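(* Let $\xi,\eta,\xi_0,\eta_0\in\mathbb{R}$ be such that $|\xi|<\xi_0$, and let $k>0$, $c>0$, $q=-\frac14c^2k^2$, $h=\frac12ck$. Then $$K_0(kr)=2\sum_{n=0}^\infty\mathrm{Ie}_n(\xi,h)\,\mathrm{ce}_n(\eta,q)\,\mathrm{Ke}_n(\xi_0,h)\,\mathrm{ce}_n(\eta_0,q)+2\sum_{n=1}^\infty\mathrm{Io}_n(\xi,h)\,\mathrm{se}_n(\eta,q)\,\mathrm{Ko}_n(\xi_0,h)\,\mathrm{se}_n(\eta_0,q),$$ where $r>0$ is given by $$r^2=c^2\left[(\cosh\xi\cos\eta-\cosh\xi_0\cos\eta_0)^2+(\sinh\xi\sin\eta-\sinh\xi_0\sin\eta_0)^2\right].$$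
   Context: $K_n(z)=\int_0^\infty e^{-z\cosh t}\cosh(nt)\,dt$ ($z>0$) and $I_n(z)=i^{-n}J_n(iz)$ are the modified Bessel functions of the second and first kind, where $J_n(z)=(z/2)^n\sum_{m=0}^\infty\frac{(-z^2/4)^m}{m!\,\Gamma(n+m+1)}$. Mathieu's equation is $u''(\eta)+(\lambda-2q\cos2\eta)u(\eta)=0$. For real $q\neq0$, $a_0(q)<a_1(q)<a_2(q)<\cdots$ are the values of $\lambda$ for which it has a nontrivial even $2\pi$-periodic solution, and $b_1(q)<b_2(q)<\cdots$ are those for which it has a nontrivial odd $2\pi$-periodic solution. $\mathrm{ce}_n(\eta,q)$ ($n\ge0$) is the real even $2\pi$-periodic solution for $\lambda=a_n(q)$, and $\mathrm{se}_n(\eta,q)$ ($n\ge1$) the real odd $2\pi$-periodic solution for $\lambda=b_n(q)$, normalized by $\int_0^{2\pi}\mathrm{ce}_n^2(\eta,q)\,d\eta=\int_0^{2\pi}\mathrm{se}_n^2(\eta,q)\,d\eta=\pi$ (the choice of sign is irrelevant here). The modified Mathieu equation is $-u''(\xi)+(\lambda-2q\cosh2\xi)u(\xi)=0$. Let $q=-h^2$ with $h>0$. For $n\ge0$ and $\lambda=a_n(q)$: $\mathrm{Ie}_n(\xi,h)$ is the even solution with $\mathrm{Ie}_n(\xi,h)\sim I_n(2h\cosh\xi)$ as $\xi\to+\infty$, and $\mathrm{Ke}_n(\xi,h)$ is the recessive solution determined by $\mathrm{Ke}_n(\xi,h)\sim K_n(2h\cosh\xi)$ as $\xi\to+\infty$.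 For $n\ge1$ and $\lambda=b_n(q)$: $\mathrm{Io}_n(\xi,h)$ is the odd solution with $\mathrm{Io}_n(\xi,h)\sim I_n(2h\cosh\xi)$ as $\xi\to+\infty$, and $\mathrm{Ko}_n(\xi,h)$ is the recessive solution determined by $\mathrm{Ko}_n(\xi,h)\sim K_n(2h\cosh\xi)$ as $\xi\to+\infty$. Here $f\sim g$ means $f/g\to1$. *)

theory Defs
  imports
    "HOL-Analysis.Analysis"
    "HOL-Library.Landau_Symbols"
    "HOL-Library.Periodic_Fun"
begin

definition bessel_J :: "nat \<Rightarrow> complex \<Rightarrow> complex" where
  "bessel_J n z =
     (z / 2) ^ n * (\<Sum>m. (- (z\<^sup>2) / 4) ^ m / (fact m * Gamma (of_nat n + of_nat m + 1)))"

definition bessel_I :: "nat \<Rightarrow> complex \<Rightarrow> complex" where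
  "bessel_I n z = \<i> powi (- int n) * bessel_J n (\<i> * z)"

(* Only meaningful for z > 0; for other z the integral diverges. *)
definition bessel_K :: "nat \<Rightarrow> real \<Rightarrow> real" where
  "bessel_K n z = integral {0..} (\<lambda>t. exp (- z * cosh t) * cosh (real n * t))"

definition even_fun :: "(real \<Rightarrow> real) \<Rightarrow> bool" where
  "even_fun u \<longleftrightarrow> (\<forall>x. u (- x) = u x)"

definition odd_fun :: "(real \<Rightarrow> real) \<Rightarrow> bool" where
  "odd_fun u \<longleftrightarrow> (\<forall>x. u (- x) = - u x)"

definition mathieu_solution :: "real \<Rightarrow> real \<Rightarrow> (real \<Rightarrow> real) \<Rightarrow> bool" where
  "mathieu_solution lam q u \<longleftrightarrow>
     (\<exists>u' u''. \<forall>x. (u has_real_derivative u' x) (at x) \<and>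
                 (u' has_real_derivative u'' x) (at x) \<and>
                 u'' x + (lam - 2 * q * cos (2 * x)) * u x = 0)"

definition modified_mathieu_solution :: "real \<Rightarrow> real \<Rightarrow> (real \<Rightarrow> real) \<Rightarrow> bool" where
  "modified_mathieu_solution lam q u \<longleftrightarrow>
     (\<exists>u' u''. \<forall>x. (u has_real_derivative u' x) (at x) \<and>
                 (u' has_real_derivative u'' x) (at x) \<and>
                 - u'' x + (lam - 2 * q * cosh (2 * x)) * u x = 0)"

definition even_eigenvalues :: "real \<Rightarrow> real set" where
  "even_eigenvalues q =
     {lam. \<exists>u. mathieu_solution lam q u \<and> even_fun u \<and> periodic_fun_simple u (2 * pi) \<and>
              (\<exists>x. u x \<noteq> 0)}"

definition odd_eigenvalues :: "real \<Rightarrow> real set" where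
  "odd_eigenvalues q =
     {lam. \<exists>u. mathieu_solution lam q u \<and> odd_fun u \<and> periodic_fun_simple u (2 * pi) \<and>
              (\<exists>x. u x \<noteq> 0)}"

(* The listing of S in increasing order, starting at index 0. It is unique if it exists. *)
definition increasing_enum :: "real set \<Rightarrow> nat \<Rightarrow> real" where
  "increasing_enum S = (THE f. strict_mono f \<and> range f = S)"

definition mathieu_a :: "nat \<Rightarrow> real \<Rightarrow> real" where
  "mathieu_a n q = increasing_enum (even_eigenvalues q) n"

(* The odd eigenvalues are numbered from 1; the value at n = 0 is irrelevant. *)
definition mathieu_b :: "nat \<Rightarrow> real \<Rightarrow> real" where
  "mathieu_b n q = increasing_enum (odd_eigenvalues q) (n - 1)"

(* ce_n and se_n are determined only up to sign by these conditions, hence predicates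
   rather than functions. *)
definition is_mathieu_ce :: "nat \<Rightarrow> real \<Rightarrow> (real \<Rightarrow> real) \<Rightarrow> bool" where
  "is_mathieu_ce n q u \<longleftrightarrow>
     mathieu_solution (mathieu_a n q) q u \<and> even_fun u \<and> periodic_fun_simple u (2 * pi) \<and>
     integral {0..2 * pi} (\<lambda>x. (u x)\<^sup>2) = pi"

definition is_mathieu_se :: "nat \<Rightarrow> real \<Rightarrow> (real \<Rightarrow> real) \<Rightarrow> bool" where
  "is_mathieu_se n q u \<longleftrightarrow>
     mathieu_solution (mathieu_b n q) q u \<and> odd_fun u \<and> periodic_fun_simple u (2 * pi) \<and>
     integral {0..2 * pi} (\<lambda>x. (u x)\<^sup>2) = pi"

(* The solutions below belong to q = -h^2 with h > 0. bessel_I is complex-valued (its values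
   at positive reals are real), so the asymptotic relation with it is stated over the complex
   numbers. *)
definition mathieu_Ie :: "nat \<Rightarrow> real \<Rightarrow> real \<Rightarrow> real" where
  "mathieu_Ie n h =
     (THE u. modified_mathieu_solution (mathieu_a n (- (h\<^sup>2))) (- (h\<^sup>2)) u \<and> even_fun u \<and>
        (\<lambda>x. complex_of_real (u x)) \<sim>[at_top] (\<lambda>x. bessel_I n (complex_of_real (2 * h * cosh x))))"

definition mathieu_Io :: "nat \<Rightarrow> real \<Rightarrow> real \<Rightarrow> real" where
  "mathieu_Io n h =
     (THE u. modified_mathieu_solution (mathieu_b n (- (h\<^sup>2))) (- (h\<^sup>2)) u \<and> odd_fun u \<and>
        (\<lambda>x. complex_of_real (u x)) \<sim>[at_top] (\<lambda>x. bessel_I n (complex_of_real (2 * h * cosh x))))"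

(* Being asymptotic to K_n(2 h cosh x), these are recessive at infinity; a solution with this
   behaviour is unique. *)
definition mathieu_Ke :: "nat \<Rightarrow> real \<Rightarrow> real \<Rightarrow> real" where
  "mathieu_Ke n h =
     (THE u. modified_mathieu_solution (mathieu_a n (- (h\<^sup>2))) (- (h\<^sup>2)) u \<and>
        u \<sim>[at_top] (\<lambda>x. bessel_K n (2 * h * cosh x)))"

definition mathieu_Ko :: "nat \<Rightarrow> real \<Rightarrow> real \<Rightarrow> real" where
  "mathieu_Ko n h =
     (THE u. modified_mathieu_solution (mathieu_b n (- (h\<^sup>2))) (- (h\<^sup>2)) u \<and>
        u \<sim>[at_top] (\<lambda>x. bessel_K n (2 * h * cosh x)))"

end

theory Submission
  imports Defs "HOL-Complex_Analysis.Great_Picard" "HOL-Probability.Distributions" "HOL-Real_Asymp.Real_Asymp"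
begin

text \<open>In elliptic coordinates \<open>K\<^sub>0(k r)\<close> separates: integrated over \<open>\<eta>\<close> against an angular function
  \<open>u\<close> (one of the \<open>ce\<^sub>n\<close>, \<open>se\<^sub>n\<close>) it solves the modified Mathieu equation as a function of \<open>\<xi>\<^sub>0\<close>.
  As \<open>\<xi>\<^sub>0 \<rightarrow> \<infinity>\<close>, \<open>K\<^sub>0(k r)\<close> becomes a multiple of a plane wave, whose integral against \<open>u\<close> solves the
  modified equation in \<open>\<xi>\<close> and, by Laplace's method, equals \<open>2\<pi> u(\<eta>\<^sub>0)\<close> times the dominant solution
  \<open>Ie\<^sub>n\<close> or \<open>Io\<^sub>n\<close>. Since a recessive solution is determined by its leading coefficient, the integral
  of \<open>K\<^sub>0(k r)\<close> is \<open>2\<pi> u(\<eta>\<^sub>0)\<close> times the product of the dominant and the recessive solution; these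
  integrals also provide the existence of both. It remains to expand \<open>K\<^sub>0(k r)\<close>, a smooth periodic
  function of \<open>\<eta>\<close>, into angular functions. Its even and odd parts live on \<open>[0, \<pi>]\<close> with Neumann and
  Dirichlet conditions, where the inverse of a shifted Mathieu operator is compact and positive.
  All \<open>I\<^sub>n\<close> have the same leading behaviour, and so do all \<open>K\<^sub>n\<close>; hence the numbering of the
  eigenvalues enters only through the fact that it exhausts them.\<close>

section \<open>Linear second order equations\<close>

text \<open>What makes the separation possible is a symmetry: the distance of the two points is
  unchanged when their radial coordinates alone are exchanged. Hence the separated partial
  differential equation holds in the mixed pair \<open>\<xi>\<^sub>0\<close>, \<eta>, taken from
  different points, and integrating out \<eta> leaves an equation in \<open>\<xi>\<^sub>0\<close>.
  The strict bound of |\<xi>| by \<open>\<xi>\<^sub>0\<close> keeps the points apart for all angles,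
  so the singularity of the kernel is never met. The spectral part lives on continuous functions
  with the L2 product, an incomplete space: a maximizing sequence need not converge, only its images
  under the operator do, so limits are taken after one more application of the operator. The same
  operator turns L2 bounds into uniform ones, which makes the series converge at every point. The
  factor 2 of the theorem: the integral of the kernel against an angular function over a full period
  carries 2 pi, the squared norm on [0, pi] is pi / 2, and the quotient 4 belongs to the functions
  g(\<eta>) + g(-\<eta>) and g(\<eta>) - g(-\<eta>), which add up to 2 g(\<eta>).\<close>

definition hill_solution_on ::
    "real set \<Rightarrow> (real \<Rightarrow> real) \<Rightarrow> (real \<Rightarrow> real) \<Rightarrow> (real \<Rightarrow> real) \<Rightarrow> bool" where
  "hill_solution_on S Q u u' \<longleftrightarrow>
     (\<forall>x\<in>S. (u has_real_derivative u' x) (at x) \<and> (u' has_real_derivative Q x * u x) (at x))"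

lemma hill_solution_onD:
  assumes "hill_solution_on S Q u u'" "x \<in> S"
  shows "(u has_real_derivative u' x) (at x)" "(u' has_real_derivative Q x * u x) (at x)"
  using assms by (auto simp: hill_solution_on_def)

lemma hill_solution_on_subset:
  "hill_solution_on S Q u u' \<Longrightarrow> T \<subseteq> S \<Longrightarrow> hill_solution_on T Q u u'"
  by (auto simp: hill_solution_on_def)

lemma hill_solution_on_continuous:
  assumes "hill_solution_on S Q u u'"
  shows "continuous_on S u" "continuous_on S u'"
  using hill_solution_onD[OF assms]
  by (auto intro!: continuous_at_imp_continuous_on DERIV_isCont)

lemma hill_solution_on_lincomb:
  assumes "hill_solution_on S Q u u'" "hill_solution_on S Q v v'"
  shows "hill_solution_on S Q (\<lambda>x. a * u x + b * v x) (\<lambda>x. a * u' x + b * v' x)"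
  unfolding hill_solution_on_def
  by (auto intro!: derivative_eq_intros hill_solution_onD[OF assms(1)] hill_solution_onD[OF assms(2)]
      simp: algebra_simps)

text \<open>Reflection in the point p / 2. The value p = pi turns the solution adapted to one end of
  [0, pi] into the one adapted to the other end; p = 0 and p = 2 pi yield parity and
  periodicity.\<close>

lemma hill_solution_on_reflect:
  assumes "hill_solution_on UNIV Q u u'" and Q: "\<And>x. Q (p - x) = Q x"
  shows "hill_solution_on UNIV Q (\<lambda>x. u (p - x)) (\<lambda>x. - u' (p - x))"
proof -
  note d = hill_solution_onD[OF assms(1) UNIV_I]
  have d0: "((\<lambda>x. p - x) has_real_derivative -1) (at x)" for x
    by (auto intro!: derivative_eq_intros)
  have "((\<lambda>x. u (p - x)) has_real_derivative u' (p - x) * -1) (at x)"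
    "((\<lambda>x. u' (p - x)) has_real_derivative (Q (p - x) * u (p - x)) * -1) (at x)" for x
    by (rule DERIV_chain2[where g = "\<lambda>x. p - x", OF d(1) d0],
        rule DERIV_chain2[where g = "\<lambda>x. p - x", OF d(2) d0])
  from this(1) DERIV_minus[OF this(2)] have "((\<lambda>x. u (p - x)) has_real_derivative - u' (p - x)) (at x)"
    "((\<lambda>x. - u' (p - x)) has_real_derivative Q x * u (p - x)) (at x)" for x
    using Q by simp_all
  then show ?thesis by (simp add: hill_solution_on_def)
qed

lemma hill_solution_on_shift:
  assumes "hill_solution_on UNIV (\<lambda>x. Q (x + p)) u u'"
  shows "hill_solution_on UNIV Q (\<lambda>x. u (x - p)) (\<lambda>x. u' (x - p))"
proof -
  note d = hill_solution_onD[OF assms UNIV_I]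
  have d0: "((\<lambda>x. x - p) has_real_derivative 1) (at x)" for x
    by (auto intro!: derivative_eq_intros)
  have "((\<lambda>x. u (x - p)) has_real_derivative u' (x - p)) (at x)"
    "((\<lambda>x. u' (x - p)) has_real_derivative Q x * u (x - p)) (at x)" for x
    using DERIV_chain2[where g = "\<lambda>x. x - p" and Db = 1 and x = x and s = UNIV, OF d(1) d0]
      DERIV_chain2[where g = "\<lambda>x. x - p" and Db = 1 and x = x and s = UNIV, OF d(2) d0]
    by auto
  then show ?thesis by (simp add: hill_solution_on_def)
qed

text \<open>Gronwall: with \<open>E = u\<^sup>2 + u'\<^sup>2\<close> and \<open>\<bar>Q\<bar> \<le> M\<close>, the functions \<open>E e\<^sup>K\<^sup>x\<close> and \<open>E e\<^sup>-\<^sup>K\<^sup>x\<close>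
  with \<open>K = 1 + M\<close> are monotone.\<close>

lemma hill_solution_zero:
  assumes sol: "hill_solution_on S Q u u'" and S: "is_interval S" and Q: "continuous_on S Q"
    and x0: "x0 \<in> S" "u x0 = 0" "u' x0 = 0" and x: "x \<in> S"
  shows "u x = 0 \<and> u' x = 0"
proof -
  define I where "I = {min x0 x..max x0 x}"
  have IS: "I \<subseteq> S"
  proof
    fix t assume "t \<in> I"
    then have "min x0 x \<le> t" "t \<le> max x0 x" by (auto simp: I_def)
    moreover have "min x0 x \<in> S" "max x0 x \<in> S" using x0(1) x by (auto simp: min_def max_def)
    ultimately show "t \<in> S" using mem_is_interval_1_I[OF S] by blast
  qed
  have "bounded (Q ` I)"
    using continuous_on_subset[OF Q IS] by (intro compact_imp_bounded compact_continuous_image) (auto simp: I_def)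
  then obtain M where M: "\<And>t. t \<in> I \<Longrightarrow> \<bar>Q t\<bar> \<le> M"
    unfolding bounded_iff by auto
  define K where "K = 1 + M"
  define E where "E t = (u t)\<^sup>2 + (u' t)\<^sup>2" for t
  define E' where "E' t = 2 * u t * u' t + 2 * u' t * (Q t * u t)" for t
  have dE: "(E has_real_derivative E' t) (at t)" if "t \<in> I" for t
    unfolding E_def E'_def using that IS
    by (auto intro!: derivative_eq_intros hill_solution_onD[OF sol])
  have bE: "\<bar>E' t\<bar> \<le> K * E t" if "t \<in> I" for t
  proof -
    have "\<bar>E' t\<bar> = \<bar>1 + Q t\<bar> * \<bar>2 * u t * u' t\<bar>"
      unfolding E'_def abs_mult[symmetric] by (simp add: algebra_simps)
    also have "\<dots> \<le> K * E t"
    proof (rule mult_mono)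
      show "\<bar>1 + Q t\<bar> \<le> K" using M[OF that] by (simp add: K_def)
      show "\<bar>2 * u t * u' t\<bar> \<le> E t"
        using zero_le_power2[of "u t - u' t"] zero_le_power2[of "u t + u' t"]
        unfolding E_def by (auto simp: power2_eq_square algebra_simps abs_le_iff)
      show "0 \<le> K" using M[OF that] by (simp add: K_def)
    qed auto
    finally show ?thesis .
  qed
  have E0: "E x0 = 0" using x0 by (simp add: E_def)
  have "E x \<le> 0"
  proof (cases "x0 \<le> x")
    case True
    have "E x * exp (- K * x) \<le> E x0 * exp (- K * x0)"
    proof (rule DERIV_nonpos_imp_nonincreasing[OF True])
      fix t assume t: "x0 \<le> t" "t \<le> x"
      then have tI: "t \<in> I" by (auto simp: I_def)
      have "((\<lambda>x. E x * exp (- K * x)) has_real_derivative (E' t - K * E t) * exp (- K * t)) (at t)"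
        by (auto intro!: derivative_eq_intros dE[OF tI] simp: algebra_simps)
      moreover have "(E' t - K * E t) * exp (- K * t) \<le> 0"
        using bE[OF tI] by (intro mult_nonpos_nonneg) auto
      ultimately show "\<exists>y. ((\<lambda>x. E x * exp (- K * x)) has_real_derivative y) (at t) \<and> y \<le> 0"
        by blast
    qed
    then show ?thesis using E0 by (simp add: mult_le_0_iff)
  next
    case False
    then have le: "x \<le> x0" by simp
    have "E x * exp (K * x) \<le> E x0 * exp (K * x0)"
    proof (rule DERIV_nonneg_imp_nondecreasing[OF le])
      fix t assume t: "x \<le> t" "t \<le> x0"
      then have tI: "t \<in> I" by (auto simp: I_def)
      have "((\<lambda>x. E x * exp (K * x)) has_real_derivative (E' t + K * E t) * exp (K * t)) (at t)"
        by (auto intro!: derivative_eq_intros dE[OF tI] simp: algebra_simps)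
      moreover have "(E' t + K * E t) * exp (K * t) \<ge> 0"
        using bE[OF tI] by (intro mult_nonneg_nonneg) auto
      ultimately show "\<exists>y. ((\<lambda>x. E x * exp (K * x)) has_real_derivative y) (at t) \<and> y \<ge> 0"
        by blast
    qed
    then show ?thesis using E0 by (simp add: mult_le_0_iff)
  qed
  then show ?thesis by (simp add: E_def sum_power2_le_zero_iff)
qed

lemma hill_solution_unique:
  assumes "hill_solution_on S Q u u'" "hill_solution_on S Q v v'" "is_interval S" "continuous_on S Q"
    "x0 \<in> S" "u x0 = v x0" "u' x0 = v' x0" "x \<in> S"
  shows "u x = v x" "u' x = v' x"
  using hill_solution_zero[OF hill_solution_on_lincomb[OF assms(1,2), of 1 "-1"] assms(3,4,5) _ _ assms(8)]
    assms(6,7) by auto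

section \<open>Global solutions of the initial value problem by Picard iteration\<close>

definition primitive :: "(real \<Rightarrow> real) \<Rightarrow> real \<Rightarrow> real" where
  "primitive f x = integral {0..x} f - integral {x..0} f"

lemma primitive_0 [simp]: "primitive f 0 = 0"
  by (simp add: primitive_def)

text \<open>Around x, on an interval {-R<..<R} that contains x and 0, the signed integral from 0
  differs by a constant from the integral from -R, to which the fundamental theorem applies.\<close>

lemma has_real_derivative_primitive:
  assumes "continuous_on UNIV f"
  shows "(primitive f has_real_derivative f x) (at x)"
proof -
  define R where "R = \<bar>x\<bar> + 1"
  have int: "f integrable_on {a..b}" for a b
    using assms continuous_on_subset integrable_continuous_interval by blast
  have eq: "primitive f t = integral {-R..t} f - integral {-R..0} f" if "t \<in> {-R..R}" for t
  proof (cases "0 \<le> t")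
    case True
    then have "integral {-R..0} f + integral {0..t} f = integral {-R..t} f"
      using that by (intro Henstock_Kurzweil_Integration.integral_combine int) (auto simp: R_def)
    moreover have "integral {t..0} f = 0" using True by (cases "t = 0") auto
    ultimately show ?thesis by (simp add: primitive_def)
  next
    case False
    then have "integral {-R..t} f + integral {t..0} f = integral {-R..0} f"
      using that by (intro Henstock_Kurzweil_Integration.integral_combine int) (auto simp: R_def)
    then show ?thesis using False by (simp add: primitive_def)
  qed
  have x: "x \<in> {-R<..<R}" by (auto simp: R_def)
  have "((\<lambda>t. integral {-R..t} f) has_real_derivative f x) (at x within {-R..R})"
    using x by (intro integral_has_real_derivative continuous_on_subset[OF assms]) auto
  then have "((\<lambda>t. integral {-R..t} f) has_real_derivative f x) (at x)"
    using x by (simp add: at_within_Icc_at)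
  then have "((\<lambda>t. integral {-R..t} f - integral {-R..0} f) has_real_derivative f x) (at x)"
    by (auto intro!: derivative_eq_intros)
  then show ?thesis
    by (rule has_field_derivative_transform_within_open[where S = "{-R<..<R}"])
      (use x eq in auto)
qed

lemma continuous_on_primitive:
  "continuous_on UNIV f \<Longrightarrow> continuous_on S (primitive f)"
  by (auto intro!: continuous_at_imp_continuous_on DERIV_isCont has_real_derivative_primitive)

text \<open>Each integration raises the power of |x| and divides by the new exponent; this is the
  source of the factorials in the Picard estimates. Negative x are handled through the function
  F(-x).\<close>

lemma abs_le_of_deriv_bound:
  fixes F f :: "real \<Rightarrow> real"
  assumes F0: "F 0 = 0" and F: "\<And>t. \<bar>t\<bar> \<le> R \<Longrightarrow> (F has_real_derivative f t) (at t)"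
    and f: "\<And>t. \<bar>t\<bar> \<le> R \<Longrightarrow> \<bar>f t\<bar> \<le> C * \<bar>t\<bar> ^ n" and x: "\<bar>x\<bar> \<le> R"
  shows "\<bar>F x\<bar> \<le> C * \<bar>x\<bar> ^ Suc n / Suc n"
proof -
  have main: "G y \<le> C * y ^ Suc n / Suc n"
    if "G 0 = 0" "\<And>t. \<lbrakk>0 \<le> t; t \<le> y\<rbrakk> \<Longrightarrow> (G has_real_derivative g t) (at t)"
      "\<And>t. \<lbrakk>0 \<le> t; t \<le> y\<rbrakk> \<Longrightarrow> g t \<le> C * t ^ n" "0 \<le> y" for G g y
  proof -
    have "G y - C * y ^ Suc n / Suc n \<le> G 0 - C * 0 ^ Suc n / Suc n"
    proof (rule DERIV_nonpos_imp_nonincreasing[OF \<open>0 \<le> y\<close>])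
      fix t assume t: "0 \<le> t" "t \<le> y"
      have "((\<lambda>y. G y - C * y ^ Suc n / Suc n) has_real_derivative g t - C * t ^ n) (at t)"
      proof -
        have "((\<lambda>y. C * y ^ Suc n / Suc n) has_real_derivative C * (Suc n * t ^ n) / Suc n) (at t)"
          using DERIV_pow[of "Suc n" t] by (intro DERIV_cdivide DERIV_cmult) simp
        also have "C * (Suc n * t ^ n) / Suc n = C * t ^ n" by simp
        finally show ?thesis by (rule DERIV_diff[OF that(2)[OF t]])
      qed
      with that(3)[OF t] show "\<exists>z. ((\<lambda>y. G y - C * y ^ Suc n / Suc n) has_real_derivative z) (at t) \<and> z \<le> 0"
        by (intro exI[of _ "g t - C * t ^ n"]) auto
    qed
    then show ?thesis using that(1) by simp
  qed
  show ?thesis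
  proof (cases "0 \<le> x")
    case True
    have f': "\<bar>f t\<bar> \<le> C * t ^ n" if "0 \<le> t" "t \<le> x" for t
      using f[of t] that x by auto
    have "F x \<le> C * x ^ Suc n / Suc n"
      by (rule main[where g = f]) (use True x F f' F0 in \<open>auto simp: abs_le_iff\<close>)
    moreover have "- F x \<le> C * x ^ Suc n / Suc n"
      by (rule main[where g = "\<lambda>t. - f t"])
        (use True x F f' F0 in \<open>auto simp: abs_le_iff intro!: derivative_eq_intros\<close>)
    ultimately show ?thesis using True by (simp add: abs_le_iff)
  next
    case False
    have d: "((\<lambda>x. F (- x)) has_real_derivative - f (- t)) (at t)" if "\<bar>t\<bar> \<le> R" for t
    proof -
      have "((\<lambda>x. - x) has_real_derivative -1) (at t)" by (auto intro!: derivative_eq_intros)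
      moreover have "(F has_real_derivative f (- t)) (at (- t))" using F[of "- t"] that by simp
      ultimately show ?thesis
        using DERIV_chain2[where f = F and g = "\<lambda>x. - x" and x = t and s = UNIV] by fastforce
    qed
    have f': "\<bar>f (- t)\<bar> \<le> C * t ^ n" if "0 \<le> t" "t \<le> - x" for t
      using f[of "-t"] that x by auto
    have "F (- (- x)) \<le> C * (- x) ^ Suc n / Suc n"
      by (rule main[where g = "\<lambda>t. - f (- t)"])
        (use False x d f' F0 in \<open>auto simp: abs_le_iff\<close>)
    moreover have "- F (- (- x)) \<le> C * (- x) ^ Suc n / Suc n"
      by (rule main[where g = "\<lambda>t. f (- t)" and G = "\<lambda>x. - F (- x)"])
        (use False x DERIV_minus[OF d] f' F0 in \<open>auto simp: abs_le_iff\<close>)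
    ultimately show ?thesis using False by (simp add: abs_le_iff)
  qed
qed

context
  fixes Q :: "real \<Rightarrow> real" and a b :: real
begin

text \<open>These are the terms of the Picard series and not its partial sums: each one is the
  double primitive of Q times the preceding one, and the solution is the sum over all n. The zeroth
  term carries the initial values a and b.\<close>

primrec picard :: "nat \<Rightarrow> real \<Rightarrow> real" where
  "picard 0 = (\<lambda>x. a + b * x)"
| "picard (Suc n) = primitive (primitive (\<lambda>t. Q t * picard n t))"

definition picard_deriv :: "nat \<Rightarrow> real \<Rightarrow> real" where
  "picard_deriv n = (case n of 0 \<Rightarrow> (\<lambda>x. b) | Suc m \<Rightarrow> primitive (\<lambda>t. Q t * picard m t))"

definition picard_deriv2 :: "nat \<Rightarrow> real \<Rightarrow> real" where
  "picard_deriv2 n = (case n of 0 \<Rightarrow> (\<lambda>x. 0) | Suc m \<Rightarrow> (\<lambda>x. Q x * picard m x))"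

context
  assumes Q: "continuous_on UNIV Q"
begin

lemma picard_props:
  "continuous_on UNIV (picard n)"
  "continuous_on UNIV (picard_deriv n)"
  "(picard n has_real_derivative picard_deriv n x) (at x)"
  "(picard_deriv n has_real_derivative picard_deriv2 n x) (at x)"
proof -
  have c: "continuous_on UNIV (picard n)" for n
    by (induction n) (auto intro!: continuous_intros continuous_on_primitive Q)
  then have c1: "continuous_on UNIV (\<lambda>t. Q t * picard n t)" for n
    by (auto intro!: continuous_intros Q)
  show "continuous_on UNIV (picard n)" by (rule c)
  show "continuous_on UNIV (picard_deriv n)"
    by (cases n) (auto simp: picard_deriv_def intro!: continuous_on_primitive c1)
  show "(picard n has_real_derivative picard_deriv n x) (at x)"
    by (cases n) (auto simp: picard_deriv_def intro!: derivative_eq_intros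
        has_real_derivative_primitive continuous_on_primitive c1)
  show "(picard_deriv n has_real_derivative picard_deriv2 n x) (at x)"
    by (cases n) (auto simp: picard_deriv_def picard_deriv2_def
        intro!: has_real_derivative_primitive c1)
qed

text \<open>Two integrations per step would give |x| ^ (2 n) over (2 n)!. The coarser |x| ^ n over
  n! is enough for convergence: of the second integration only a factor R is kept, and its
  denominator is dropped.\<close>

lemma picard_bounds:
  assumes M: "\<And>t. \<bar>t\<bar> \<le> R \<Longrightarrow> \<bar>Q t\<bar> \<le> M" and x: "\<bar>x\<bar> \<le> R"
  defines "A \<equiv> \<bar>a\<bar> + \<bar>b\<bar> * R"
  shows "\<bar>picard n x\<bar> \<le> A * (M * R) ^ n / fact n * \<bar>x\<bar> ^ n"
    "\<bar>picard_deriv (Suc n) x\<bar> \<le> M * A * (M * R) ^ n / fact (Suc n) * \<bar>x\<bar> ^ Suc n"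
proof -
  have R: "R \<ge> 0" using x by linarith
  have M0: "M \<ge> 0" using M[of 0] R by auto
  have A0: "A \<ge> 0" using R by (auto simp: A_def)
  have step: "\<bar>picard_deriv (Suc n) x\<bar> \<le> M * A * (M * R) ^ n / fact (Suc n) * \<bar>x\<bar> ^ Suc n"
    if IH: "\<And>x. \<bar>x\<bar> \<le> R \<Longrightarrow> \<bar>picard n x\<bar> \<le> A * (M * R) ^ n / fact n * \<bar>x\<bar> ^ n" and x: "\<bar>x\<bar> \<le> R" for n x
  proof -
    have "\<bar>picard_deriv (Suc n) x\<bar> \<le> M * (A * (M * R) ^ n / fact n) * \<bar>x\<bar> ^ Suc n / Suc n"
    proof (rule abs_le_of_deriv_bound[where R = R])
      show "picard_deriv (Suc n) 0 = 0" by (simp add: picard_deriv_def)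
      show "(picard_deriv (Suc n) has_real_derivative Q t * picard n t) (at t)" for t
        using picard_props(4)[of "Suc n" t] by (simp add: picard_deriv2_def)
      show "\<bar>Q t * picard n t\<bar> \<le> M * (A * (M * R) ^ n / fact n) * \<bar>t\<bar> ^ n" if "\<bar>t\<bar> \<le> R" for t
        using mult_mono[OF M[OF that] IH[OF that] M0] by (simp add: abs_mult mult.assoc)
    qed (rule x)
    also have "\<dots> = M * A * (M * R) ^ n / fact (Suc n) * \<bar>x\<bar> ^ Suc n"
      by (simp add: field_simps)
    finally show ?thesis .
  qed
  have main: "\<bar>picard n x\<bar> \<le> A * (M * R) ^ n / fact n * \<bar>x\<bar> ^ n" if "\<bar>x\<bar> \<le> R" for n x
    using that
  proof (induction n arbitrary: x)
    case 0
    have "\<bar>a + b * x\<bar> \<le> \<bar>a\<bar> + \<bar>b\<bar> * \<bar>x\<bar>" using abs_triangle_ineq[of a "b * x"] by (simp add: abs_mult)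
    also have "\<dots> \<le> A" using 0 by (auto simp: A_def intro: mult_left_mono)
    finally show ?case by simp
  next
    case (Suc n)
    have "\<bar>picard (Suc n) x\<bar> \<le> M * A * (M * R) ^ n / fact (Suc n) * \<bar>x\<bar> ^ Suc (Suc n) / Suc (Suc n)"
    proof (rule abs_le_of_deriv_bound[where R = R])
      show "picard (Suc n) 0 = 0" by simp
      show "(picard (Suc n) has_real_derivative picard_deriv (Suc n) t) (at t)" for t
        by (rule picard_props(3))
      show "\<bar>picard_deriv (Suc n) t\<bar> \<le> M * A * (M * R) ^ n / fact (Suc n) * \<bar>t\<bar> ^ Suc n" if "\<bar>t\<bar> \<le> R" for t
        by (rule step[OF Suc.IH that])
    qed (rule Suc.prems)
    also have "\<dots> \<le> M * A * (M * R) ^ n / fact (Suc n) * \<bar>x\<bar> ^ Suc (Suc n)"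
    proof -
      have "0 \<le> M * A * (M * R) ^ n / fact (Suc n) * \<bar>x\<bar> ^ Suc (Suc n)" (is "0 \<le> ?B") using M0 A0 R by simp
      then have "?B / Suc (Suc n) \<le> ?B / 1" by (intro divide_left_mono) auto
      then show ?thesis by simp
    qed
    also have "\<dots> \<le> M * A * (M * R) ^ n / fact (Suc n) * (R * \<bar>x\<bar> ^ Suc n)"
      using Suc.prems M0 A0 R by (intro mult_left_mono) (auto intro: mult_right_mono)
    also have "\<dots> = A * (M * R) ^ Suc n / fact (Suc n) * \<bar>x\<bar> ^ Suc n" by simp
    finally show ?case .
  qed
  show "\<bar>picard n x\<bar> \<le> A * (M * R) ^ n / fact n * \<bar>x\<bar> ^ n" by (rule main[OF x])
  show "\<bar>picard_deriv (Suc n) x\<bar> \<le> M * A * (M * R) ^ n / fact (Suc n) * \<bar>x\<bar> ^ Suc n"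
    by (rule step[OF main x])
qed

lemma summable_exp_shifted: "summable (\<lambda>n. (X::real) ^ n / fact (Suc n))"
proof (rule summable_comparison_test'[where N = 0])
  show "summable (\<lambda>n. \<bar>X\<bar> ^ n / fact n)"
    using summable_exp[of "\<bar>X\<bar>"] by (simp add: field_simps)
  show "norm (X ^ n / fact (Suc n)) \<le> \<bar>X\<bar> ^ n / fact n" for n
    by (simp add: power_abs[symmetric] divide_simps abs_mult del: fact_Suc) (simp add: mult_left_mono)
qed

text \<open>The bounds give uniform convergence on bounded intervals only, so each x is treated
  inside its own interval of radius |x| + 1. Termwise differentiation is applied twice, and the
  series of second derivatives, shifted by one index, is Q times the solution.\<close>

lemma hill_initial_value_aux:
  "\<exists>u u'. u 0 = a \<and> u' 0 = b \<and> hill_solution_on UNIV Q u u'"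
proof -
  define u where "u x = (\<Sum>n. picard n x)" for x
  define u' where "u' x = (\<Sum>n. picard_deriv n x)" for x
  have "(u has_real_derivative u' x) (at x) \<and> (u' has_real_derivative Q x * u x) (at x)" for x
  proof -
    define R where "R = \<bar>x\<bar> + 1"
    define S where "S = {-R..R}"
    have S: "\<bar>t\<bar> \<le> R" if "t \<in> S" for t using that by (auto simp: S_def)
    have "bounded (Q ` S)"
      by (intro compact_imp_bounded compact_continuous_image continuous_on_subset[OF Q]) (auto simp: S_def)
    then obtain M where "\<And>t. t \<in> S \<Longrightarrow> \<bar>Q t\<bar> \<le> M"
      unfolding bounded_iff by auto
    then have M: "\<And>t. \<bar>t\<bar> \<le> R \<Longrightarrow> \<bar>Q t\<bar> \<le> M" by (auto simp: S_def abs_le_iff)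
    define A where "A = \<bar>a\<bar> + \<bar>b\<bar> * R"
    have R0: "R > 0" by (simp add: R_def)
    have M0: "M \<ge> 0" using M[of 0] R0 by auto
    have A0: "A \<ge> 0" using R0 by (auto simp: A_def)
    define B where "B n = A * ((M * R * R) ^ n / fact n)" for n
    define B1 where "B1 n = M * A * R * ((M * R * R) ^ n / fact (Suc n))" for n
    have sB: "summable B" unfolding B_def
      using summable_exp[of "M * R * R"] by (intro summable_mult) (simp add: field_simps)
    have sB1: "summable B1" unfolding B1_def
      by (intro summable_mult summable_exp_shifted)
    have b: "\<bar>picard n t\<bar> \<le> B n" if "t \<in> S" for n t
    proof -
      have "\<bar>picard n t\<bar> \<le> A * (M * R) ^ n / fact n * \<bar>t\<bar> ^ n"
        unfolding A_def by (rule picard_bounds(1)[OF M S[OF that]])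
      also have "\<dots> \<le> A * (M * R) ^ n / fact n * R ^ n"
        using S[OF that] A0 M0 R0 by (intro mult_left_mono power_mono) auto
      finally show ?thesis by (simp add: B_def power_mult_distrib mult_ac)
    qed
    have b1: "\<bar>picard_deriv (Suc n) t\<bar> \<le> B1 n" if "t \<in> S" for n t
    proof -
      have "\<bar>picard_deriv (Suc n) t\<bar> \<le> M * A * (M * R) ^ n / fact (Suc n) * \<bar>t\<bar> ^ Suc n"
        unfolding A_def by (rule picard_bounds(2)[OF M S[OF that]])
      also have "\<dots> \<le> M * A * (M * R) ^ n / fact (Suc n) * R ^ Suc n"
        using S[OF that] A0 M0 R0 by (intro mult_left_mono power_mono) auto
      finally show ?thesis by (simp add: B1_def power_mult_distrib mult_ac del: fact_Suc)
    qed
    have uc1: "uniformly_convergent_on S (\<lambda>n x. \<Sum>i<n. picard_deriv i x)"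
    proof (rule Weierstrass_m_test'[where M = "\<lambda>n. case n of 0 \<Rightarrow> \<bar>b\<bar> | Suc m \<Rightarrow> B1 m"])
      show "norm (picard_deriv n t) \<le> (case n of 0 \<Rightarrow> \<bar>b\<bar> | Suc m \<Rightarrow> B1 m)" if "t \<in> S" for n t
        using b1[OF that] by (cases n) (auto simp: picard_deriv_def)
      show "summable (\<lambda>n. case n of 0 \<Rightarrow> \<bar>b\<bar> | Suc m \<Rightarrow> B1 m)"
        by (subst summable_Suc_iff[symmetric]) (simp add: sB1)
    qed
    have uc2: "uniformly_convergent_on S (\<lambda>n x. \<Sum>i<n. picard_deriv2 i x)"
    proof (rule Weierstrass_m_test'[where M = "\<lambda>n. case n of 0 \<Rightarrow> 0 | Suc m \<Rightarrow> M * B m"])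
      show "norm (picard_deriv2 n t) \<le> (case n of 0 \<Rightarrow> 0 | Suc m \<Rightarrow> M * B m)" if "t \<in> S" for n t
        using mult_mono[OF M[OF S[OF that]] b[OF that] M0]
        by (cases n) (auto simp: picard_deriv2_def abs_mult)
      show "summable (\<lambda>n. case n of 0 \<Rightarrow> 0 | Suc m \<Rightarrow> M * B m)"
        by (subst summable_Suc_iff[symmetric]) (simp add: sB summable_mult)
    qed
    have x: "x \<in> interior S" "x \<in> S" by (auto simp: S_def R_def)
    have conv: "convex S" by (simp add: S_def)
    have s0: "summable (\<lambda>n. picard n x)"
      by (rule summable_comparison_test'[OF sB]) (use b[OF x(2)] in auto)
    have s1: "summable (\<lambda>n. picard_deriv n x)"
      by (subst summable_Suc_iff[symmetric], rule summable_comparison_test'[OF sB1])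
        (use b1[OF x(2)] in auto)
    have d1: "(u has_real_derivative u' x) (at x)"
      unfolding u_def u'_def
      by (rule has_field_derivative_series'(2)[where f = picard, OF conv _ uc1 x(2) s0 x(1)])
        (auto intro: DERIV_subset picard_props)
    have d2: "(u' has_real_derivative (\<Sum>n. picard_deriv2 n x)) (at x)"
      unfolding u'_def
      by (rule has_field_derivative_series'(2)[where f = picard_deriv, OF conv _ uc2 x(2) s1 x(1)])
        (auto intro: DERIV_subset picard_props)
    have "(\<lambda>n. picard_deriv2 (Suc n) x) sums (Q x * u x)"
      unfolding picard_deriv2_def u_def using s0 by (auto intro: sums_mult summable_sums)
    then have "(\<lambda>n. picard_deriv2 n x) sums (Q x * u x)"
      using sums_Suc[of "\<lambda>n. picard_deriv2 n x"] by (simp add: picard_deriv2_def)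
    with d1 d2 show ?thesis by (simp add: sums_iff)
  qed
  moreover have "u 0 = a"
  proof -
    have "(\<lambda>n. picard n 0) = (\<lambda>n. if n = 0 then a else 0)"
    proof
      show "picard n 0 = (if n = 0 then a else 0)" for n by (cases n) auto
    qed
    then show ?thesis using sums_single[of 0 "\<lambda>_. a"] by (simp add: u_def sums_iff)
  qed
  moreover have "u' 0 = b"
  proof -
    have "picard_deriv n 0 = (if n = 0 then b else 0)" for n by (cases n) (auto simp: picard_deriv_def)
    then have "(\<lambda>n. picard_deriv n 0) = (\<lambda>n. if n = 0 then b else 0)" by auto
    then show ?thesis using sums_single[of 0 "\<lambda>_. b"] by (simp add: u'_def sums_iff)
  qed
  ultimately show ?thesis unfolding hill_solution_on_def by blast
qed

end

end

lemma hill_initial_value: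
  fixes Q :: "real \<Rightarrow> real"
  assumes "continuous_on UNIV Q"
  shows "\<exists>u u'. u p = a \<and> u' p = b \<and> hill_solution_on UNIV Q u u'"
proof -
  have "continuous_on UNIV (\<lambda>x. Q (x + p))"
    by (intro continuous_on_compose2[OF assms] continuous_intros) auto
  from hill_initial_value_aux[OF this, of a b] obtain u u'
    where "u 0 = a" "u' 0 = b" "hill_solution_on UNIV (\<lambda>x. Q (x + p)) u u'" by blast
  then show ?thesis
    by (intro exI[of _ "\<lambda>x. u (x - p)"] exI[of _ "\<lambda>x. u' (x - p)"]) (auto intro: hill_solution_on_shift)
qed

section \<open>Compact positive operators on an interval\<close>

lemma tendsto_zero_of_square_le:
  fixes f g :: "nat \<Rightarrow> real"
  assumes "\<And>n. (f n)\<^sup>2 \<le> g n" "g \<longlonglongrightarrow> 0"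
  shows "f \<longlonglongrightarrow> 0"
proof -
  have "(\<lambda>n. (f n)\<^sup>2) \<longlonglongrightarrow> 0"
    by (rule tendsto_sandwich[OF _ _ tendsto_const assms(2)]) (auto simp: assms(1))
  from tendsto_real_sqrt[OF this] show ?thesis by (simp add: tendsto_rabs_zero_iff)
qed

section \<open>The L2 inner product on the continuous functions of an interval\<close>

locale interval_inner =
  fixes a b :: real
  assumes ab: "a < b"
begin

abbreviation cont :: "(real \<Rightarrow> real) \<Rightarrow> bool" where
  "cont f \<equiv> continuous_on {a..b} f"

definition ip :: "(real \<Rightarrow> real) \<Rightarrow> (real \<Rightarrow> real) \<Rightarrow> real" where
  "ip f g = integral {a..b} (\<lambda>x. f x * g x)"

lemma ip_commute: "ip f g = ip g f"
  by (simp add: ip_def mult.commute)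

lemma ip_cong:
  "\<lbrakk>\<And>x. x \<in> {a..b} \<Longrightarrow> f x = f' x; \<And>x. x \<in> {a..b} \<Longrightarrow> g x = g' x\<rbrakk> \<Longrightarrow> ip f g = ip f' g'"
  unfolding ip_def by (rule integral_cong) auto

lemma ip_integrable: "cont f \<Longrightarrow> cont g \<Longrightarrow> (\<lambda>x. f x * g x) integrable_on {a..b}"
  by (intro integrable_continuous_interval continuous_intros)

text \<open>Differences and multiples of functions are written as
  \<open>1 * f x + (-1) * g x\<close> and \<open>s * f x + 0 * f x\<close> from here on, so that
  this rule and its analogues for solutions and operators apply by unification.\<close>

lemma ip_lincomb_left:
  assumes "cont f" "cont g" "cont h"
  shows "ip (\<lambda>x. s * f x + t * g x) h = s * ip f h + t * ip g h"
proof -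
  have "ip (\<lambda>x. s * f x + t * g x) h = integral {a..b} (\<lambda>x. s * (f x * h x) + t * (g x * h x))"
    unfolding ip_def by (rule integral_cong) (simp add: algebra_simps)
  also have "\<dots> = s * ip f h + t * ip g h"
    unfolding ip_def using ip_integrable[OF assms(1,3)] ip_integrable[OF assms(2,3)]
    by (subst integral_add) (auto intro!: integrable_on_mult_right simp: integral_mult_right)
  finally show ?thesis .
qed

lemma ip_lincomb_right:
  assumes "cont f" "cont g" "cont h"
  shows "ip h (\<lambda>x. s * f x + t * g x) = s * ip h f + t * ip h g"
  using ip_lincomb_left[OF assms] by (simp add: ip_commute)

lemma ip_sum_left:
  assumes "finite F" "\<And>i. i \<in> F \<Longrightarrow> cont (e i)" "cont g"
  shows "ip (\<lambda>x. \<Sum>i\<in>F. c i * e i x) g = (\<Sum>i\<in>F. c i * ip (e i) g)"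
  using assms
proof (induction F rule: finite_induct)
  case empty
  then show ?case by (simp add: ip_def)
next
  case (insert i F)
  have "ip (\<lambda>x. c i * e i x + 1 * (\<Sum>j\<in>F. c j * e j x)) g
      = c i * ip (e i) g + 1 * ip (\<lambda>x. \<Sum>j\<in>F. c j * e j x) g"
    using insert.prems by (intro ip_lincomb_left) (auto intro!: continuous_intros)
  then show ?case using insert by simp
qed

lemma ip_self_nonneg: "cont f \<Longrightarrow> ip f f \<ge> 0"
  unfolding ip_def by (rule integral_nonneg) (auto intro: ip_integrable)

lemma ip_self_zero:
  assumes "cont f" "ip f f = 0" "x \<in> {a..b}"
  shows "f x = 0"
proof -
  have c: "cont (\<lambda>x. f x * f x)" by (intro continuous_intros assms)
  have "integral {a..b} (\<lambda>x. f x * f x) = 0 \<longleftrightarrow> (\<forall>x\<in>{a..b}. f x * f x = 0)"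
    by (rule integral_eq_0_iff[OF c ab]) simp
  then have "f x * f x = 0" using assms(2,3) unfolding ip_def by blast
  then show ?thesis by simp
qed

lemma ip_self_pos:
  "cont f \<Longrightarrow> x \<in> {a..b} \<Longrightarrow> f x \<noteq> 0 \<Longrightarrow> ip f f > 0"
  using ip_self_nonneg[of f] ip_self_zero[of f x] unfolding less_le by metis

lemma ip_Cauchy_Schwarz:
  assumes "cont f" "cont g"
  shows "(ip f g)\<^sup>2 \<le> ip f f * ip g g"
proof (cases "ip g g = 0")
  case True
  have "ip f g = ip f (\<lambda>x. 0)" by (rule ip_cong) (use ip_self_zero[OF assms(2) True] in auto)
  then show ?thesis using True by (simp add: ip_def)
next
  case False
  define t where "t = ip f g / ip g g"
  define w where "w = (\<lambda>x. 1 * f x + (- t) * g x)"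
  have w: "cont w" unfolding w_def by (intro continuous_intros assms)
  have "ip w w = 1 * ip f w + (- t) * ip g w"
    using w assms unfolding w_def by (intro ip_lincomb_left)
  also have "ip f w = 1 * ip f f + (- t) * ip f g"
    using assms unfolding w_def by (intro ip_lincomb_right)
  also have "ip g w = 1 * ip g f + (- t) * ip g g"
    using assms unfolding w_def by (intro ip_lincomb_right)
  finally have "ip w w = ip f f - (ip f g)\<^sup>2 / ip g g"
    using False ip_commute[of g f] by (simp add: t_def power2_eq_square)
  then have "(ip f g)\<^sup>2 / ip g g \<le> ip f f" using ip_self_nonneg[OF w] by simp
  then show ?thesis using False ip_self_nonneg[OF assms(2)] by (simp add: divide_le_eq)
qed

lemma ip_self_le:
  assumes "cont f" "\<And>x. x \<in> {a..b} \<Longrightarrow> (f x)\<^sup>2 \<le> B"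
  shows "ip f f \<le> (b - a) * B"
proof -
  have "ip f f \<le> integral {a..b} (\<lambda>x. B)"
    unfolding ip_def using assms
    by (intro integral_le ip_integrable) (auto simp: power2_eq_square)
  then show ?thesis using ab by simp
qed

lemma ip_self_tendsto_zero:
  assumes "\<And>n. cont (w n)"
    and "\<And>e. 0 < e \<Longrightarrow> \<exists>N. \<forall>n\<ge>N. \<forall>x\<in>{a..b}. \<bar>w n x\<bar> < e"
  shows "(\<lambda>n. ip (w n) (w n)) \<longlonglongrightarrow> 0"
proof (rule LIMSEQ_I)
  fix r :: real assume r: "r > 0"
  define e where "e = sqrt (r / (2 * (b - a)))"
  have e: "e > 0" using r ab by (simp add: e_def)
  obtain N where N: "\<And>n x. n \<ge> N \<Longrightarrow> x \<in> {a..b} \<Longrightarrow> \<bar>w n x\<bar> < e"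
    using assms(2)[OF e] by blast
  have "norm (ip (w n) (w n) - 0) < r" if "n \<ge> N" for n
  proof -
    have "(w n x)\<^sup>2 \<le> e\<^sup>2" if "x \<in> {a..b}" for x
      using N[OF \<open>n \<ge> N\<close> that] by (metis abs_ge_zero less_imp_le power2_abs power_mono)
    then have "ip (w n) (w n) \<le> (b - a) * e\<^sup>2" by (intro ip_self_le assms(1))
    also have "\<dots> = r / 2"
    proof -
      have "D * (r / (2 * D)) = r / 2" if "D > 0" for D using that by (simp add: field_simps)
      from this[of "b - a"] have "(b - a) * (r / (2 * (b - a))) = r / 2" using ab by linarith
      moreover have "e\<^sup>2 = r / (2 * (b - a))" using r ab by (simp add: e_def)
      ultimately show ?thesis by (simp only:)
    qed
    finally show ?thesis using r ip_self_nonneg[OF assms(1), of n] by simp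
  qed
  then show "\<exists>N. \<forall>n\<ge>N. norm (ip (w n) (w n) - 0) < r" by blast
qed

lemma ip_tendsto_zero:
  assumes "\<And>n. cont (w n)" "cont g" "(\<lambda>n. ip (w n) (w n)) \<longlonglongrightarrow> 0"
  shows "(\<lambda>n. ip (w n) g) \<longlonglongrightarrow> 0"
  by (rule tendsto_zero_of_square_le[where g = "\<lambda>n. ip (w n) (w n) * ip g g"])
    (auto intro: ip_Cauchy_Schwarz assms tendsto_mult_left_zero)

end

text \<open>\<open>T_sup\<close> and \<open>T_holder\<close> say that L2-bounded sets are mapped to
  uniformly bounded sets of functions with a common Hoelder modulus of exponent 1/2; this is the
  compactness. Linearity and injectivity are asked for on {a..b} only, because the operator to which
  this will be applied is determined only there.\<close>

locale compact_positive_operator = interval_inner +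
  fixes T :: "(real \<Rightarrow> real) \<Rightarrow> real \<Rightarrow> real" and C :: real
  assumes C: "C > 0"
    and T_cont: "\<And>f. cont f \<Longrightarrow> cont (T f)"
    and T_lin: "\<And>f g s t x. \<lbrakk>cont f; cont g; x \<in> {a..b}\<rbrakk> \<Longrightarrow>
      T (\<lambda>x. s * f x + t * g x) x = s * T f x + t * T g x"
    and T_sym: "\<And>f g. \<lbrakk>cont f; cont g\<rbrakk> \<Longrightarrow> ip (T f) g = ip f (T g)"
    and T_pos: "\<And>f. cont f \<Longrightarrow> ip (T f) f \<ge> 0"
    and T_sup: "\<And>f x. \<lbrakk>cont f; x \<in> {a..b}\<rbrakk> \<Longrightarrow> (T f x)\<^sup>2 \<le> C * ip f f"
    and T_holder: "\<And>f x y. \<lbrakk>cont f; x \<in> {a..b}; y \<in> {a..b}\<rbrakk> \<Longrightarrow>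
      (T f x - T f y)\<^sup>2 \<le> C * \<bar>x - y\<bar> * ip f f"
    and T_inj: "\<And>f x. \<lbrakk>cont f; \<And>x. x \<in> {a..b} \<Longrightarrow> T f x = 0; x \<in> {a..b}\<rbrakk> \<Longrightarrow> f x = 0"
begin

lemma T_norm: "cont f \<Longrightarrow> ip (T f) (T f) \<le> C * (b - a) * ip f f"
  using ip_self_le[OF T_cont T_sup] by (simp add: mult_ac)

lemma T_sum:
  assumes "finite F" "\<And>i. i \<in> F \<Longrightarrow> cont (e i)" "x \<in> {a..b}"
  shows "T (\<lambda>x. \<Sum>i\<in>F. c i * e i x) x = (\<Sum>i\<in>F. c i * T (e i) x)"
  using assms
proof (induction F rule: finite_induct)
  case empty
  then show ?case using T_lin[of "\<lambda>x. 0" "\<lambda>x. 0" x 0 0] by simp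
next
  case (insert i F)
  have "T (\<lambda>x. c i * e i x + 1 * (\<Sum>j\<in>F. c j * e j x)) x
      = c i * T (e i) x + 1 * T (\<lambda>x. \<Sum>j\<in>F. c j * e j x) x"
    using insert.prems by (intro T_lin) (auto intro!: continuous_intros)
  then show ?case using insert by simp
qed

text \<open>Arzela-Ascoli: for unit vectors, \<open>T_sup\<close> bounds the images by
  \<open>sqrt C\<close>, and \<open>T_holder\<close> makes them equicontinuous with radius
  \<open>e\<^sup>2 / C\<close>.\<close>

lemma T_subsequence:
  assumes f: "\<And>n. cont (f n)" "\<And>n. ip (f n) (f n) = 1"
  obtains p k where "cont p" "strict_mono (k :: nat \<Rightarrow> nat)"
    "(\<lambda>n. ip (\<lambda>x. T (f (k n)) x - p x) (\<lambda>x. T (f (k n)) x - p x)) \<longlonglongrightarrow> 0"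
    "\<And>x. x \<in> {a..b} \<Longrightarrow> (\<lambda>n. T (f (k n)) x) \<longlonglongrightarrow> p x"
proof -
  have bd: "norm (T (f n) x) \<le> sqrt C" if "x \<in> {a..b}" for n x
    using T_sup[OF f(1) that] real_sqrt_le_mono[of "(T (f n) x)\<^sup>2" C] by (simp add: f(2))
  have eq: "\<exists>d>0. \<forall>n y. y \<in> {a..b} \<and> norm (x - y) < d \<longrightarrow> norm (T (f n) x - T (f n) y) < e"
    if x: "x \<in> {a..b}" and e: "0 < e" for x e
  proof (intro exI[of _ "e\<^sup>2 / C"] conjI allI impI)
    show "e\<^sup>2 / C > 0" using e C by simp
    fix n y assume y: "y \<in> {a..b} \<and> norm (x - y) < e\<^sup>2 / C"
    have "(T (f n) x - T (f n) y)\<^sup>2 \<le> C * \<bar>x - y\<bar>" using T_holder[OF f(1) x, of y n] y by (simp add: f(2))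
    also have "\<dots> < e\<^sup>2" using y C by (simp add: field_simps)
    finally show "norm (T (f n) x - T (f n) y) < e"
      using e by (metis power2_abs power2_less_imp_less less_imp_le real_norm_def)
  qed
  have "\<exists>p k. cont p \<and> strict_mono (k :: nat \<Rightarrow> nat) \<and>
    (\<forall>e>0. \<exists>N. \<forall>n x. n \<ge> N \<and> x \<in> {a..b} \<longrightarrow> norm (T (f (k n)) x - p x) < e)"
  proof (rule Arzela_Ascoli[of "{a..b}" "\<lambda>n. T (f n)" "sqrt C"])
    fix g and k :: "nat \<Rightarrow> nat"
    assume "cont g" "strict_mono k"
      "\<And>e. 0 < e \<Longrightarrow> \<exists>N. \<forall>n x. n \<ge> N \<and> x \<in> {a..b} \<longrightarrow> norm (T (f (k n)) x - g x) < e"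
    then show ?thesis by blast
  qed (use bd eq in blast)+
  then obtain p k where p: "cont p" "strict_mono (k :: nat \<Rightarrow> nat)"
    "\<And>e. 0 < e \<Longrightarrow> \<exists>N. \<forall>n x. n \<ge> N \<and> x \<in> {a..b} \<longrightarrow> norm (T (f (k n)) x - p x) < e"
    by blast
  have "(\<lambda>n. ip (\<lambda>x. T (f (k n)) x - p x) (\<lambda>x. T (f (k n)) x - p x)) \<longlonglongrightarrow> 0"
  proof (rule ip_self_tendsto_zero)
    show "cont (\<lambda>x. T (f (k n)) x - p x)" for n by (intro continuous_intros T_cont f p)
    fix e :: real assume "0 < e"
    from p(3)[OF this] show "\<exists>N. \<forall>n\<ge>N. \<forall>x\<in>{a..b}. \<bar>T (f (k n)) x - p x\<bar> < e"
      unfolding real_norm_def by blast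
  qed
  moreover have "(\<lambda>n. T (f (k n)) x) \<longlonglongrightarrow> p x" if "x \<in> {a..b}" for x
    using p(3) that unfolding LIMSEQ_iff by blast
  ultimately show ?thesis using that p(1,2) by blast
qed

text \<open>If \<open>T\<close> did not vanish on the orthogonal complement of the \<open>e i\<close>, a maximizer of \<open>\<parallel>T f\<parallel>\<close> there
  would be an eigenvector of \<open>T\<^sup>2\<close>, and hence yield an eigenvector of \<open>T\<close> orthogonal to all \<open>e i\<close>.\<close>

lemma T_zero_of_orthogonal:
  assumes e: "\<And>i. i \<in> I \<Longrightarrow> cont (e i)" "\<And>i x. i \<in> I \<Longrightarrow> x \<in> {a..b} \<Longrightarrow> T (e i) x = \<mu> i * e i x"
    and complete: "\<And>g \<nu>. \<lbrakk>cont g; \<nu> > 0; \<And>x. x \<in> {a..b} \<Longrightarrow> T g x = \<nu> * g x; \<exists>x\<in>{a..b}. g x \<noteq> 0\<rbrakk>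
       \<Longrightarrow> \<exists>i\<in>I. ip g (e i) \<noteq> 0"
    and h: "cont h" "\<And>i. i \<in> I \<Longrightarrow> ip h (e i) = 0" and x: "x \<in> {a..b}"
  shows "T h x = 0"
proof (rule ccontr)
  assume Th: "T h x \<noteq> 0"
  define H where "H = {f. cont f \<and> (\<forall>i\<in>I. ip f (e i) = 0)}"
  have Hc: "cont f" if "f \<in> H" for f using that by (simp add: H_def)
  have HT: "T f \<in> H" if "f \<in> H" for f
  proof -
    have "ip (T f) (e i) = 0" if i: "i \<in> I" for i
    proof -
      have "ip (T f) (e i) = ip f (T (e i))" using T_sym[OF Hc[OF \<open>f \<in> H\<close>] e(1)[OF i]] .
      also have "\<dots> = ip f (\<lambda>x. \<mu> i * e i x + 0 * e i x)" by (rule ip_cong) (auto simp: e(2)[OF i])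
      also have "\<dots> = \<mu> i * ip f (e i) + 0 * ip f (e i)"
        by (intro ip_lincomb_right e i Hc[OF \<open>f \<in> H\<close>])
      finally show ?thesis using that \<open>f \<in> H\<close> by (simp add: H_def)
    qed
    then show ?thesis using T_cont[OF Hc[OF that]] by (simp add: H_def)
  qed
  have Hlin: "(\<lambda>x. s * f x + t * g x) \<in> H" if "f \<in> H" "g \<in> H" for f g s t
  proof -
    have "ip (\<lambda>x. s * f x + t * g x) (e i) = s * ip f (e i) + t * ip g (e i)" if "i \<in> I" for i
      using Hc[OF \<open>f \<in> H\<close>] Hc[OF \<open>g \<in> H\<close>] e(1)[OF that] by (rule ip_lincomb_left)
    then show ?thesis using that by (auto simp: H_def intro!: continuous_intros)
  qed
  have normalize: "ip (\<lambda>x. s * f x + 0 * f x) (\<lambda>x. s * f x + 0 * f x) = s\<^sup>2 * ip f f"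
    "ip (T (\<lambda>x. s * f x + 0 * f x)) (T (\<lambda>x. s * f x + 0 * f x)) = s\<^sup>2 * ip (T f) (T f)"
    if "cont f" for f s
  proof -
    have 1: "ip (\<lambda>x. s * g x + 0 * g x) (\<lambda>x. s * g x + 0 * g x) = s\<^sup>2 * ip g g" if "cont g" for g
      using ip_lincomb_left[OF that that, of "\<lambda>x. s * g x + 0 * g x" s 0]
        ip_lincomb_right[OF that that that, of s 0] that
      by (simp add: power2_eq_square continuous_intros)
    show "ip (\<lambda>x. s * f x + 0 * f x) (\<lambda>x. s * f x + 0 * f x) = s\<^sup>2 * ip f f" by (rule 1[OF that])
    have "ip (T (\<lambda>x. s * f x + 0 * f x)) (T (\<lambda>x. s * f x + 0 * f x)) =
      ip (\<lambda>x. s * T f x + 0 * T f x) (\<lambda>x. s * T f x + 0 * T f x)"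
      by (rule ip_cong) (auto simp: T_lin[OF that that, of _ s 0, simplified])
    then show "ip (T (\<lambda>x. s * f x + 0 * f x)) (T (\<lambda>x. s * f x + 0 * f x)) = s\<^sup>2 * ip (T f) (T f)"
      using 1[OF T_cont[OF that]] by simp
  qed
  define A where "A = (\<lambda>f. ip (T f) (T f)) ` {f \<in> H. ip f f = 1}"
  have hH: "h \<in> H" using h by (simp add: H_def)
  have iph: "ip h h > 0"
    using T_sup[OF h(1) x] Th C by (smt (verit, best) mult_pos_pos zero_less_mult_iff zero_less_power2)
  have ipTh: "ip (T h) (T h) > 0" using ip_self_pos[OF T_cont[OF h(1)] x Th] .
  define h1 where "h1 = (\<lambda>x. (1 / sqrt (ip h h)) * h x + 0 * h x)"
  have h1: "h1 \<in> {f \<in> H. ip f f = 1}" "ip (T h1) (T h1) > 0"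
    using normalize[OF h(1), of "1 / sqrt (ip h h)"] Hlin[OF hH hH, of "1 / sqrt (ip h h)" 0] iph ipTh
    by (auto simp: h1_def power_divide)
  have "ip (T f) (T f) \<le> C * (b - a)" if "f \<in> H" "ip f f = 1" for f
    using T_norm[OF Hc[OF that(1)]] that(2) by simp
  then have A_bdd: "bdd_above A"
    unfolding A_def by (intro bdd_aboveI[of _ "C * (b - a)"]) blast
  define \<sigma> where "\<sigma> = Sup A"
  have \<sigma>_ub: "ip (T f) (T f) \<le> \<sigma>" if "f \<in> H" "ip f f = 1" for f
    unfolding \<sigma>_def by (rule cSup_upper[OF _ A_bdd]) (use that in \<open>auto simp: A_def\<close>)
  have \<sigma>_pos: "\<sigma> > 0" using \<sigma>_ub[of h1] h1 by auto
  have \<sigma>_le: "ip (T f) (T f) \<le> \<sigma> * ip f f" if f: "f \<in> H" for f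
  proof (cases "ip f f = 0")
    case True
    then show ?thesis using T_norm[OF Hc[OF f]] by simp
  next
    case False
    then have pos: "ip f f > 0" using ip_self_nonneg[OF Hc[OF f]] by simp
    have "(1 / sqrt (ip f f))\<^sup>2 * ip (T f) (T f) \<le> \<sigma>"
      using \<sigma>_ub[OF Hlin[OF f f, of "1 / sqrt (ip f f)" 0]] normalize[OF Hc[OF f], of "1 / sqrt (ip f f)"] pos
      by (simp add: power_divide)
    then show ?thesis using pos by (simp add: power_divide field_simps)
  qed
  have "\<exists>f. f \<in> H \<and> ip f f = 1 \<and> \<sigma> - 1 / Suc n < ip (T f) (T f)" for n
  proof -
    have "\<exists>y\<in>A. \<sigma> - 1 / Suc n < y"
      unfolding \<sigma>_def by (rule less_cSupD) (use h1 in \<open>auto simp: A_def\<close>)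
    then show ?thesis by (auto simp: A_def)
  qed
  then obtain f where f: "\<And>n. f n \<in> H" "\<And>n. ip (f n) (f n) = 1"
    "\<And>n. \<sigma> - 1 / Suc n < ip (T (f n)) (T (f n))" by metis
  obtain p k where p: "cont p" "strict_mono (k :: nat \<Rightarrow> nat)"
    and w0: "(\<lambda>n. ip (\<lambda>x. T (f (k n)) x - p x) (\<lambda>x. T (f (k n)) x - p x)) \<longlonglongrightarrow> 0"
    and lim: "\<And>x. x \<in> {a..b} \<Longrightarrow> (\<lambda>n. T (f (k n)) x) \<longlonglongrightarrow> p x"
  proof (rule T_subsequence[of f])
    show "cont (f n)" "ip (f n) (f n) = 1" for n using f Hc by auto
  qed (rule that)
  define g where "g n = f (k n)" for n
  define w where "w n = (\<lambda>x. 1 * T (g n) x + (-1) * p x)" for n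
  have gH: "g n \<in> H" and g1: "ip (g n) (g n) = 1" for n using f by (auto simp: g_def)
  have gc: "cont (g n)" "cont (T (g n))" for n using gH Hc T_cont by auto
  have wc: "cont (w n)" for n unfolding w_def by (intro continuous_intros gc p)
  have w0: "(\<lambda>n. ip (w n) (w n)) \<longlonglongrightarrow> 0" using w0 by (simp add: w_def g_def)
  have lim: "(\<lambda>n. T (g n) x) \<longlonglongrightarrow> p x" if "x \<in> {a..b}" for x using lim[OF that] by (simp add: g_def)
  have norm_lim: "(\<lambda>n. ip (T (g n)) (T (g n))) \<longlonglongrightarrow> \<sigma>"
  proof (rule tendsto_sandwich)
    show "\<forall>\<^sub>F n in sequentially. \<sigma> - 1 / Suc n \<le> ip (T (g n)) (T (g n))"
    proof (rule always_eventually, rule allI)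
      fix n
      have "\<sigma> - 1 / Suc n \<le> \<sigma> - 1 / Suc (k n)"
        using strict_mono_imp_increasing[OF p(2), of n] by (simp add: frac_le)
      also have "\<dots> \<le> ip (T (g n)) (T (g n))" using f(3)[of "k n"] by (simp add: g_def)
      finally show "\<sigma> - 1 / Suc n \<le> ip (T (g n)) (T (g n))" .
    qed
    show "\<forall>\<^sub>F n in sequentially. ip (T (g n)) (T (g n)) \<le> \<sigma>" using \<sigma>_ub gH g1 by auto
    show "(\<lambda>n. \<sigma> - 1 / Suc n) \<longlonglongrightarrow> \<sigma>"
      using tendsto_diff[OF tendsto_const lim_1_over_n[THEN LIMSEQ_Suc], of \<sigma>] by simp
  qed auto
  have pH: "p \<in> H"
  proof -
    have "ip p (e i) = 0" if i: "i \<in> I" for i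
    proof -
      have "ip (w n) (e i) = 1 * ip (T (g n)) (e i) + (-1) * ip p (e i)" for n
        unfolding w_def by (intro ip_lincomb_left gc p e i)
      moreover have "ip (T (g n)) (e i) = 0" for n using HT[OF gH] i by (simp add: H_def)
      ultimately have "(\<lambda>n. - ip p (e i)) \<longlonglongrightarrow> 0"
        using ip_tendsto_zero[OF wc e(1)[OF i] w0] by simp
      then show ?thesis by (simp add: LIMSEQ_const_iff)
    qed
    then show ?thesis using p by (simp add: H_def)
  qed
  have p_nz: "\<exists>x\<in>{a..b}. p x \<noteq> 0"
  proof (rule ccontr)
    assume "\<not> (\<exists>x\<in>{a..b}. p x \<noteq> 0)"
    then have "ip (w n) (w n) = ip (T (g n)) (T (g n))" for n
      by (intro ip_cong) (auto simp: w_def)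
    then show False using LIMSEQ_unique[OF w0] norm_lim \<sigma>_pos by auto
  qed
  have TTp: "T (T p) y = \<sigma> * p y" if y: "y \<in> {a..b}" for y
  proof -
    \<comment> \<open>The defect of \<open>g n\<close> as an eigenvector of the square of T.
      Expanding its squared norm and using maximality of \<sigma> bounds it by \<sigma> times the
      gap between \<sigma> and the squared norm of \<open>T (g n)\<close>, which tends to 0. As
      \<open>g n\<close> itself need not converge, T is applied once more: only the convergent
      \<open>T (g n)\<close> then occurs, with limit p.\<close>
    define d where "d n = (\<lambda>x. 1 * T (T (g n)) x + (- \<sigma>) * g n x)" for n
    have dc: "cont (d n)" for n unfolding d_def by (intro continuous_intros T_cont gc)
    have d_le: "ip (d n) (d n) \<le> \<sigma> * (\<sigma> - ip (T (g n)) (T (g n)))" for n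
    proof -
      have "ip (d n) (d n) = 1 * ip (T (T (g n))) (d n) + (- \<sigma>) * ip (g n) (d n)"
        using dc[of n] unfolding d_def by (intro ip_lincomb_left gc T_cont)
      also have "ip (T (T (g n))) (d n) = 1 * ip (T (T (g n))) (T (T (g n))) + (- \<sigma>) * ip (T (T (g n))) (g n)"
        unfolding d_def by (intro ip_lincomb_right gc T_cont)
      also have "ip (g n) (d n) = 1 * ip (g n) (T (T (g n))) + (- \<sigma>) * ip (g n) (g n)"
        unfolding d_def by (intro ip_lincomb_right gc T_cont)
      also have "ip (g n) (T (T (g n))) = ip (T (g n)) (T (g n))" by (rule T_sym[symmetric, OF gc])
      also have "ip (T (T (g n))) (g n) = ip (T (g n)) (T (g n))" by (rule T_sym[OF gc(2,1)])
      finally have "ip (d n) (d n) = ip (T (T (g n))) (T (T (g n))) - 2 * \<sigma> * ip (T (g n)) (T (g n)) + \<sigma>\<^sup>2"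
        by (simp add: g1 power2_eq_square algebra_simps)
      with \<sigma>_le[OF HT[OF gH[of n]]] show ?thesis by (simp add: power2_eq_square algebra_simps)
    qed
    have "(\<lambda>n. T (d n) y) \<longlonglongrightarrow> 0"
    proof (rule tendsto_zero_of_square_le)
      show "(T (d n) y)\<^sup>2 \<le> C * (\<sigma> * (\<sigma> - ip (T (g n)) (T (g n))))" for n
        using T_sup[OF dc y] mult_left_mono[OF d_le] C by (smt (verit))
      show "(\<lambda>n. C * (\<sigma> * (\<sigma> - ip (T (g n)) (T (g n))))) \<longlonglongrightarrow> 0"
        using norm_lim by (auto intro!: tendsto_eq_intros)
    qed
    moreover have "T (d n) y = T (T (T (g n))) y - \<sigma> * T (g n) y" for n
      unfolding d_def using T_lin[OF T_cont[OF gc(2)] gc(1) y, of 1 _ "- \<sigma>"] by simp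
    moreover have "(\<lambda>n. T (T (T (g n))) y) \<longlonglongrightarrow> T (T p) y"
    proof -
      have "T (T (w n)) y = T (T (T (g n))) y - T (T p) y" for n
      proof -
        have eq: "T (w n) x = 1 * T (T (g n)) x + (-1) * T p x" if "x \<in> {a..b}" for x
          unfolding w_def by (rule T_lin[OF gc(2) p(1) that])
        \<comment> \<open>That T depends only on the values on {a..b} is obtained from linearity and
          \<open>T_sup\<close>: the argument on the right vanishes on {a..b}, so it has norm 0 and T
          maps it to 0 there.\<close>
        have "T (T (w n)) y - (T (T (T (g n))) y - T (T p) y)
            = T (\<lambda>x. 1 * T (w n) x + (-1) * (1 * T (T (g n)) x + (-1) * T p x)) y"
          using T_lin[where s = 1 and t = "-1", OF T_cont[OF wc[of n]] _ y,
              of "\<lambda>x. 1 * T (T (g n)) x + (-1) * T p x"]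
            T_lin[where s = 1 and t = "-1", OF T_cont[OF gc(2)[of n]] T_cont[OF p(1)] y] y
          by (simp add: continuous_intros T_cont gc p)
        moreover have "ip (\<lambda>x. 1 * T (w n) x + (-1) * (1 * T (T (g n)) x + (-1) * T p x))
            (\<lambda>x. 1 * T (w n) x + (-1) * (1 * T (T (g n)) x + (-1) * T p x)) = ip (\<lambda>x. 0) (\<lambda>x. 0)"
          by (rule ip_cong) (auto simp: eq)
        ultimately show ?thesis
          using T_sup[of "\<lambda>x. 1 * T (w n) x + (-1) * (1 * T (T (g n)) x + (-1) * T p x)" y] y
          by (simp add: continuous_intros T_cont gc p wc ip_def)
      qed
      moreover have "(\<lambda>n. T (T (w n)) y) \<longlonglongrightarrow> 0"
      proof (rule tendsto_zero_of_square_le)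
        show "(T (T (w n)) y)\<^sup>2 \<le> C * (C * (b - a) * ip (w n) (w n))" for n
          using T_sup[OF T_cont[OF wc] y] mult_left_mono[OF T_norm[OF wc]] C by (smt (verit))
        show "(\<lambda>n. C * (C * (b - a) * ip (w n) (w n))) \<longlonglongrightarrow> 0"
          using w0 by (auto intro!: tendsto_eq_intros)
      qed
      ultimately show ?thesis by (simp add: LIM_zero_iff)
    qed
    ultimately have "(\<lambda>n. T (T (T (g n))) y - \<sigma> * T (g n) y) \<longlonglongrightarrow> 0"
      "(\<lambda>n. T (T (T (g n))) y - \<sigma> * T (g n) y) \<longlonglongrightarrow> T (T p) y - \<sigma> * p y"
      using lim[OF y] by (auto intro!: tendsto_intros)
    then show ?thesis using LIMSEQ_unique by fastforce
  qed
  \<comment> \<open>On p the square of T acts as \<sigma>, so T - sqrt \<sigma> annihilates the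
    image of p under T + sqrt \<sigma>. If that image vanished, p would be an eigenvector for the
    negative value -sqrt \<sigma>, against positivity.\<close>
  define v where "v = (\<lambda>x. 1 * T p x + sqrt \<sigma> * p x)"
  have vH: "v \<in> H" unfolding v_def by (intro Hlin HT pH)
  have Tv: "T v y = sqrt \<sigma> * v y" if y: "y \<in> {a..b}" for y
  proof -
    have "T v y = 1 * T (T p) y + sqrt \<sigma> * T p y"
      unfolding v_def by (rule T_lin[OF T_cont[OF p(1)] p(1) y])
    then show ?thesis using TTp[OF y] \<sigma>_pos by (simp add: v_def algebra_simps)
  qed
  have "\<exists>x\<in>{a..b}. v x \<noteq> 0"
  proof (rule ccontr)
    assume *: "\<not> (\<exists>x\<in>{a..b}. v x \<noteq> 0)"
    have "ip (T p) p = ip (\<lambda>x. (- sqrt \<sigma>) * p x + 0 * p x) p"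
      using * by (intro ip_cong) (auto simp: v_def eq_neg_iff_add_eq_0)
    also have "\<dots> = - sqrt \<sigma> * ip p p" by (subst ip_lincomb_left[OF p(1) p(1) p(1)]) simp
    also have "\<dots> < 0" using \<sigma>_pos p_nz ip_self_pos[OF p(1)] by (auto simp: mult_pos_pos)
    finally show False using T_pos[OF p(1)] by simp
  qed
  from complete[OF Hc[OF vH] _ Tv this] \<sigma>_pos vH show False by (auto simp: H_def)
qed

lemma ip_orthogonal_sum:
  assumes "finite F" "\<And>i. i \<in> F \<Longrightarrow> cont (e i)"
    and "\<And>i j. i \<in> F \<Longrightarrow> j \<in> F \<Longrightarrow> ip (e i) (e j) = (if i = j then N else 0)"
  shows "ip (\<lambda>x. \<Sum>i\<in>F. c i * e i x) (\<lambda>x. \<Sum>i\<in>F. c i * e i x) = N * (\<Sum>i\<in>F. (c i)\<^sup>2)"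
proof -
  have cs: "cont (\<lambda>x. \<Sum>i\<in>F. c i * e i x)" using assms(2) by (auto intro!: continuous_intros)
  have "ip (e i) (\<lambda>x. \<Sum>i\<in>F. c i * e i x) = N * c i" if "i \<in> F" for i
  proof -
    have "ip (e i) (\<lambda>x. \<Sum>i\<in>F. c i * e i x) = (\<Sum>j\<in>F. c j * ip (e j) (e i))"
      by (subst ip_commute, rule ip_sum_left) (use assms that in auto)
    also have "\<dots> = (\<Sum>j\<in>F. if j = i then c j * N else 0)"
      by (rule sum.cong) (use assms(3) that in auto)
    finally show ?thesis using assms(1) that by simp
  qed
  then have "(\<Sum>i\<in>F. c i * ip (e i) (\<lambda>x. \<Sum>i\<in>F. c i * e i x)) = (\<Sum>i\<in>F. c i * (N * c i))"
    by (intro sum.cong) auto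
  then show ?thesis
    using ip_sum_left[OF assms(1,2) cs, where c = c]
    by (simp add: sum_distrib_left power2_eq_square mult_ac)
qed

text \<open>The Hilbert-Schmidt bound. For fixed x, \<open>T_sup\<close> is applied to the
  combination of the e i with coefficients \<mu> i times e i x: the value of T at x is s x and the
  squared norm is N times s x, whence s x is at most C N. Integration over x gives the claim, which
  later shows that eigenvalues cannot accumulate.\<close>

lemma sum_eigenvalue_squares_le:
  assumes F: "finite F" and e: "\<And>i. i \<in> F \<Longrightarrow> cont (e i)"
    and eig: "\<And>i x. i \<in> F \<Longrightarrow> x \<in> {a..b} \<Longrightarrow> T (e i) x = \<mu> i * e i x"
    and orth: "\<And>i j. i \<in> F \<Longrightarrow> j \<in> F \<Longrightarrow> ip (e i) (e j) = (if i = j then N else 0)"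
    and N: "N > 0"
  shows "(\<Sum>i\<in>F. (\<mu> i)\<^sup>2) \<le> C * (b - a)"
proof -
  define s where "s x = (\<Sum>i\<in>F. (\<mu> i * e i x)\<^sup>2)" for x
  have s_le: "s x \<le> C * N" if x: "x \<in> {a..b}" for x
  proof -
    have "T (\<lambda>y. \<Sum>i\<in>F. (\<mu> i * e i x) * e i y) x = s x"
      using T_sum[of F e x "\<lambda>i. \<mu> i * e i x"] F e eig x by (simp add: s_def power2_eq_square mult_ac cong: sum.cong)
    moreover have "ip (\<lambda>y. \<Sum>i\<in>F. (\<mu> i * e i x) * e i y) (\<lambda>y. \<Sum>i\<in>F. (\<mu> i * e i x) * e i y) = N * s x"
      unfolding s_def by (rule ip_orthogonal_sum[OF F e orth])
    moreover have "cont (\<lambda>y. \<Sum>i\<in>F. (\<mu> i * e i x) * e i y)" using e by (auto intro!: continuous_intros)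
    ultimately have "(s x)\<^sup>2 \<le> C * (N * s x)" using T_sup x by metis
    moreover have "s x \<ge> 0" unfolding s_def by (simp add: sum_nonneg)
    ultimately show ?thesis using C N by (cases "s x = 0") (auto simp: power2_eq_square mult_ac)
  qed
  have sq: "(\<lambda>x. (e i x)\<^sup>2) integrable_on {a..b}" if "i \<in> F" for i
    using e[OF that] by (intro integrable_continuous_interval continuous_intros)
  have "integral {a..b} s = (\<Sum>i\<in>F. (\<mu> i)\<^sup>2 * integral {a..b} (\<lambda>x. (e i x)\<^sup>2))"
    unfolding s_def power_mult_distrib using F sq
    by (subst integral_sum) (auto intro!: integrable_on_mult_right)
  also have "\<dots> = (\<Sum>i\<in>F. (\<mu> i)\<^sup>2 * N)"
    using orth by (intro sum.cong) (auto simp: ip_def power2_eq_square)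
  finally have "N * (\<Sum>i\<in>F. (\<mu> i)\<^sup>2) = integral {a..b} s" by (simp add: sum_distrib_left mult_ac)
  also have "\<dots> \<le> integral {a..b} (\<lambda>x. C * N)"
    using s_le e unfolding s_def by (intro integral_le integrable_continuous_interval continuous_intros) auto
  also have "\<dots> = N * (C * (b - a))" using ab by simp
  finally show ?thesis using N by simp
qed

text \<open>The function expanded is \<open>T h\<close> and not h: Bessel's inequality makes the
  coefficients of h square summable, and \<open>T_sup\<close> turns this into uniform convergence
  once T is applied. The difference between \<open>T h\<close> and the limit is orthogonal to all e
  i, hence annihilated by T, hence zero by injectivity.\<close>

theorem eigenfunction_expansion:
  fixes e :: "nat \<Rightarrow> real \<Rightarrow> real"
  assumes e: "\<And>i. cont (e i)" and eig: "\<And>i x. x \<in> {a..b} \<Longrightarrow> T (e i) x = \<mu> i * e i x"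
    and orth: "\<And>i j. ip (e i) (e j) = (if i = j then N else 0)" and N: "N > 0"
    and complete: "\<And>g \<nu>. \<lbrakk>cont g; \<nu> > 0; \<And>x. x \<in> {a..b} \<Longrightarrow> T g x = \<nu> * g x; \<exists>x\<in>{a..b}. g x \<noteq> 0\<rbrakk>
       \<Longrightarrow> \<exists>i. ip g (e i) \<noteq> 0"
    and h: "cont h" and x: "x \<in> {a..b}"
  shows "(\<lambda>n. ip (T h) (e n) / N * e n x) sums T h x"
proof -
  define c where "c i = ip h (e i) / N" for i
  define P where "P F = (\<lambda>y. \<Sum>i\<in>F. c i * e i y)" for F
  define S where "S n y = (\<Sum>i<n. c i * \<mu> i * e i y)" for n y
  have Pc: "cont (P F)" for F unfolding P_def by (intro continuous_intros e)
  have Sc: "cont (S n)" for n unfolding S_def by (intro continuous_intros e)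
  have TP: "T (P F) y = (\<Sum>i\<in>F. c i * \<mu> i * e i y)" if "finite F" "y \<in> {a..b}" for F y
    unfolding P_def using T_sum[OF that(1) e that(2)] eig[OF that(2)] by (simp add: mult_ac)
  have PP: "ip (P F) (P F) = N * (\<Sum>i\<in>F. (c i)\<^sup>2)" if "finite F" for F
    unfolding P_def by (rule ip_orthogonal_sum) (use that e orth in auto)
  have bessel: "N * (\<Sum>i\<in>F. (c i)\<^sup>2) \<le> ip h h" if F: "finite F" for F
  proof -
    have hP: "ip h (P F) = N * (\<Sum>i\<in>F. (c i)\<^sup>2)"
    proof -
      have "ip (P F) h = (\<Sum>i\<in>F. c i * ip (e i) h)" unfolding P_def using F e h by (rule ip_sum_left)
      then show ?thesis using N by (simp add: ip_commute[of h] c_def sum_distrib_left power2_eq_square)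
    qed
    have "(N * (\<Sum>i\<in>F. (c i)\<^sup>2))\<^sup>2 \<le> ip h h * (N * (\<Sum>i\<in>F. (c i)\<^sup>2))"
      using ip_Cauchy_Schwarz[OF h Pc[of F]] by (simp add: hP PP[OF F])
    moreover have "N * (\<Sum>i\<in>F. (c i)\<^sup>2) \<ge> 0" using N by (simp add: sum_nonneg)
    ultimately show ?thesis using ip_self_nonneg[OF h]
      by (cases "N * (\<Sum>i\<in>F. (c i)\<^sup>2) = 0") (auto simp: power2_eq_square mult_le_cancel_right)
  qed
  have summ: "summable (\<lambda>i. (c i)\<^sup>2)"
  proof (rule summableI_nonneg_bounded[where x = "ip h h / N"])
    show "(\<Sum>i<n. (c i)\<^sup>2) \<le> ip h h / N" for n
      using bessel[of "{..<n}"] N by (simp add: field_simps)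
  qed auto
  have diff: "(S m y - S n y)\<^sup>2 \<le> C * N * (\<Sum>i=n..<m. (c i)\<^sup>2)" if "n \<le> m" "y \<in> {a..b}" for m n y
  proof -
    have "S m y - S n y = T (P {n..<m}) y"
      using TP[of "{n..<m}" y] that sum_diff_nat_ivl[of 0 n m "\<lambda>i. c i * \<mu> i * e i y"]
      by (simp add: S_def atLeast0LessThan)
    then show ?thesis using T_sup[OF Pc that(2), of "{n..<m}"] PP[of "{n..<m}"] by (simp add: mult_ac)
  qed
  have "uniformly_Cauchy_on {a..b} S"
    unfolding uniformly_Cauchy_on_def
  proof (intro allI impI)
    fix r :: real assume r: "r > 0"
    define \<epsilon> where "\<epsilon> = r\<^sup>2 / (C * N)"
    have "\<epsilon> > 0" using r C N by (simp add: \<epsilon>_def)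
    then obtain M where M: "\<And>m n. m \<ge> M \<Longrightarrow> norm (\<Sum>i=m..<n. (c i)\<^sup>2) < \<epsilon>"
      using summ unfolding summable_Cauchy by blast
    have 1: "\<bar>S m y - S n y\<bar> < r" if "n \<ge> M" "n \<le> m" "y \<in> {a..b}" for m n y
    proof -
      have "(S m y - S n y)\<^sup>2 \<le> C * N * (\<Sum>i=n..<m. (c i)\<^sup>2)" by (rule diff[OF that(2,3)])
      also have "\<dots> < C * N * \<epsilon>" using M[OF that(1), of m] C N by (intro mult_strict_left_mono) auto
      also have "\<dots> = r\<^sup>2" using C N by (simp add: \<epsilon>_def)
      finally show ?thesis using r by (metis power2_abs power2_less_imp_less less_imp_le)
    qed
    show "\<exists>M. \<forall>y\<in>{a..b}. \<forall>m\<ge>M. \<forall>n\<ge>M. dist (S m y) (S n y) < r"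
    proof (intro exI[of _ M] ballI allI impI)
      fix y m n assume "y \<in> {a..b}" "m \<ge> M" "n \<ge> M"
      then show "dist (S m y) (S n y) < r"
        using 1[of n m y] 1[of m n y] by (cases "n \<le> m") (auto simp: dist_real_def abs_minus_commute)
    qed
  qed
  then obtain s where s: "uniform_limit {a..b} S s sequentially"
    using Cauchy_uniformly_convergent uniformly_convergent_on_def by blast
  have sc: "cont s"
    by (rule uniform_limit_theorem[OF _ s]) (use Sc in auto)
  define w where "w n = (\<lambda>x. 1 * S n x + (-1) * s x)" for n
  have w0: "(\<lambda>n. ip (w n) (w n)) \<longlonglongrightarrow> 0"
  proof (rule ip_self_tendsto_zero)
    show "cont (w n)" for n unfolding w_def by (intro continuous_intros Sc sc)
    show "\<exists>N. \<forall>n\<ge>N. \<forall>x\<in>{a..b}. \<bar>w n x\<bar> < r" if "r > 0" for r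
      using s that unfolding uniform_limit_sequentially_iff by (auto simp: w_def dist_real_def)
  qed
  have wc: "cont (w n)" for n unfolding w_def by (intro continuous_intros Sc sc)
  define d where "d = (\<lambda>x. 1 * T h x + (-1) * s x)"
  have dc: "cont d" unfolding d_def by (intro continuous_intros T_cont h sc)
  have The: "ip (T h) (e j) = \<mu> j * ip h (e j)" for j
  proof -
    have "ip (T h) (e j) = ip h (T (e j))" by (rule T_sym[OF h e])
    also have "\<dots> = ip h (\<lambda>x. \<mu> j * e j x + 0 * e j x)" by (rule ip_cong) (auto simp: eig)
    also have "\<dots> = \<mu> j * ip h (e j)" by (subst ip_lincomb_right[OF e e h]) simp
    finally show ?thesis .
  qed
  have d_orth: "ip d (e j) = 0" for j
  proof -
    have Se: "ip (S n) (e j) = \<mu> j * ip h (e j)" if "n > j" for n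
    proof -
      have "ip (S n) (e j) = (\<Sum>i<n. c i * \<mu> i * ip (e i) (e j))"
        unfolding S_def by (rule ip_sum_left) (use e in auto)
      also have "\<dots> = (\<Sum>i<n. if i = j then c j * \<mu> j * N else 0)"
        by (rule sum.cong) (auto simp: orth)
      also have "\<dots> = \<mu> j * ip h (e j)" using that N by (simp add: c_def)
      finally show ?thesis .
    qed
    have we: "ip (w n) (e j) = 1 * ip (S n) (e j) + (-1) * ip s (e j)" for n
      unfolding w_def by (intro ip_lincomb_left Sc sc e)
    have "\<forall>\<^sub>F n in sequentially. ip (w n) (e j) = \<mu> j * ip h (e j) - ip s (e j)"
    proof (rule eventually_mono[OF eventually_gt_at_top[of j]])
      fix n assume "j < n"
      then show "ip (w n) (e j) = \<mu> j * ip h (e j) - ip s (e j)" using we[of n] Se[of n] by simp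
    qed
    from LIMSEQ_unique[OF ip_tendsto_zero[OF wc e w0] tendsto_eventually[OF this]]
    have "\<mu> j * ip h (e j) - ip s (e j) = 0" by simp
    moreover have "ip d (e j) = 1 * ip (T h) (e j) + (-1) * ip s (e j)"
      unfolding d_def by (intro ip_lincomb_left T_cont h sc e)
    ultimately show ?thesis by (simp add: The)
  qed
  have "T d y = 0" if "y \<in> {a..b}" for y
    by (rule T_zero_of_orthogonal[where I = UNIV and e = e and \<mu> = \<mu>])
      (use e eig complete dc d_orth that in auto)
  then have "d x = 0" using T_inj[OF dc] x by blast
  then have "T h x = s x" by (simp add: d_def)
  moreover have "(\<lambda>n. S n x) \<longlonglongrightarrow> s x" using tendsto_uniform_limitI[OF s x] .
  moreover have "c n * \<mu> n * e n x = ip (T h) (e n) / N * e n x" for n by (simp add: c_def The)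
  ultimately show ?thesis unfolding sums_def S_def by simp
qed

end

section \<open>Sturm-Liouville theory for Mathieu's equation\<close>

text \<open>The sign s treats symmetry (1) and antisymmetry (-1) about p / 2 together. At the fixed
  point x = p / 2 the symmetric case yields a vanishing derivative.\<close>

lemma has_real_derivative_even_odd:
  fixes u u' :: "real \<Rightarrow> real"
  assumes d: "\<And>x. (u has_real_derivative u' x) (at x)" and p: "\<And>x. u (p - x) = s * u x"
  shows "u' (p - x) = - s * u' x"
proof -
  have d0: "((\<lambda>x. p - x) has_real_derivative -1) (at x)" by (auto intro!: derivative_eq_intros)
  have "((\<lambda>x. u (p - x)) has_real_derivative u' (p - x) * -1) (at x)"
    by (rule DERIV_chain2[where g = "\<lambda>x. p - x", OF d d0])
  moreover have "((\<lambda>x. u (p - x)) has_real_derivative s * u' x) (at x)"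
    unfolding p using d by (intro DERIV_cmult)
  ultimately have "u' (p - x) * -1 = s * u' x" by (rule DERIV_unique)
  then show ?thesis by simp
qed

text \<open>With \<open>neu\<close> the boundary conditions at \<open>0\<close> and \<open>\<pi>\<close> are those of Neumann (even periodic functions),
  otherwise those of Dirichlet (odd periodic functions). The shift of the spectrum makes the
  potential at least 1.\<close>

locale mathieu_sturm_liouville =
  fixes h :: real and neu :: bool
begin

sublocale interval_inner 0 pi
  by unfold_locales simp

section \<open>The boundary value problem and its energy estimates\<close>

definition shift :: real where "shift = 2 * h\<^sup>2 + 1"

definition V :: "real \<Rightarrow> real" where "V x = shift - 2 * h\<^sup>2 * cos (2 * x)"

definition bc :: "(real \<Rightarrow> real) \<Rightarrow> (real \<Rightarrow> real) \<Rightarrow> bool" where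
  "bc u u' \<longleftrightarrow> (if neu then u' 0 = 0 \<and> u' pi = 0 else u 0 = 0 \<and> u pi = 0)"

text \<open>The boundary value problem -u'' + V u = f. The derivatives at 0 and pi are two-sided, as
  solutions are obtained by restricting functions on the whole line.\<close>

definition sl :: "(real \<Rightarrow> real) \<Rightarrow> (real \<Rightarrow> real) \<Rightarrow> (real \<Rightarrow> real) \<Rightarrow> bool" where
  "sl u u' f \<longleftrightarrow> bc u u' \<and> (\<forall>x\<in>{0..pi}. (u has_real_derivative u' x) (at x) \<and>
      (u' has_real_derivative V x * u x - f x) (at x))"

lemma V_ge_1: "V x \<ge> 1"
  using mult_left_mono[OF cos_le_one[of "2 * x"], of "2 * h\<^sup>2"] by (simp add: V_def shift_def)

lemma V_cont: "continuous_on S V"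
  unfolding V_def by (intro continuous_intros)

lemma V_reflect: "V (pi - x) = V x" "V (- x) = V x" "V (2 * pi - x) = V x"
proof -
  have "cos (2 * (pi - x)) = cos (2 * x)" by (simp add: right_diff_distrib cos_diff)
  then show "V (pi - x) = V x" by (simp add: V_def)
  show "V (- x) = V x" by (simp add: V_def)
  have "cos (2 * (2 * pi - x)) = cos (2 * x)"
    using cos_periodic[of "2 * (2 * pi - x) - 2 * pi"] cos_periodic[of "- (2 * x)"]
    by (simp add: algebra_simps)
  then show "V (2 * pi - x) = V x" by (simp add: V_def)
qed

lemma slD:
  assumes "sl u u' f" "x \<in> {0..pi}"
  shows "(u has_real_derivative u' x) (at x)" "(u' has_real_derivative V x * u x - f x) (at x)"
  using assms by (auto simp: sl_def)

lemma sl_cont: assumes "sl u u' f" shows "cont u" "cont u'"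
  using slD[OF assms] DERIV_isCont by (blast intro!: continuous_at_imp_continuous_on)+

lemma sl_lincomb:
  assumes "sl u u' f" "sl v v' g"
  shows "sl (\<lambda>x. s * u x + t * v x) (\<lambda>x. s * u' x + t * v' x) (\<lambda>x. s * f x + t * g x)"
proof -
  have "bc (\<lambda>x. s * u x + t * v x) (\<lambda>x. s * u' x + t * v' x)"
    using assms by (auto simp: sl_def bc_def split: if_splits)
  moreover have "((\<lambda>x. s * u x + t * v x) has_real_derivative s * u' x + t * v' x) (at x)"
    if "x \<in> {0..pi}" for x
    by (intro DERIV_add DERIV_cmult slD(1)[OF assms(1) that] slD(1)[OF assms(2) that])
  moreover have "((\<lambda>x. s * u' x + t * v' x) has_real_derivative
      V x * (s * u x + t * v x) - (s * f x + t * g x)) (at x)" if "x \<in> {0..pi}" for x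
  proof -
    have "((\<lambda>x. s * u' x + t * v' x) has_real_derivative
        s * (V x * u x - f x) + t * (V x * v x - g x)) (at x)"
      by (intro DERIV_add DERIV_cmult slD(2)[OF assms(1) that] slD(2)[OF assms(2) that])
    then show ?thesis by (simp add: algebra_simps)
  qed
  ultimately show ?thesis by (simp add: sl_def)
qed

text \<open>Lagrange's identity: u' v - u v' has derivative u g - f v and vanishes at both ends
  under either boundary condition. It makes the solution operator symmetric.\<close>

lemma sl_green:
  assumes u: "sl u u' f" and v: "sl v v' g" and c: "cont f" "cont g"
  shows "ip u g = ip f v"
proof -
  define w where "w x = u' x * v x - u x * v' x" for x
  have "(w has_real_derivative u x * g x - f x * v x) (at x)" if "x \<in> {0..pi}" for x
  proof -
    have "(w has_real_derivative
        ((V x * u x - f x) * v x + u' x * v' x) - (u' x * v' x + u x * (V x * v x - g x))) (at x)"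
      unfolding w_def
      using slD[OF u that] slD[OF v that] by (auto intro!: derivative_eq_intros simp: algebra_simps)
    then show ?thesis by (simp add: algebra_simps)
  qed
  then have "((\<lambda>x. u x * g x - f x * v x) has_integral w pi - w 0) {0..pi}"
    by (intro fundamental_theorem_of_calculus)
      (auto intro: has_vector_derivative_at_within simp: has_real_derivative_iff_has_vector_derivative)
  moreover have "w pi - w 0 = 0"
    using u v by (auto simp: w_def sl_def bc_def split: if_splits)
  ultimately have "integral {0..pi} (\<lambda>x. u x * g x - f x * v x) = 0" by (simp add: integral_unique)
  moreover have "integral {0..pi} (\<lambda>x. u x * g x - f x * v x) = ip u g - ip f v"
    unfolding ip_def by (intro integral_diff ip_integrable sl_cont[OF u] sl_cont[OF v] c)
  ultimately show ?thesis by simp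
qed

text \<open>The equation is multiplied by u and integrated; the boundary term u u' vanishes, and V
  is at least 1. The second bound follows from 2 f u \<le> f^2 + u^2.\<close>

lemma sl_energy:
  assumes u: "sl u u' f" and c: "cont f"
  shows "ip u' u' + ip u u \<le> ip f u" "ip u' u' + ip u u \<le> ip f f"
proof -
  note uc = sl_cont[OF u]
  define w where "w x = u x * u' x" for x
  have "(w has_real_derivative u' x * u' x + V x * u x * u x - f x * u x) (at x)" if "x \<in> {0..pi}" for x
  proof -
    have "(w has_real_derivative u' x * u' x + u x * (V x * u x - f x)) (at x)"
      unfolding w_def using slD[OF u that] by (auto intro!: derivative_eq_intros)
    then show ?thesis by (simp add: algebra_simps)
  qed
  then have "((\<lambda>x. u' x * u' x + V x * u x * u x - f x * u x) has_integral w pi - w 0) {0..pi}"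
    by (intro fundamental_theorem_of_calculus)
      (auto intro: has_vector_derivative_at_within simp: has_real_derivative_iff_has_vector_derivative)
  moreover have "w pi - w 0 = 0"
    using u by (auto simp: w_def sl_def bc_def split: if_splits)
  ultimately have "integral {0..pi} (\<lambda>x. u' x * u' x + V x * u x * u x - f x * u x) = 0"
    by (simp add: integral_unique)
  moreover have "integral {0..pi} (\<lambda>x. u' x * u' x + u x * u x - f x * u x)
      \<le> integral {0..pi} (\<lambda>x. u' x * u' x + V x * u x * u x - f x * u x)"
  proof (rule integral_le)
    fix x
    show "u' x * u' x + u x * u x - f x * u x \<le> u' x * u' x + V x * u x * u x - f x * u x"
      using mult_right_mono[OF V_ge_1[of x], of "u x * u x"] by (simp add: mult.assoc)
  qed (intro integrable_continuous_interval continuous_intros uc c V_cont)+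
  moreover have "integral {0..pi} (\<lambda>x. u' x * u' x + u x * u x - f x * u x) = ip u' u' + ip u u - ip f u"
  proof -
    have i: "(\<lambda>x. u' x * u' x) integrable_on {0..pi}" "(\<lambda>x. u x * u x) integrable_on {0..pi}"
      "(\<lambda>x. f x * u x) integrable_on {0..pi}" by (intro ip_integrable uc c)+
    show ?thesis
      unfolding ip_def integral_diff[OF integrable_add[OF i(1,2)] i(3)] integral_add[OF i(1,2)] ..
  qed
  ultimately show 1: "ip u' u' + ip u u \<le> ip f u" by linarith
  have "0 \<le> ip (\<lambda>x. 1 * f x + (-1) * u x) (\<lambda>x. 1 * f x + (-1) * u x)"
    by (intro ip_self_nonneg continuous_intros uc c)
  also have "\<dots> = 1 * ip f (\<lambda>x. 1 * f x + (-1) * u x) + (-1) * ip u (\<lambda>x. 1 * f x + (-1) * u x)"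
    by (intro ip_lincomb_left continuous_intros uc c)
  also have "ip f (\<lambda>x. 1 * f x + (-1) * u x) = 1 * ip f f + (-1) * ip f u"
    by (intro ip_lincomb_right uc c)
  also have "ip u (\<lambda>x. 1 * f x + (-1) * u x) = 1 * ip u f + (-1) * ip u u"
    by (intro ip_lincomb_right uc c)
  finally have "2 * ip f u \<le> ip f f + ip u u" using ip_commute[of u f] by simp
  then show "ip u' u' + ip u u \<le> ip f f" using 1 ip_self_nonneg[OF uc(2)] by linarith
qed

lemma sl_unique:
  assumes "sl u u' f" "sl v v' f" "cont f" "x \<in> {0..pi}"
  shows "u x = v x"
proof -
  let ?d = "\<lambda>x. 1 * u x + (-1) * v x"
  have s: "sl ?d (\<lambda>x. 1 * u' x + (-1) * v' x) (\<lambda>x. 1 * f x + (-1) * f x)"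
    by (rule sl_lincomb[OF assms(1,2)])
  have "ip (\<lambda>x. 1 * u' x + (-1) * v' x) (\<lambda>x. 1 * u' x + (-1) * v' x) + ip ?d ?d
      \<le> ip (\<lambda>x. 1 * f x + (-1) * f x) ?d"
    by (rule sl_energy(1)[OF s]) simp
  also have "\<dots> = 0" by (simp add: ip_def)
  finally have "ip ?d ?d = 0"
    using ip_self_nonneg[OF sl_cont(1)[OF s]] ip_self_nonneg[OF sl_cont(2)[OF s]] by linarith
  from ip_self_zero[OF sl_cont(1)[OF s] this assms(4)] show ?thesis by simp
qed

text \<open>Cauchy-Schwarz for u' and the constant 1 on the interval between x and y.\<close>

lemma sl_holder:
  assumes u: "sl u u' f" and xy: "x \<in> {0..pi}" "y \<in> {0..pi}"
  shows "(u x - u y)\<^sup>2 \<le> \<bar>x - y\<bar> * ip u' u'"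
proof -
  have main: "(u x - u y)\<^sup>2 \<le> (y - x) * ip u' u'" if xy: "0 \<le> x" "x < y" "y \<le> pi" for x y
  proof -
    interpret I: interval_inner x y by unfold_locales fact
    have sub: "{x..y} \<subseteq> {0..pi}" using xy by auto
    have c: "I.cont u'" "I.cont (\<lambda>x. 1)" using continuous_on_subset[OF sl_cont(2)[OF u] sub] by auto
    have "(u' has_integral u y - u x) {x..y}"
    proof (rule fundamental_theorem_of_calculus)
      fix t assume "t \<in> {x..y}"
      then have "(u has_real_derivative u' t) (at t)" using slD(1)[OF u] sub by blast
      then show "(u has_vector_derivative u' t) (at t within {x..y})"
        using has_real_derivative_iff_has_vector_derivative has_vector_derivative_at_within by blast
    qed (use xy in simp)
    then have "I.ip u' (\<lambda>x. 1) = u y - u x" by (simp add: I.ip_def integral_unique)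
    moreover have "I.ip (\<lambda>x. 1) (\<lambda>x. 1) = y - x" using xy by (simp add: I.ip_def)
    ultimately have "(u y - u x)\<^sup>2 \<le> I.ip u' u' * (y - x)"
      using I.ip_Cauchy_Schwarz[OF c] by simp
    also have "I.ip u' u' \<le> ip u' u'"
      unfolding I.ip_def ip_def using sub c sl_cont(2)[OF u]
      by (intro integral_subset_le integrable_continuous_interval continuous_intros) auto
    finally show ?thesis using xy by (simp add: power2_commute mult.commute mult_right_mono)
  qed
  show ?thesis
    using main[of x y] main[of y x] xy
    by (cases x y rule: linorder_cases) (auto simp: power2_commute)
qed

text \<open>In \<open>sl_sup\<close> the inequality u(x)^2 \<le> 2 u(y)^2 + 2 pi |u'|^2, with the L2
  norm of u', is averaged over y in [0, pi]. This leaves the factors 2 / pi for the norm of u and 2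
  pi for that of u', both of which the energy estimate bounds by the norm of f.\<close>

definition sl_const :: real where "sl_const = 2 / pi + 2 * pi"

lemma sl_const_ge_1: "sl_const \<ge> 1"
proof -
  have "2 * pi \<ge> 1" using pi_gt3 by linarith
  moreover have "2 / pi > 0" by simp
  ultimately show ?thesis unfolding sl_const_def by linarith
qed

lemma sl_sup:
  assumes u: "sl u u' f" and c: "cont f" and x: "x \<in> {0..pi}"
  shows "(u x)\<^sup>2 \<le> sl_const * ip f f"
proof -
  note uc = sl_cont[OF u]
  have pt: "(u x)\<^sup>2 \<le> 2 * (u y * u y) + 2 * pi * ip u' u'" if y: "y \<in> {0..pi}" for y
  proof -
    have "(u x)\<^sup>2 \<le> 2 * (u y)\<^sup>2 + 2 * (u x - u y)\<^sup>2"
      using zero_le_power2[of "u x - 2 * u y"] by (simp add: power2_eq_square algebra_simps)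
    also have "(u x - u y)\<^sup>2 \<le> pi * ip u' u'"
    proof -
      have "\<bar>x - y\<bar> \<le> pi" using x y by auto
      then have "\<bar>x - y\<bar> * ip u' u' \<le> pi * ip u' u'"
        by (intro mult_right_mono ip_self_nonneg uc)
      then show ?thesis using sl_holder[OF u x y] by linarith
    qed
    finally show ?thesis by (simp add: power2_eq_square)
  qed
  have "integral {0..pi} (\<lambda>y. (u x)\<^sup>2) \<le> integral {0..pi} (\<lambda>y. 2 * (u y * u y) + 2 * pi * ip u' u')"
    using pt by (intro integral_le integrable_continuous_interval continuous_intros uc) auto
  also have "\<dots> = 2 * ip u u + pi * (2 * pi * ip u' u')"
    unfolding ip_def
    by (subst integral_add) (auto intro!: integrable_continuous_interval continuous_intros uc)
  also have "\<dots> \<le> 2 * ip f f + pi * (2 * pi * ip f f)"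
    using sl_energy(2)[OF u c] ip_self_nonneg[OF uc(1)] ip_self_nonneg[OF uc(2)]
    by (intro add_mono mult_left_mono) auto
  finally have "pi * (u x)\<^sup>2 \<le> pi * (sl_const * ip f f)"
    by (simp add: sl_const_def algebra_simps)
  then show ?thesis by simp
qed

text \<open>A solution that meets the condition at 0 cannot meet the one at pi: u u' vanishes at 0,
  so its value at pi is the integral of u'^2 + V u^2, which is positive.\<close>

lemma fundamental_solutions:
  obtains u u' where "hill_solution_on UNIV V u u'"
    "if neu then u' 0 = 0 \<and> u 0 \<noteq> 0 else u 0 = 0 \<and> u' 0 \<noteq> 0" "u pi * u' pi \<noteq> 0"
proof -
  define a b :: real where "a = (if neu then 1 else 0)" and "b = (if neu then 0 else 1)"
  obtain u u' where u: "u 0 = a" "u' 0 = b" "hill_solution_on UNIV V u u'"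
    using hill_initial_value[OF V_cont] by blast
  note d = hill_solution_onD[OF u(3) UNIV_I]
  have uc: "cont u" "cont u'" using d by (auto intro!: continuous_at_imp_continuous_on DERIV_isCont)
  have "((\<lambda>x. u x * u' x) has_real_derivative u' x * u' x + V x * u x * u x) (at x)" for x
    using d by (auto intro!: derivative_eq_intros)
  then have "((\<lambda>x. u' x * u' x + V x * u x * u x) has_integral u pi * u' pi - u 0 * u' 0) {0..pi}"
    by (intro fundamental_theorem_of_calculus)
      (auto intro: has_vector_derivative_at_within simp: has_real_derivative_iff_has_vector_derivative)
  moreover have "u 0 * u' 0 = 0" using u by (simp add: a_def b_def)
  ultimately have 1: "integral {0..pi} (\<lambda>x. u' x * u' x + V x * u x * u x) = u pi * u' pi"
    by (simp add: integral_unique)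
  have "integral {0..pi} (\<lambda>x. u' x * u' x + u x * u x)
      \<le> integral {0..pi} (\<lambda>x. u' x * u' x + V x * u x * u x)"
  proof (rule integral_le)
    fix x
    show "u' x * u' x + u x * u x \<le> u' x * u' x + V x * u x * u x"
      using mult_right_mono[OF V_ge_1[of x], of "u x * u x"] by (simp add: mult.assoc)
  qed (intro integrable_continuous_interval continuous_intros uc V_cont)+
  moreover have "integral {0..pi} (\<lambda>x. u' x * u' x + u x * u x) = ip u' u' + ip u u"
    unfolding ip_def by (intro integral_add integrable_continuous_interval continuous_intros uc)
  moreover have "ip u' u' + ip u u > 0"
  proof (cases neu)
    case True
    then have "ip u u > 0" using u uc by (intro ip_self_pos[of _ 0]) (auto simp: a_def)
    then show ?thesis using ip_self_nonneg[OF uc(2)] by simp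
  next
    case False
    then have "ip u' u' > 0" using u uc by (intro ip_self_pos[of _ 0]) (auto simp: b_def)
    then show ?thesis using ip_self_nonneg[OF uc(1)] by simp
  qed
  ultimately have "u pi * u' pi \<noteq> 0" using 1 by linarith
  then show ?thesis using u by (intro that[of u u']) (auto simp: a_def b_def)
qed

text \<open>Variation of parameters, that is, Green's function: u1 satisfies the condition at 0, its
  reflection u2 the one at pi, and their constant Wronskian is nonzero by the preceding
  lemma.\<close>

lemma sl_exists:
  assumes f: "cont f"
  shows "\<exists>u u'. sl u u' f"
proof -
  obtain u1 u1' where u1: "hill_solution_on UNIV V u1 u1'"
    "if neu then u1' 0 = 0 \<and> u1 0 \<noteq> 0 else u1 0 = 0 \<and> u1' 0 \<noteq> 0" "u1 pi * u1' pi \<noteq> 0" by (rule fundamental_solutions)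
  define u2 u2' where "u2 x = u1 (pi - x)" and "u2' x = - u1' (pi - x)" for x
  have u2: "hill_solution_on UNIV V u2 u2'"
    unfolding u2_def u2'_def by (rule hill_solution_on_reflect[OF u1(1) V_reflect(1)])
  note d1 = hill_solution_onD[OF u1(1) UNIV_I] and d2 = hill_solution_onD[OF u2 UNIV_I]
  define W where "W = u1' 0 * u2 0 - u1 0 * u2' 0"
  have W: "u1' x * u2 x - u1 x * u2' x = W" for x
  proof -
    have "((\<lambda>x. u1' x * u2 x - u1 x * u2' x) has_real_derivative
        (V x * u1 x * u2 x + u1' x * u2' x) - (u1' x * u2' x + u1 x * (V x * u2 x))) (at x)" for x
      using d1 d2 by (auto intro!: derivative_eq_intros)
    then have "\<forall>x. ((\<lambda>x. u1' x * u2 x - u1 x * u2' x) has_real_derivative 0) (at x)" by simp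
    from DERIV_isconst_all[OF this, of x 0] show ?thesis by (simp add: W_def)
  qed
  have W0: "W \<noteq> 0" using u1(2,3) by (auto simp: W_def u2_def u2'_def split: if_splits)
  \<comment> \<open>f is only given on [0, pi]; it is continued by its boundary values, which keeps
    it continuous and yields the two-sided derivatives at the end points.\<close>
  define fe where "fe x = f (max 0 (min pi x))" for x
  have fe: "continuous_on UNIV fe"
    unfolding fe_def by (rule continuous_on_compose2[OF f]) (auto intro!: continuous_intros)
  have uc: "continuous_on UNIV u1" "continuous_on UNIV u2"
    using hill_solution_on_continuous u1(1) u2 by blast+
  define A where "A = primitive (\<lambda>x. u1 x * fe x)"
  define B where "B = primitive (\<lambda>x. u2 x * fe x)"
  have dA: "(A has_real_derivative u1 x * fe x) (at x)" for x
    unfolding A_def by (intro has_real_derivative_primitive continuous_intros uc fe)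
  have dB: "(B has_real_derivative u2 x * fe x) (at x)" for x
    unfolding B_def by (intro has_real_derivative_primitive continuous_intros uc fe)
  define u where "u x = (u2 x * A x + u1 x * (B pi - B x)) / W" for x
  define u' where "u' x = (u2' x * A x + u1' x * (B pi - B x)) / W" for x
  have du: "(u has_real_derivative u' x) (at x)" for x
  proof -
    have "(u has_real_derivative ((u2' x * A x + u2 x * (u1 x * fe x)) +
        (u1' x * (B pi - B x) + u1 x * (0 - u2 x * fe x))) / W) (at x)"
      unfolding u_def using d1(1)[of x] d2(1)[of x] dA[of x] dB[of x]
      by (intro DERIV_cdivide) (auto intro!: derivative_eq_intros simp: algebra_simps)
    then show ?thesis by (simp add: u'_def algebra_simps)
  qed
  have du': "(u' has_real_derivative V x * u x - fe x) (at x)" for x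
  proof -
    have "(u' has_real_derivative ((u2' x * (u1 x * fe x) + V x * u2 x * A x) +
        (u1' x * (0 - u2 x * fe x) + V x * u1 x * (B pi - B x))) / W) (at x)"
      unfolding u'_def using d1(2)[of x] d2(2)[of x] dA[of x] dB[of x]
      by (intro DERIV_cdivide) (auto intro!: derivative_eq_intros simp: algebra_simps)
    moreover have "((u2' x * (u1 x * fe x) + V x * u2 x * A x) +
        (u1' x * (0 - u2 x * fe x) + V x * u1 x * (B pi - B x))) / W
      = V x * u x - (u1' x * u2 x - u1 x * u2' x) * fe x / W"
      by (simp add: u_def diff_divide_distrib add_divide_distrib algebra_simps)
    ultimately show ?thesis using W[of x] W0 by simp
  qed
  have "bc u u'"
    using u1(2) by (auto simp: bc_def u_def u'_def u2_def u2'_def A_def split: if_splits)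
  moreover have "fe x = f x" if "x \<in> {0..pi}" for x using that by (simp add: fe_def)
  ultimately have "sl u u' f" using du du' unfolding sl_def by metis
  then show ?thesis by blast
qed

text \<open>The boundary value problem determines the solution on [0, pi] only; outside, the values
  are an arbitrary choice. Statements about \<open>T f\<close> are therefore confined to
  [0, pi].\<close>

definition T :: "(real \<Rightarrow> real) \<Rightarrow> real \<Rightarrow> real" where
  "T f = (SOME u. \<exists>u'. sl u u' f)"

lemma sl_T: assumes "cont f" obtains v where "sl (T f) v f"
  using someI_ex[of "\<lambda>u. \<exists>u'. sl u u' f"] sl_exists[OF assms] unfolding T_def by blast

lemma T_eqI: assumes "sl u u' f" "cont f" "x \<in> {0..pi}" shows "T f x = u x"
  using sl_T[OF assms(2)] sl_unique assms by metis

sublocale compact_positive_operator 0 pi T sl_const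
proof unfold_locales
  show "0 < sl_const" using sl_const_ge_1 by linarith
  fix f assume f: "cont f"
  obtain v where v: "sl (T f) v f" using sl_T[OF f] .
  show "cont (T f)" using sl_cont[OF v] by blast
  show "0 \<le> ip (T f) f"
    using sl_energy(1)[OF v f] ip_self_nonneg[OF sl_cont(1)[OF v]] ip_self_nonneg[OF sl_cont(2)[OF v]]
      ip_commute[of "T f" f] by linarith
  show "ip (T f) g = ip f (T g)" if g: "cont g" for g
  proof -
    obtain w where w: "sl (T g) w g" using sl_T[OF g] .
    show ?thesis by (rule sl_green[OF v w f g])
  qed
  show "T (\<lambda>x. s * f x + t * g x) x = s * T f x + t * T g x" if g: "cont g" "x \<in> {0..pi}" for g s t x
  proof -
    obtain w where w: "sl (T g) w g" using sl_T[OF g(1)] .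
    show ?thesis by (rule T_eqI[OF sl_lincomb[OF v w]]) (intro continuous_intros f g)+
  qed
  show "(T f x)\<^sup>2 \<le> sl_const * ip f f" if "x \<in> {0..pi}" for x
    by (rule sl_sup[OF v f that])
  show "(T f x - T f y)\<^sup>2 \<le> sl_const * \<bar>x - y\<bar> * ip f f" if "x \<in> {0..pi}" "y \<in> {0..pi}" for x y
  proof -
    have "(T f x - T f y)\<^sup>2 \<le> 1 * \<bar>x - y\<bar> * ip v v" using sl_holder[OF v that] by simp
    also have "\<dots> \<le> sl_const * \<bar>x - y\<bar> * ip f f"
      using sl_energy(2)[OF v f] sl_const_ge_1 ip_self_nonneg[OF sl_cont(1)[OF v]]
        ip_self_nonneg[OF sl_cont(2)[OF v]]
      by (intro mult_mono) auto
    finally show ?thesis .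
  qed
  show "f x = 0" if z: "\<And>x. x \<in> {0..pi} \<Longrightarrow> T f x = 0" and x: "x \<in> {0..pi}" for x
  proof -
    \<comment> \<open>In the open interval the zero function has zero derivatives of both orders, so
      the equation gives f = 0 there; the end points follow by continuity.\<close>
    have v0: "v y = 0" if y: "y \<in> {0<..<pi}" for y
    proof -
      have "((\<lambda>x. 0) has_real_derivative v y) (at y)"
        by (rule has_field_derivative_transform_within_open[OF slD(1)[OF v] _ y]) (use y z in auto)
      then show ?thesis using DERIV_unique DERIV_const by blast
    qed
    have f0: "f y = 0" if y: "y \<in> {0<..<pi}" for y
    proof -
      have "((\<lambda>x. 0) has_real_derivative V y * T f y - f y) (at y)"
        by (rule has_field_derivative_transform_within_open[OF slD(2)[OF v] _ y]) (use y v0 in auto)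
      then have "V y * T f y - f y = 0" using DERIV_unique DERIV_const by blast
      then show ?thesis using z[of y] y by simp
    qed
    have cl: "closure {0<..<pi} = {0..pi}" by simp
    show ?thesis
      by (rule continuous_constant_on_closure[of "{0<..<pi}" f 0 x]) (use f f0 x cl in auto)
  qed
qed

section \<open>Periodic Mathieu functions of a given parity as eigenvectors of the inverse
  operator\<close>

definition eigenfunction :: "real \<Rightarrow> (real \<Rightarrow> real) \<Rightarrow> bool" where
  "eigenfunction lam u \<longleftrightarrow> mathieu_solution lam (- (h\<^sup>2)) u \<and> (if neu then even_fun u else odd_fun u) \<and>
     periodic_fun_simple u (2 * pi) \<and> (\<exists>x. u x \<noteq> 0)"

lemma mathieu_solution_iff:
  "mathieu_solution lam (- (h\<^sup>2)) u \<longleftrightarrow> (\<exists>u'. hill_solution_on UNIV (\<lambda>x. V x - (lam + shift)) u u')"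
proof -
  have eq: "V x - (lam + shift) = - (lam - 2 * (- (h\<^sup>2)) * cos (2 * x))" for x
    by (simp add: V_def)
  show ?thesis
  proof
    assume "mathieu_solution lam (- (h\<^sup>2)) u"
    then obtain u' u'' where u: "\<And>x. (u has_real_derivative u' x) (at x)"
      "\<And>x. (u' has_real_derivative u'' x) (at x)"
      "\<And>x. u'' x + (lam - 2 * (- (h\<^sup>2)) * cos (2 * x)) * u x = 0"
      unfolding mathieu_solution_def by blast
    have "u'' x = (V x - (lam + shift)) * u x" for x
      unfolding eq using u(3)[of x] by (simp add: algebra_simps)
    then have "hill_solution_on UNIV (\<lambda>x. V x - (lam + shift)) u u'"
      using u(1,2) unfolding hill_solution_on_def by metis
    then show "\<exists>u'. hill_solution_on UNIV (\<lambda>x. V x - (lam + shift)) u u'" by blast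
  next
    assume "\<exists>u'. hill_solution_on UNIV (\<lambda>x. V x - (lam + shift)) u u'"
    then obtain u' where u: "hill_solution_on UNIV (\<lambda>x. V x - (lam + shift)) u u'" by blast
    show "mathieu_solution lam (- (h\<^sup>2)) u"
      unfolding mathieu_solution_def
      by (intro exI[of _ u'] exI[of _ "\<lambda>x. (V x - (lam + shift)) * u x"])
        (use hill_solution_onD[OF u UNIV_I] in \<open>auto simp: eq algebra_simps\<close>)
  qed
qed

lemma hill_cont: "continuous_on S (\<lambda>x. V x - e)"
  by (intro continuous_intros V_cont)

text \<open>Parity about 0 and the period give the same parity about pi, and thus the boundary
  condition at both ends. Restricted to [0, pi], u solves the problem with right side (lam + shift)
  u; the energy estimate then forces lam + shift \<ge> 1.\<close>

lemma eigenfunctionE: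
  assumes "eigenfunction lam u"
  obtains u' where "hill_solution_on UNIV (\<lambda>x. V x - (lam + shift)) u u'" "bc u u'"
    "cont u" "ip u u > 0" "lam + shift \<ge> 1"
    "\<And>x. x \<in> {0..pi} \<Longrightarrow> T u x = 1 / (lam + shift) * u x"
proof -
  obtain u' where u': "hill_solution_on UNIV (\<lambda>x. V x - (lam + shift)) u u'"
    using assms mathieu_solution_iff unfolding eigenfunction_def by blast
  note d = hill_solution_onD[OF u' UNIV_I]
  interpret P: periodic_fun_simple u "2 * pi" using assms by (simp add: eigenfunction_def)
  define s :: real where "s = (if neu then 1 else - 1)"
  have par: "u (0 - x) = s * u x" for x
    using assms by (auto simp: eigenfunction_def even_fun_def odd_fun_def s_def split: if_splits)
  have par2: "u (2 * pi - x) = s * u x" for x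
    using P.plus_1[of "- x"] par[of x] by simp
  have "u' 0 = - s * u' 0" "u' pi = - s * u' pi"
    using has_real_derivative_even_odd[OF d(1) par, of 0] has_real_derivative_even_odd[OF d(1) par2, of pi]
    by auto
  moreover have "u 0 = s * u 0" "u pi = s * u pi" using par[of 0] par2[of pi] by auto
  ultimately have bc: "bc u u'" by (auto simp: bc_def s_def split: if_splits)
  have c: "cont u" using d by (auto intro!: continuous_at_imp_continuous_on DERIV_isCont)
  have "\<exists>x\<in>{0..pi}. u x \<noteq> 0"
  proof (rule ccontr)
    assume *: "\<not> (\<exists>x\<in>{0..pi}. u x \<noteq> 0)"
    have m: "pi / 2 \<in> {0<..<pi}" by auto
    have "((\<lambda>x. 0) has_real_derivative u' (pi / 2)) (at (pi / 2))"
      by (rule has_field_derivative_transform_within_open[OF d(1) _ m]) (use * in auto)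
    then have "u' (pi / 2) = 0" using DERIV_unique DERIV_const by blast
    moreover have "u (pi / 2) = 0" using * m by auto
    ultimately have "u x = 0" for x
      using hill_solution_zero[OF u' is_interval_univ hill_cont UNIV_I _ _ UNIV_I] by blast
    then show False using assms by (auto simp: eigenfunction_def)
  qed
  then have pos: "ip u u > 0" using ip_self_pos[OF c] by blast
  have sl: "sl u u' (\<lambda>x. (lam + shift) * u x + 0 * u x)"
    using bc d by (simp add: sl_def algebra_simps)
  have "ip u' u' + ip u u \<le> ip (\<lambda>x. (lam + shift) * u x + 0 * u x) u"
    by (rule sl_energy(1)[OF sl]) (intro continuous_intros c)
  also have "\<dots> = (lam + shift) * ip u u" using ip_lincomb_left[OF c c c, of "lam + shift" 0] by simp
  finally have "1 * ip u u \<le> (lam + shift) * ip u u" using ip_self_nonneg[OF sl_cont(2)[OF sl]] by simp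
  then have ge: "lam + shift \<ge> 1" using pos by (simp only: mult_le_cancel_right)
  have "T u x = 1 / (lam + shift) * u x" if x: "x \<in> {0..pi}" for x
  proof -
    have "u x = T (\<lambda>x. (lam + shift) * u x + 0 * u x) x"
      by (rule T_eqI[OF sl _ x, symmetric]) (intro continuous_intros c)
    also have "\<dots> = (lam + shift) * T u x" using T_lin[OF c c x, of "lam + shift" 0] by simp
    finally show ?thesis using ge by (simp add: field_simps)
  qed
  then show ?thesis using that u' bc c pos ge by blast
qed

text \<open>The multiple \<open>T g\<close> of g is a solution on [0, pi] and is continued to the
  line by its initial values at 0. The boundary conditions and uniqueness give reflection symmetry
  about 0 and about pi; composing the two reflections gives the period 2 pi.\<close>

lemma eigenfunction_of_T:
  assumes g: "cont g" and \<nu>: "\<nu> > 0" and Tg: "\<And>x. x \<in> {0..pi} \<Longrightarrow> T g x = \<nu> * g x"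
    and nz: "\<exists>x\<in>{0..pi}. g x \<noteq> 0"
  obtains u where "eigenfunction (1 / \<nu> - shift) u" "\<And>x. x \<in> {0..pi} \<Longrightarrow> u x = g x"
proof -
  obtain v where v: "sl (T g) v g" using sl_T[OF g] .
  define Q where "Q x = V x - 1 / \<nu>" for x
  have Qc: "continuous_on S Q" for S unfolding Q_def by (rule hill_cont)
  have w: "hill_solution_on {0..pi} Q (T g) v"
    unfolding hill_solution_on_def
  proof (intro ballI conjI)
    fix x :: real assume x: "x \<in> {0..pi}"
    show "(T g has_real_derivative v x) (at x)" by (rule slD(1)[OF v x])
    have "V x * T g x - g x = Q x * T g x" using Tg[OF x] \<nu> by (simp add: Q_def algebra_simps)
    then show "(v has_real_derivative Q x * T g x) (at x)" using slD(2)[OF v x] by simp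
  qed
  obtain U U' where U: "U 0 = T g 0" "U' 0 = v 0" "hill_solution_on UNIV Q U U'"
    using hill_initial_value[OF Qc] by blast
  have UT: "U x = T g x" "U' x = v x" if "x \<in> {0..pi}" for x
    by (rule hill_solution_unique[OF hill_solution_on_subset[OF U(3)] w is_interval_cc Qc, of 0 x];
        use U that in auto)+
  have bc: "bc U U'"
  proof -
    have "bc (T g) v" using v unfolding sl_def by blast
    moreover have "U 0 = T g 0" "U pi = T g pi" "U' 0 = v 0" "U' pi = v pi" using UT by auto
    ultimately show ?thesis by (simp only: bc_def)
  qed
  define s :: real where "s = (if neu then 1 else - 1)"
  have sym: "U (p - x) = s * U x" if p: "p = 0 \<or> p = 2 * pi" for p x
  proof -
    have Qp: "Q (p - x) = Q x" for x using p V_reflect by (auto simp: Q_def)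
    have R: "hill_solution_on UNIV Q (\<lambda>x. s * U (p - x) + 0 * U x) (\<lambda>x. s * (- U' (p - x)) + 0 * U' x)"
      by (rule hill_solution_on_lincomb[OF hill_solution_on_reflect[OF U(3) Qp] U(3)])
    have "s * U (p - x) + 0 * U x = U x"
      by (rule hill_solution_unique(1)[OF R U(3) is_interval_univ Qc UNIV_I[of "p / 2"]])
        (use bc p in \<open>auto simp: bc_def s_def split: if_splits\<close>)
    then have "s * (s * U (p - x)) = s * U x" by simp
    then show ?thesis by (simp add: s_def split: if_splits)
  qed
  have per: "U (x + 2 * pi) = U x" for x
  proof -
    have "U (x + 2 * pi) = s * U (- x)" using sym[of "2 * pi" "- x"] by (simp add: add.commute)
    also have "\<dots> = s * (s * U x)" using sym[of 0 x] by simp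
    finally show ?thesis by (simp add: s_def split: if_splits)
  qed
  define u where "u x = (1 / \<nu>) * U x + 0 * U x" for x
  have ug: "u x = g x" if "x \<in> {0..pi}" for x using UT(1)[OF that] Tg[OF that] \<nu> by (simp add: u_def)
  have "hill_solution_on UNIV Q u (\<lambda>x. (1 / \<nu>) * U' x + 0 * U' x)"
    unfolding u_def by (rule hill_solution_on_lincomb[OF U(3,3)])
  then have "mathieu_solution (1 / \<nu> - shift) (- (h\<^sup>2)) u"
    unfolding mathieu_solution_iff Q_def by auto
  moreover have "if neu then even_fun u else odd_fun u"
    using sym[of 0] by (auto simp: even_fun_def odd_fun_def u_def s_def)
  moreover have "periodic_fun_simple u (2 * pi)" by unfold_locales (simp add: u_def per)
  moreover have "\<exists>x. u x \<noteq> 0" using nz ug by metis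
  ultimately have "eigenfunction (1 / \<nu> - shift) u" by (simp add: eigenfunction_def)
  then show ?thesis using ug that by blast
qed

text \<open>The boundary condition at 0 leaves a single free initial value, so eigenvalues are
  simple.\<close>

lemma eigenfunction_proportional:
  assumes "eigenfunction lam u" "eigenfunction lam v"
  shows "\<exists>c. c \<noteq> 0 \<and> (\<forall>x. u x = c * v x)"
proof -
  obtain u' where u': "hill_solution_on UNIV (\<lambda>x. V x - (lam + shift)) u u'" "bc u u'"
    using eigenfunctionE[OF assms(1)] by blast
  obtain v' where v': "hill_solution_on UNIV (\<lambda>x. V x - (lam + shift)) v v'" "bc v v'"
    using eigenfunctionE[OF assms(2)] by blast
  define c where "c = (if neu then u 0 / v 0 else u' 0 / v' 0)"
  have nz: "(if neu then v 0 else v' 0) \<noteq> 0"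
  proof
    assume "(if neu then v 0 else v' 0) = 0"
    then have "v 0 = 0" "v' 0 = 0" using v'(2) by (auto simp: bc_def split: if_splits)
    then have "v x = 0" for x
      using hill_solution_zero[OF v'(1) is_interval_univ hill_cont UNIV_I _ _ UNIV_I] by blast
    then show False using assms(2) by (auto simp: eigenfunction_def)
  qed
  have R: "hill_solution_on UNIV (\<lambda>x. V x - (lam + shift)) (\<lambda>x. c * v x + 0 * v x) (\<lambda>x. c * v' x + 0 * v' x)"
    by (rule hill_solution_on_lincomb[OF v'(1) v'(1)])
  have eq: "u x = c * v x + 0 * v x" for x
    by (rule hill_solution_unique(1)[OF u'(1) R is_interval_univ hill_cont UNIV_I[of 0]])
      (use nz u'(2) v'(2) in \<open>auto simp: bc_def c_def split: if_splits\<close>)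
  moreover have "c \<noteq> 0" using eq assms(1) by (auto simp: eigenfunction_def)
  ultimately show ?thesis by auto
qed

lemma eigenfunction_orthogonal:
  assumes "eigenfunction lam u" "eigenfunction mu v" "lam \<noteq> mu"
  shows "ip u v = 0"
proof -
  obtain u' where u: "cont u" "lam + shift \<ge> 1"
    "\<And>x. x \<in> {0..pi} \<Longrightarrow> T u x = 1 / (lam + shift) * u x"
    using eigenfunctionE[OF assms(1)] by blast
  obtain v' where v: "cont v" "mu + shift \<ge> 1"
    "\<And>x. x \<in> {0..pi} \<Longrightarrow> T v x = 1 / (mu + shift) * v x"
    using eigenfunctionE[OF assms(2)] by blast
  have "ip (T u) v = ip (\<lambda>x. 1 / (lam + shift) * u x + 0 * u x) v" by (rule ip_cong) (auto simp: u(3))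
  also have "\<dots> = 1 / (lam + shift) * ip u v" using ip_lincomb_left[OF u(1) u(1) v(1), of "1 / (lam + shift)" 0] by simp
  finally have 1: "ip (T u) v = 1 / (lam + shift) * ip u v" .
  have "ip u (T v) = ip u (\<lambda>x. 1 / (mu + shift) * v x + 0 * v x)" by (rule ip_cong) (auto simp: v(3))
  also have "\<dots> = 1 / (mu + shift) * ip u v" using ip_lincomb_right[OF v(1) v(1) u(1), of "1 / (mu + shift)" 0] by simp
  finally have "1 / (lam + shift) * ip u v = 1 / (mu + shift) * ip u v"
    using 1 T_sym[OF u(1) v(1)] by linarith
  moreover have "1 / (lam + shift) \<noteq> 1 / (mu + shift)" using assms(3) u(2) v(2) by simp
  ultimately show ?thesis by (metis mult_right_cancel)
qed

definition eigenvalues :: "real set" where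
  "eigenvalues = {lam. \<exists>u. eigenfunction lam u}"

lemma normalized_eigenfunctions:
  obtains e where "\<And>lam. lam \<in> eigenvalues \<Longrightarrow> eigenfunction lam (e lam)"
    "\<And>lam mu. lam \<in> eigenvalues \<Longrightarrow> mu \<in> eigenvalues \<Longrightarrow> ip (e lam) (e mu) = (if lam = mu then 1 else 0)"
proof -
  have "\<exists>u. eigenfunction lam u \<and> ip u u = 1" if lam: "lam \<in> eigenvalues" for lam
  proof -
    obtain w where w: "eigenfunction lam w" using lam by (auto simp: eigenvalues_def)
    obtain w' where w': "hill_solution_on UNIV (\<lambda>x. V x - (lam + shift)) w w'" "cont w" "ip w w > 0"
      using eigenfunctionE[OF w] by blast
    define c where "c = 1 / sqrt (ip w w)"
    have c: "c \<noteq> 0" using w'(3) by (simp add: c_def)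
    define u where "u x = c * w x + 0 * w x" for x
    interpret P: periodic_fun_simple w "2 * pi" using w by (simp add: eigenfunction_def)
    have "hill_solution_on UNIV (\<lambda>x. V x - (lam + shift)) u (\<lambda>x. c * w' x + 0 * w' x)"
      unfolding u_def by (rule hill_solution_on_lincomb[OF w'(1,1)])
    then have "mathieu_solution lam (- (h\<^sup>2)) u" unfolding mathieu_solution_iff by blast
    moreover have "periodic_fun_simple u (2 * pi)" by unfold_locales (simp add: u_def P.plus_1)
    ultimately have "eigenfunction lam u"
      using w c by (auto simp: eigenfunction_def u_def even_fun_def odd_fun_def)
    moreover have "ip u u = 1"
    proof -
      have "cont u" unfolding u_def by (intro continuous_intros w'(2))
      then have "ip (\<lambda>x. c * w x + 0 * w x) u = c * ip w u"
        using ip_lincomb_left[OF w'(2,2), of u c 0] by linarith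
      then have "ip u u = c * ip w u" by (simp add: ip_def u_def)
      also have "ip w u = c * ip w w" using ip_lincomb_right[OF w'(2,2,2), of c 0] by (simp add: ip_def u_def)
      finally show ?thesis using w'(3) by (simp add: c_def)
    qed
    ultimately show ?thesis by blast
  qed
  then obtain e where e: "\<And>lam. lam \<in> eigenvalues \<Longrightarrow> eigenfunction lam (e lam)"
    "\<And>lam. lam \<in> eigenvalues \<Longrightarrow> ip (e lam) (e lam) = 1" by metis
  show ?thesis   proof (rule that[of e])
    show "ip (e lam) (e mu) = (if lam = mu then 1 else 0)"
      if "lam \<in> eigenvalues" "mu \<in> eigenvalues" for lam mu
      using e that eigenfunction_orthogonal[OF e(1)[OF that(1)] e(1)[OF that(2)]] by auto
  qed (rule e)
qed

text \<open>An eigenvalue up to L contributes at least 1 / M^2 to the sum of squares bounded by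
  \<open>sum_eigenvalue_squares_le\<close>, so there are at most M^2 times
  \<open>sl_const * pi\<close> of them.\<close>

lemma finite_eigenvalues_below: "finite {lam \<in> eigenvalues. lam \<le> L}"
proof -
  obtain e where e: "\<And>lam. lam \<in> eigenvalues \<Longrightarrow> eigenfunction lam (e lam)"
    "\<And>lam mu. lam \<in> eigenvalues \<Longrightarrow> mu \<in> eigenvalues \<Longrightarrow> ip (e lam) (e mu) = (if lam = mu then 1 else 0)"
    using normalized_eigenfunctions by blast
  define M where "M = \<bar>L + shift\<bar> + 1"
  have M: "M > 0" by (simp add: M_def)
  have bound: "real (card F) \<le> M\<^sup>2 * (sl_const * pi)"
    if F: "finite F" "F \<subseteq> {lam \<in> eigenvalues. lam \<le> L}" for F
  proof -
    have sq: "(\<Sum>lam\<in>F. (1 / (lam + shift))\<^sup>2) \<le> sl_const * (pi - 0)"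
    proof (rule sum_eigenvalue_squares_le[OF F(1), where e = e and N = 1])
      fix lam assume "lam \<in> F"
      then have ef: "eigenfunction lam (e lam)" using e F by auto
      then show "cont (e lam)" using eigenfunctionE by blast
      show "T (e lam) x = 1 / (lam + shift) * e lam x" if "x \<in> {0..pi}" for x
        using eigenfunctionE[OF ef] that by blast
      show "ip (e lam) (e mu) = (if lam = mu then 1 else 0)" if "mu \<in> F" for mu
        using e(2)[of lam mu] F \<open>lam \<in> F\<close> that by blast
    qed simp
    have "(1 / M)\<^sup>2 \<le> (1 / (lam + shift))\<^sup>2" if "lam \<in> F" for lam
    proof -
      have "eigenfunction lam (e lam)" using e F that by auto
      then have "lam + shift \<ge> 1" using eigenfunctionE by blast
      moreover have "lam + shift \<le> M" using F that by (auto simp: M_def)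
      ultimately have "1 / M \<le> 1 / (lam + shift)" using M by (simp add: frac_le)
      then show ?thesis using M by (intro power_mono) simp_all
    qed
    then have "(\<Sum>lam\<in>F. (1 / M)\<^sup>2) \<le> (\<Sum>lam\<in>F. (1 / (lam + shift))\<^sup>2)" by (rule sum_mono)
    then have "real (card F) * (1 / M)\<^sup>2 \<le> sl_const * pi" using sq by simp
    then have "M\<^sup>2 * (real (card F) * (1 / M)\<^sup>2) \<le> M\<^sup>2 * (sl_const * pi)"
      by (intro mult_left_mono) simp_all
    then show ?thesis using M by (simp add: power_divide)
  qed
  show ?thesis
  proof (rule conjunct1[OF finite_if_finite_subsets_card_bdd[of _ "nat \<lceil>M\<^sup>2 * (sl_const * pi)\<rceil>"]])
    fix F assume "F \<subseteq> {lam \<in> eigenvalues. lam \<le> L}" "finite F"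
    from bound[OF this(2,1)] show "card F \<le> nat \<lceil>M\<^sup>2 * (sl_const * pi)\<rceil>" by linarith
  qed
qed

text \<open>If there were only finitely many eigenvalues, every continuous function would be a combination of
  eigenfunctions and hence differentiable.\<close>

lemma infinite_eigenvalues: "infinite eigenvalues"
proof
  assume fin: "finite eigenvalues"
  obtain e where e: "\<And>lam. lam \<in> eigenvalues \<Longrightarrow> eigenfunction lam (e lam)"
    "\<And>lam mu. lam \<in> eigenvalues \<Longrightarrow> mu \<in> eigenvalues \<Longrightarrow> ip (e lam) (e mu) = (if lam = mu then 1 else 0)"
    using normalized_eigenfunctions by blast
  have ec: "cont (e lam)" if "lam \<in> eigenvalues" for lam using eigenfunctionE[OF e(1)[OF that]] by blast
  \<comment> \<open>Continuous, with a kink in the interior of [0, pi].\<close>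
  define f :: "real \<Rightarrow> real" where "f x = \<bar>x - pi / 2\<bar>" for x
  have fc: "cont f" unfolding f_def by (intro continuous_intros)
  define p where "p x = (\<Sum>lam\<in>eigenvalues. ip f (e lam) * e lam x)" for x
  have pc: "cont p" unfolding p_def by (intro continuous_intros ec)
  define d where "d x = 1 * f x + (-1) * p x" for x
  have dc: "cont d" unfolding d_def by (intro continuous_intros fc pc)
  have d_orth: "ip d (e mu) = 0" if mu: "mu \<in> eigenvalues" for mu
  proof -
    have "ip p (e mu) = (\<Sum>lam\<in>eigenvalues. ip f (e lam) * ip (e lam) (e mu))"
      unfolding p_def by (rule ip_sum_left[OF fin ec ec[OF mu]])
    also have "\<dots> = (\<Sum>lam\<in>eigenvalues. if lam = mu then ip f (e mu) else 0)"
      using e(2) mu by (intro sum.cong) auto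
    also have "\<dots> = ip f (e mu)" using fin mu by simp
    finally have "ip p (e mu) = ip f (e mu)" .
    moreover have "ip d (e mu) = 1 * ip f (e mu) + (-1) * ip p (e mu)"
      unfolding d_def by (rule ip_lincomb_left[OF fc pc ec[OF mu]])
    ultimately show ?thesis by simp
  qed
  have "T d x = 0" if x: "x \<in> {0..pi}" for x
  proof (rule T_zero_of_orthogonal[where I = eigenvalues and e = e and \<mu> = "\<lambda>lam. 1 / (lam + shift)"])
    show "T (e lam) x = 1 / (lam + shift) * e lam x" if "lam \<in> eigenvalues" "x \<in> {0..pi}" for lam x
      using eigenfunctionE[OF e(1)[OF that(1)]] that(2) by blast
    fix g \<nu> assume g: "cont g" "\<nu> > 0" "\<And>x. x \<in> {0..pi} \<Longrightarrow> T g x = \<nu> * g x" "\<exists>x\<in>{0..pi}. g x \<noteq> 0"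
    obtain u where u: "eigenfunction (1 / \<nu> - shift) u" "\<And>x. x \<in> {0..pi} \<Longrightarrow> u x = g x"
      using eigenfunction_of_T[OF g] by blast
    have mem: "1 / \<nu> - shift \<in> eigenvalues" using u by (auto simp: eigenvalues_def)
    obtain c where c: "c \<noteq> 0" "\<And>x. e (1 / \<nu> - shift) x = c * u x"
      using eigenfunction_proportional[OF e(1)[OF mem] u(1)] by blast
    have "ip g (e (1 / \<nu> - shift)) = ip g (\<lambda>x. c * g x + 0 * g x)"
      by (rule ip_cong) (auto simp: c u)
    also have "\<dots> = c * ip g g" using ip_lincomb_right[OF g(1) g(1) g(1), of c 0] by simp
    finally have "ip g (e (1 / \<nu> - shift)) \<noteq> 0" using c(1) g(4) ip_self_pos[OF g(1)] by fastforce
    then show "\<exists>lam\<in>eigenvalues. ip g (e lam) \<noteq> 0" using mem by blast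
  qed (use ec dc d_orth x in auto)
  then have d0: "d x = 0" if "x \<in> {0..pi}" for x using T_inj[OF dc] that by blast
  have "p differentiable (at (pi / 2))"
    unfolding p_def
  proof (intro differentiable_sum ballI differentiable_mult differentiable_const fin)
    fix lam assume "lam \<in> eigenvalues"
    then obtain v where "hill_solution_on UNIV (\<lambda>x. V x - (lam + shift)) (e lam) v"
      using eigenfunctionE[OF e(1)] by metis
    then show "e lam differentiable (at (pi / 2))"
      using hill_solution_onD(1) real_differentiable_def by blast
  qed
  then obtain D where D: "(p has_real_derivative D) (at (pi / 2))" by (auto simp: real_differentiable_def)
  have "(f has_real_derivative D) (at (pi / 2))"
    by (rule has_field_derivative_transform_within_open[OF D, of "{0<..<pi}"])
      (use d0 in \<open>auto simp: d_def\<close>)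
  \<comment> \<open>For both s = 0 and s = 1, subtracting s times (x - pi / 2) from |x - pi / 2|
    leaves a minimum at pi / 2, so the supposed derivative D would equal 0 and 1.\<close>
  then have "((\<lambda>x. f x - s * (x - pi / 2)) has_real_derivative D - s) (at (pi / 2))" for s
    by (auto intro!: derivative_eq_intros)
  then have "D - s = 0" if "s = 0 \<or> s = 1" for s
    by (rule DERIV_local_min[where d = 1]) (use that in \<open>auto simp: f_def\<close>)
  from this[of 0] this[of 1] show False by simp
qed

text \<open>Here g is T applied to f, so the expansion on the range of T applies. An eigenvector of
  T extends to an eigenfunction; its eigenvalue is some lam n because lam exhausts the spectrum, and
  by simplicity it is a multiple of e n, hence not orthogonal to it.\<close>

theorem eigenfunction_expansion_C2:
  fixes e :: "nat \<Rightarrow> real \<Rightarrow> real" and lam :: "nat \<Rightarrow> real"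
  assumes e: "\<And>n. eigenfunction (lam n) (e n)" and N: "\<And>n. ip (e n) (e n) = N"
    and lam: "inj lam" "range lam = eigenvalues"
    and g: "sl g g' f" "cont f" and x: "x \<in> {0..pi}"
  shows "(\<lambda>n. ip g (e n) / N * e n x) sums g x"
proof -
  have ec: "cont (e n)" for n using eigenfunctionE[OF e] by blast
  have Tf: "T f y = g y" if "y \<in> {0..pi}" for y by (rule T_eqI[OF g that])
  have "(\<lambda>n. ip (T f) (e n) / N * e n x) sums T f x"
  proof (rule eigenfunction_expansion[where \<mu> = "\<lambda>n. 1 / (lam n + shift)"])
    show "T (e n) y = 1 / (lam n + shift) * e n y" if "y \<in> {0..pi}" for n y
      using eigenfunctionE[OF e] that by blast
    show "ip (e i) (e j) = (if i = j then N else 0)" for i j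
      using eigenfunction_orthogonal[OF e e] N lam(1) by (auto simp: inj_eq)
    show "N > 0" using eigenfunctionE[OF e[of 0]] N[of 0] by metis
    fix w \<nu> assume w: "cont w" "\<nu> > 0" "\<And>x. x \<in> {0..pi} \<Longrightarrow> T w x = \<nu> * w x" "\<exists>x\<in>{0..pi}. w x \<noteq> 0"
    obtain u where u: "eigenfunction (1 / \<nu> - shift) u" "\<And>x. x \<in> {0..pi} \<Longrightarrow> u x = w x"
      using eigenfunction_of_T[OF w] by blast
    then have "1 / \<nu> - shift \<in> range lam" using lam(2) by (auto simp: eigenvalues_def)
    then obtain n where n: "lam n = 1 / \<nu> - shift" by (metis imageE)
    have "eigenfunction (1 / \<nu> - shift) (e n)" using e[of n] n by simp
    then obtain c where c: "c \<noteq> 0" "\<And>x. e n x = c * u x"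
      using eigenfunction_proportional u(1) by blast
    have "ip w (e n) = ip w (\<lambda>x. c * w x + 0 * w x)"
      by (rule ip_cong) (auto simp: c u)
    also have "\<dots> = c * ip w w" using ip_lincomb_right[OF w(1) w(1) w(1), of c 0] by simp
    finally have "ip w (e n) \<noteq> 0" using c(1) w(4) ip_self_pos[OF w(1)] by fastforce
    then show "\<exists>i. ip w (e i) \<noteq> 0" by blast
  qed (use ec g x in auto)
  moreover have "ip (T f) (e n) = ip g (e n)" for n by (rule ip_cong) (auto simp: Tf)
  ultimately show ?thesis using Tf[OF x] by simp
qed

end

section \<open>Listing a discrete set of reals in increasing order\<close>

lemma increasing_enum_exists:
  fixes S :: "real set"
  assumes inf: "infinite S" and fin: "\<And>L. finite {s \<in> S. s \<le> L}"
  shows "\<exists>f :: nat \<Rightarrow> real. strict_mono f \<and> range f = S"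
proof -
  have least: "\<exists>m\<in>A. \<forall>s\<in>A. m \<le> s" if A: "A \<subseteq> S" "A \<noteq> {}" for A
  proof -
    obtain a where a: "a \<in> A" using A by blast
    have fA: "finite {s \<in> A. s \<le> a}" by (rule finite_subset[OF _ fin[of a]]) (use A in auto)
    have "Min {s \<in> A. s \<le> a} \<in> {s \<in> A. s \<le> a}" using fA a by (intro Min_in) auto
    moreover have "Min {s \<in> A. s \<le> a} \<le> s" if "s \<in> A" for s
      using that a fA by (cases "s \<le> a") (auto intro: order_trans[of _ a])
    ultimately show ?thesis by auto
  qed
  have above: "{s \<in> S. s > x} \<noteq> {}" for x
  proof
    assume "{s \<in> S. s > x} = {}"
    then have "S \<subseteq> {s \<in> S. s \<le> x}" by (auto simp: not_less[symmetric])
    then show False using inf fin finite_subset by blast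
  qed
  have "\<exists>m. m \<in> S \<and> m > x \<and> (\<forall>s\<in>S. s > x \<longrightarrow> m \<le> s)" for x
    using least[OF _ above[of x]] by auto
  then obtain nxt where nxt: "\<And>x. nxt x \<in> S" "\<And>x. nxt x > x" "\<And>x s. s \<in> S \<Longrightarrow> s > x \<Longrightarrow> nxt x \<le> s"
    by metis
  obtain m0 where m0: "m0 \<in> S" "\<And>s. s \<in> S \<Longrightarrow> m0 \<le> s" using least[of S] inf by fastforce
  define f where "f = rec_nat m0 (\<lambda>_. nxt)"
  have f0: "f 0 = m0" and fS: "f (Suc n) = nxt (f n)" for n by (auto simp: f_def)
  have sm: "strict_mono f" by (rule strict_monoI_Suc) (simp add: fS nxt)
  have fin_S: "f n \<in> S" for n by (cases n) (auto simp: f0 fS m0 nxt)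
  \<comment> \<open>An element that is never reached would be an upper bound of all f n, and
    infinitely many elements of S would lie below it.\<close>
  have "s \<in> range f" if s: "s \<in> S" for s
  proof (rule ccontr)
    assume ns: "s \<notin> range f"
    have "f n \<le> s" for n
    proof (induction n)
      case (Suc n)
      then have "f n < s" using ns by (metis order_le_less rangeI)
      then show ?case using nxt(3)[OF s] by (simp add: fS)
    qed (simp add: f0 m0 s)
    then have "range f \<subseteq> {t \<in> S. t \<le> s}" using fin_S by auto
    moreover have "infinite (range f)" using sm by (simp add: range_inj_infinite strict_mono_imp_inj_on)
    ultimately show False using fin finite_subset by blast
  qed
  then show ?thesis using sm fin_S by blast
qed

lemma strict_mono_range_unique:
  fixes f g :: "nat \<Rightarrow> real"
  assumes "strict_mono f" "strict_mono g" "range f = range g"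
  shows "f = g"
proof
  fix n
  show "f n = g n"
  proof (induction n rule: less_induct)
    case (less n)
    have main: "g n \<le> f n" if fg: "strict_mono f" "strict_mono g" "range f = range g" "\<And>m. m < n \<Longrightarrow> f m = g m"
      for f g :: "nat \<Rightarrow> real"
    proof -
      obtain m where m: "f n = g m" using fg(3) by (metis rangeE rangeI)
      have "n \<le> m"
      proof (rule ccontr)
        assume "\<not> n \<le> m"
        then have "f n = f m" using m fg(4)[of m] by simp
        then show False using \<open>\<not> n \<le> m\<close> fg(1) by (auto simp: strict_mono_eq)
      qed
      then show ?thesis using m fg(2) by (simp add: strict_mono_less_eq)
    qed
    show ?case using main[of f g] main[of g f] assms less by fastforce
  qed
qed

text \<open>Existence and uniqueness together give the definite description in
  \<open>increasing_enum\<close> its intended meaning.\<close>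

lemma increasing_enum_props:
  assumes "infinite S" "\<And>L. finite {s \<in> S. s \<le> L}"
  shows "strict_mono (increasing_enum S)" "range (increasing_enum S) = S"
proof -
  have "\<exists>!f :: nat \<Rightarrow> real. strict_mono f \<and> range f = S"
    using increasing_enum_exists[OF assms] strict_mono_range_unique by (metis (no_types, lifting))
  from theI'[OF this] show "strict_mono (increasing_enum S)" "range (increasing_enum S) = S"
    unfolding increasing_enum_def by auto
qed

section \<open>Asymptotics of Bessel functions\<close>

text \<open>The sum of exp t \<ge> 1 + t + t^2 / 2 and exp (-t) \<ge> 1 - t, halved. It provides
  Gaussian majorants for the integrals that define K_n.\<close>

lemma cosh_ge_quadratic: "cosh t \<ge> 1 + t\<^sup>2 / 4" for t :: real
proof -
  have main: "cosh t \<ge> 1 + t\<^sup>2 / 4" if "t \<ge> 0" for t :: real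
    using exp_lower_Taylor_quadratic[OF that] exp_ge_add_one_self[of "- t"]
    by (simp add: cosh_field_def field_simps)
  show ?thesis using main[of t] main[of "- t"] by (cases "t \<ge> 0") auto
qed

text \<open>Taylor's formula gives t^2 / 2 - t^4 / 24. Since t^2 \<le> pi^2 \<le> 10, at least (1/2
  - 10/24) t^2 = t^2 / 12 remains; this is a Gaussian majorant valid on the whole period.\<close>

lemma one_minus_cos_ge:
  fixes t :: real
  assumes "\<bar>t\<bar> \<le> pi"
  shows "1 - cos t \<ge> t\<^sup>2 / 12"
proof -
  have "t\<^sup>2 \<le> pi\<^sup>2" using power_mono[OF assms, of 2] by simp
  also have "\<dots> \<le> 3.15\<^sup>2" using pi_approx by (intro power_mono) auto
  finally have t10: "t\<^sup>2 \<le> 10" by (simp add: power2_eq_square)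
  obtain s where "cos t = (\<Sum>m<4. cos_coeff m * t ^ m) + cos (s + 1 / 2 * real 4 * pi) / fact 4 * t ^ 4"
    using Maclaurin_cos_expansion[of t 4] by blast
  moreover have "(\<Sum>m<4. cos_coeff m * t ^ m) = 1 - t\<^sup>2 / 2"
  proof -
    have "(\<Sum>m<4. f m) = f 0 + f 1 + f 2 + f 3" for f :: "nat \<Rightarrow> real" by (simp add: eval_nat_numeral)
    then show ?thesis by (simp add: cos_coeff_def)
  qed
  moreover have "cos (s + 1 / 2 * real 4 * pi) / fact 4 * t ^ 4 \<le> 1 / fact 4 * t ^ 4"
    by (intro mult_right_mono divide_right_mono) auto
  moreover have "1 / fact 4 * t ^ 4 = t\<^sup>2 * t\<^sup>2 / 24"
    by (simp add: fact_numeral power2_eq_square eval_nat_numeral)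
  moreover have "t\<^sup>2 * t\<^sup>2 \<le> 10 * t\<^sup>2" using t10 by (intro mult_right_mono) auto
  ultimately show ?thesis by linarith
qed

lemma integrable_exp_quadratic:
  assumes a: "a > 0"
  shows "integrable lborel (\<lambda>t::real. exp (- a * t\<^sup>2 + b * t))"
proof -
  define \<mu> \<sigma> where "\<mu> = b / (2 * a)" and "\<sigma> = 1 / sqrt (2 * a)"
  have \<sigma>2: "\<sigma>\<^sup>2 = 1 / (2 * a)" using a by (simp add: \<sigma>_def power_divide)
  have eq: "exp (- a * t\<^sup>2 + b * t) = exp (a * \<mu>\<^sup>2) * sqrt (2 * pi * \<sigma>\<^sup>2) * normal_density \<mu> \<sigma> t" for t
  proof -
    have "- (t - \<mu>)\<^sup>2 / (2 * \<sigma>\<^sup>2) = - a * (t - \<mu>)\<^sup>2" using a by (simp add: \<sigma>2)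
    also have "\<dots> = - a * t\<^sup>2 + b * t - a * \<mu>\<^sup>2"
      using a by (simp add: \<mu>_def power2_eq_square field_simps)
    finally have "exp (- (t - \<mu>)\<^sup>2 / (2 * \<sigma>\<^sup>2)) = exp (- a * t\<^sup>2 + b * t) / exp (a * \<mu>\<^sup>2)"
      by (simp add: exp_diff)
    moreover have "\<sigma> \<noteq> 0" using a by (simp add: \<sigma>_def)
    ultimately show ?thesis unfolding normal_density_def by simp
  qed
  show ?thesis unfolding eq using a by (intro integrable_mult_right integrable_normal_density) (simp add: \<sigma>_def)
qed

lemma integral_exp_half_square: "(\<integral>s. exp (- (s\<^sup>2 / 2)) \<partial>lborel) = sqrt (2 * pi)"
proof -
  have "exp (- (s\<^sup>2 / 2)) = sqrt (2 * pi) * std_normal_density s" for s :: real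
    by (simp add: normal_density_def)
  then have "(\<integral>s. exp (- (s\<^sup>2 / 2)) \<partial>lborel) = (\<integral>s. sqrt (2 * pi) * std_normal_density s \<partial>lborel)"
    by presburger
  then show ?thesis by simp
qed

lemma integral_half_line_exp_half_square:
  "(\<integral>s. indicator {0..} s * exp (- (s\<^sup>2 / 2)) \<partial>lborel) = sqrt (pi / 2)"
proof -
  have "has_bochner_integral lborel
      (\<lambda>s. indicator {0..} (0 + (1 / sqrt 2) * s) *\<^sub>R exp (- (0 + (1 / sqrt 2) * s)\<^sup>2))
      ((sqrt pi / 2) /\<^sub>R \<bar>1 / sqrt 2\<bar>)"
    using lborel_has_bochner_integral_real_affine_iff[THEN iffD1, OF _ gaussian_moment_0, of "1 / sqrt 2" 0]
    by simp
  moreover have "indicator {0..} (0 + (1 / sqrt 2) * s) *\<^sub>R exp (- (0 + (1 / sqrt 2) * s)\<^sup>2)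
     = indicator {0..} s * exp (- (s\<^sup>2 / 2))" for s :: real
    by (simp add: indicator_def power_divide zero_le_divide_iff)
  moreover have "(sqrt pi / 2) /\<^sub>R \<bar>1 / sqrt 2\<bar> = sqrt (pi / 2)"
    by (simp add: real_sqrt_divide field_simps)
  ultimately show ?thesis by (simp add: has_bochner_integral_iff)
qed

text \<open>After the substitution t = s / sqrt (Z x) the exponent -Z (1 - cos t) tends to -s^2 / 2
  and is dominated by -s^2 / 12. The factor g may vary with x, since the plane wave in elliptic
  coordinates has the exponent Z cos t only up to a vanishing correction.\<close>

lemma laplace_method_cos:
  fixes Z :: "real \<Rightarrow> real" and g :: "real \<Rightarrow> real \<Rightarrow> real"
  assumes Z: "filterlim Z at_top at_top"
    and g: "\<And>x. continuous_on UNIV (g x)"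
    and bd: "\<forall>\<^sub>F x in at_top. \<forall>t. \<bar>g x t\<bar> \<le> M"
    and lim: "\<And>s. ((\<lambda>x. g x (s / sqrt (Z x))) \<longlongrightarrow> L) at_top"
  shows "((\<lambda>x. sqrt (Z x) * exp (- Z x) * integral {-pi..pi} (\<lambda>t. exp (Z x * cos t) * g x t))
    \<longlongrightarrow> sqrt (2 * pi) * L) at_top"
proof -
  define F where "F x s = indicator {-pi..pi} (s / sqrt (Z x)) *
    (exp (- (Z x * (1 - cos (s / sqrt (Z x))))) * g x (s / sqrt (Z x)))" for x s
  have [measurable]: "g x \<in> borel_measurable borel" for x
    using g by (intro borel_measurable_continuous_onI)
  have Zpos: "\<forall>\<^sub>F x in at_top. Z x > 0" using Z by (auto simp: filterlim_at_top_dense)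
  have "((\<lambda>x. \<integral>s. F x s \<partial>lborel) \<longlongrightarrow> (\<integral>s. exp (- (s\<^sup>2 / 2)) * L \<partial>lborel)) at_top"
  proof (rule integral_dominated_convergence_at_top[where w = "\<lambda>s. exp (- (1 / 12) * s\<^sup>2 + 0 * s) * \<bar>M\<bar>"])
    show "F x \<in> borel_measurable lborel" for x unfolding F_def by measurable
    show "integrable lborel (\<lambda>s::real. exp (- (1 / 12) * s\<^sup>2 + 0 * s) * \<bar>M\<bar>)"
      by (intro integrable_mult_left integrable_exp_quadratic) simp
    show "AE s in lborel. ((\<lambda>x. F x s) \<longlongrightarrow> exp (- (s\<^sup>2 / 2)) * L) at_top"
    proof (rule AE_I2)
      fix s :: real
      have "((\<lambda>z. s / sqrt z) \<longlongrightarrow> 0) at_top" by real_asymp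
      then have "\<forall>\<^sub>F z in at_top. s / sqrt z \<in> {-pi<..<pi}"
        using pi_gt_zero by (intro topological_tendstoD) auto
      then have "\<forall>\<^sub>F x in at_top. s / sqrt (Z x) \<in> {-pi<..<pi}"
        using Z by (rule eventually_compose_filterlim)
      then have "\<forall>\<^sub>F x in at_top. (1::real) = indicator {-pi..pi} (s / sqrt (Z x))"
        by eventually_elim auto
      then have 1: "((\<lambda>x. indicator {-pi..pi} (s / sqrt (Z x))) \<longlongrightarrow> (1::real)) at_top"
        by (intro Lim_transform_eventually[OF tendsto_const])
      have "((\<lambda>z. z * (1 - cos (s / sqrt z))) \<longlongrightarrow> s * s / 2) at_top" by real_asymp
      then have "((\<lambda>x. Z x * (1 - cos (s / sqrt (Z x)))) \<longlongrightarrow> s * s / 2) at_top"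
        using Z by (rule filterlim_compose)
      from tendsto_mult[OF 1 tendsto_mult[OF tendsto_exp[OF tendsto_minus[OF this]] lim[of s]]]
      show "((\<lambda>x. F x s) \<longlongrightarrow> exp (- (s\<^sup>2 / 2)) * L) at_top"
        by (simp add: F_def power2_eq_square)
    qed
    show "\<forall>\<^sub>F x in at_top. AE s in lborel. norm (F x s) \<le> exp (- (1 / 12) * s\<^sup>2 + 0 * s) * \<bar>M\<bar>"
      using Zpos bd
    proof eventually_elim
      case (elim x)
      have "norm (F x s) \<le> exp (- (1 / 12) * s\<^sup>2 + 0 * s) * \<bar>M\<bar>" for s
      proof (cases "s / sqrt (Z x) \<in> {-pi..pi}")
        case True
        have "Z x * ((s / sqrt (Z x))\<^sup>2 / 12) \<le> Z x * (1 - cos (s / sqrt (Z x)))"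
          using True elim(1) by (intro mult_left_mono one_minus_cos_ge) (auto simp: abs_le_iff)
        moreover have "Z x * ((s / sqrt (Z x))\<^sup>2 / 12) = s\<^sup>2 / 12"
          using elim(1) by (simp add: power_divide)
        ultimately have "exp (- (Z x * (1 - cos (s / sqrt (Z x))))) \<le> exp (- (1 / 12) * s\<^sup>2 + 0 * s)"
          by simp
        moreover have "\<bar>g x (s / sqrt (Z x))\<bar> \<le> \<bar>M\<bar>"
          using elim(2) by (meson abs_ge_self order_trans)
        ultimately have "exp (- (Z x * (1 - cos (s / sqrt (Z x))))) * \<bar>g x (s / sqrt (Z x))\<bar>
          \<le> exp (- (1 / 12) * s\<^sup>2 + 0 * s) * \<bar>M\<bar>" by (intro mult_mono) auto
        then show ?thesis using True by (simp add: F_def abs_mult)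
      qed (simp add: F_def)
      then show ?case by simp
    qed
  qed simp
  moreover have "\<forall>\<^sub>F x in at_top. (\<integral>s. F x s \<partial>lborel) =
      sqrt (Z x) * exp (- Z x) * integral {-pi..pi} (\<lambda>t. exp (Z x * cos t) * g x t)"
    using Zpos
  proof eventually_elim
    case (elim x)
    define G where "G t = exp (Z x * cos t) * g x t" for t
    have "continuous_on {-pi..pi} G"
      unfolding G_def by (intro continuous_intros continuous_on_subset[OF g]) auto
    then have "integral {-pi..pi} G = (\<integral>t. indicator {-pi..pi} t *\<^sub>R G t \<partial>lborel)"
      using set_borel_integral_eq_integral(2)[OF borel_integrable_atLeastAtMost', of "-pi" pi G]
      by (simp add: set_lebesgue_integral_def)
    also have "\<dots> = \<bar>1 / sqrt (Z x)\<bar> *\<^sub>R (\<integral>s. indicator {-pi..pi} (0 + (1 / sqrt (Z x)) * s) *\<^sub>R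
       G (0 + (1 / sqrt (Z x)) * s) \<partial>lborel)"
      using elim by (intro lborel_integral_real_affine) auto
    finally have "sqrt (Z x) * exp (- Z x) * integral {-pi..pi} G
      = (\<integral>s. exp (- Z x) * (indicator {-pi..pi} (s / sqrt (Z x)) * G (s / sqrt (Z x))) \<partial>lborel)"
      using elim by simp
    also have "(\<lambda>s. exp (- Z x) * (indicator {-pi..pi} (s / sqrt (Z x)) * G (s / sqrt (Z x)))) = F x"
    proof
      fix s
      have "exp (- Z x) * exp (Z x * cos (s / sqrt (Z x))) = exp (- (Z x * (1 - cos (s / sqrt (Z x)))))"
        by (simp add: exp_add[symmetric] algebra_simps)
      then show "exp (- Z x) * (indicator {-pi..pi} (s / sqrt (Z x)) * G (s / sqrt (Z x))) = F x s"
        by (simp add: F_def G_def mult_ac indicator_def)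
    qed
    finally show ?case by (simp add: G_def)
  qed
  ultimately have "((\<lambda>x. sqrt (Z x) * exp (- Z x) * integral {-pi..pi} (\<lambda>t. exp (Z x * cos t) * g x t))
    \<longlongrightarrow> (\<integral>s. exp (- (s\<^sup>2 / 2)) * L \<partial>lborel)) at_top"
    by (rule Lim_transform_eventually)
  then show ?thesis by (simp add: integral_exp_half_square)
qed

text \<open>The Gaussian with exponent -z t^2 / 4 + N t dominates. Weights of exponential growth
  cover both \<open>cosh (real n * t)\<close> and the powers of cosh.\<close>

lemma set_integrable_exp_cosh:
  fixes w :: "real \<Rightarrow> real"
  assumes z: "z > 0" and w: "continuous_on UNIV w" "\<And>t. t \<ge> 0 \<Longrightarrow> \<bar>w t\<bar> \<le> exp (N * t)"
  shows "set_integrable lborel {0..} (\<lambda>t. exp (- z * cosh t) * w t)"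
  unfolding set_integrable_def
proof (rule Bochner_Integration.integrable_bound)
  have [measurable]: "w \<in> borel_measurable borel" by (intro borel_measurable_continuous_onI w)
  have [measurable]: "(cosh :: real \<Rightarrow> real) \<in> borel_measurable borel"
    by (intro borel_measurable_continuous_onI continuous_intros)
  show "integrable lborel (\<lambda>t. exp (- (z / 4) * t\<^sup>2 + N * t))"
    using z by (intro integrable_exp_quadratic) auto
  show "(\<lambda>t. indicator {0..} t *\<^sub>R (exp (- z * cosh t) * w t)) \<in> borel_measurable lborel" by measurable
  show "AE t in lborel. norm (indicator {0..} t *\<^sub>R (exp (- z * cosh t) * w t)) \<le> norm (exp (- (z / 4) * t\<^sup>2 + N * t))"
  proof (rule AE_I2)
    fix t :: real
    show "norm (indicator {0..} t *\<^sub>R (exp (- z * cosh t) * w t)) \<le> norm (exp (- (z / 4) * t\<^sup>2 + N * t))"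
    proof (cases "t \<ge> 0")
      case True
      have "z * (t\<^sup>2 / 4) \<le> z * cosh t" using z cosh_ge_quadratic[of t] by (intro mult_left_mono) auto
      then have "exp (- z * cosh t) \<le> exp (- (z / 4) * t\<^sup>2)" by simp
      then have "exp (- z * cosh t) * \<bar>w t\<bar> \<le> exp (- (z / 4) * t\<^sup>2) * exp (N * t)"
        using w(2)[OF True] by (intro mult_mono) auto
      then have "exp (- z * cosh t) * \<bar>w t\<bar> \<le> exp (- (z / 4) * t\<^sup>2 + N * t)" by (simp only: exp_add)
      then show ?thesis using True by (simp add: abs_mult)
    qed simp
  qed
qed

lemma cosh_mult_le_exp: "t \<ge> 0 \<Longrightarrow> \<bar>cosh (real n * t)\<bar> \<le> exp (real n * t)"
  by (simp add: cosh_field_def)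

text \<open>Laplace's method on a half line with t = s / sqrt z. The order enters through the factor
  cosh (n s / sqrt z), which tends to 1 and for z \<ge> 1 is at most exp (n s), so one majorant
  serves all large z.\<close>

lemma bessel_K_asymptotic:
  "((\<lambda>z. sqrt z * exp z * bessel_K n z) \<longlongrightarrow> sqrt (pi / 2)) at_top"
proof -
  have [measurable]: "(cosh :: real \<Rightarrow> real) \<in> borel_measurable borel"
    by (intro borel_measurable_continuous_onI continuous_intros)
  define F where "F z s = indicator {0..} s * (exp (- (z * (cosh (s / sqrt z) - 1))) * cosh (real n * (s / sqrt z)))"
    for z s :: real
  have "((\<lambda>z. \<integral>s. F z s \<partial>lborel) \<longlongrightarrow> (\<integral>s. indicator {0..} s * exp (- (s\<^sup>2 / 2)) \<partial>lborel)) at_top"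
  proof (rule integral_dominated_convergence_at_top[where w = "\<lambda>s. exp (- (1 / 4) * s\<^sup>2 + real n * s)"])
    show "F z \<in> borel_measurable lborel" for z unfolding F_def by measurable
    show "integrable lborel (\<lambda>s::real. exp (- (1 / 4) * s\<^sup>2 + real n * s))"
      by (intro integrable_exp_quadratic) simp
    show "AE s in lborel. ((\<lambda>z. F z s) \<longlongrightarrow> indicator {0..} s * exp (- (s\<^sup>2 / 2))) at_top"
    proof (rule AE_I2)
      fix s :: real
      have 1: "((\<lambda>z. z * (cosh (s / sqrt z) - 1)) \<longlongrightarrow> s * s / 2) at_top" by real_asymp
      have "((\<lambda>z. s / sqrt z) \<longlongrightarrow> 0) at_top" by real_asymp
      then have "((\<lambda>z. cosh (real n * (s / sqrt z))) \<longlongrightarrow> cosh (real n * 0)) at_top"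
        by (intro tendsto_cosh tendsto_mult tendsto_const)
      from tendsto_mult[OF tendsto_const[of "indicator {0..} s"] tendsto_mult[OF tendsto_exp[OF tendsto_minus[OF 1]] this]]
      show "((\<lambda>z. F z s) \<longlongrightarrow> indicator {0..} s * exp (- (s\<^sup>2 / 2))) at_top"
        by (simp add: F_def power2_eq_square)
    qed
    show "\<forall>\<^sub>F z in at_top. AE s in lborel. norm (F z s) \<le> exp (- (1 / 4) * s\<^sup>2 + real n * s)"
      using eventually_ge_at_top[of 1]
    proof eventually_elim
      case (elim z)
      have "norm (F z s) \<le> exp (- (1 / 4) * s\<^sup>2 + real n * s)" for s
      proof (cases "s \<ge> 0")
        case True
        have "z * ((s / sqrt z)\<^sup>2 / 4) \<le> z * (cosh (s / sqrt z) - 1)"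
          using elim cosh_ge_quadratic[of "s / sqrt z"] by (intro mult_left_mono) auto
        moreover have "z * ((s / sqrt z)\<^sup>2 / 4) = s\<^sup>2 / 4" using elim by (simp add: power_divide)
        ultimately have "exp (- (z * (cosh (s / sqrt z) - 1))) \<le> exp (- (1 / 4) * s\<^sup>2)" by simp
        moreover have "cosh (real n * (s / sqrt z)) \<le> exp (real n * s)"
        proof -
          have "s / sqrt z \<le> s / 1" using True elim by (intro divide_left_mono) auto
          then have "real n * (s / sqrt z) \<le> real n * s" by (intro mult_left_mono) auto
          moreover have "cosh (real n * (s / sqrt z)) \<le> exp (real n * (s / sqrt z))"
            using cosh_mult_le_exp[of "s / sqrt z" n] True elim by auto
          ultimately show ?thesis by (meson exp_le_cancel_iff order_trans)
        qed
        ultimately have "exp (- (z * (cosh (s / sqrt z) - 1))) * cosh (real n * (s / sqrt z))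
            \<le> exp (- (1 / 4) * s\<^sup>2) * exp (real n * s)"
          by (intro mult_mono) auto
        then have "exp (- (z * (cosh (s / sqrt z) - 1))) * cosh (real n * (s / sqrt z))
            \<le> exp (- (1 / 4) * s\<^sup>2 + real n * s)"
          by (simp only: exp_add)
        then show ?thesis using True by (simp add: F_def abs_mult)
      qed (simp add: F_def)
      then show ?case by simp
    qed
  qed simp
  moreover have "\<forall>\<^sub>F z in at_top. (\<integral>s. F z s \<partial>lborel) = sqrt z * exp z * bessel_K n z"
    using eventually_gt_at_top[of 0]
  proof eventually_elim
    case (elim z)
    define G where "G t = exp (- z * cosh t) * cosh (real n * t)" for t
    have "set_integrable lborel {0..} G"
      unfolding G_def
      using elim by (intro set_integrable_exp_cosh[where N = "real n"] continuous_intros cosh_mult_le_exp)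
    then have "bessel_K n z = (\<integral>t. indicator {0..} t *\<^sub>R G t \<partial>lborel)"
      using set_borel_integral_eq_integral(2)[of "{0..}" G]
      by (simp add: set_lebesgue_integral_def bessel_K_def G_def[abs_def])
    also have "\<dots> = \<bar>1 / sqrt z\<bar> *\<^sub>R (\<integral>s. indicator {0..} (0 + (1 / sqrt z) * s) *\<^sub>R
       G (0 + (1 / sqrt z) * s) \<partial>lborel)"
      using elim by (intro lborel_integral_real_affine) auto
    finally have "sqrt z * exp z * bessel_K n z
      = (\<integral>s. exp z * (indicator {0..} (s / sqrt z) * G (s / sqrt z)) \<partial>lborel)"
      using elim by simp
    also have "(\<lambda>s. exp z * (indicator {0..} (s / sqrt z) * G (s / sqrt z))) = F z"
    proof
      fix s
      have "exp z * exp (- z * cosh (s / sqrt z)) = exp (- (z * (cosh (s / sqrt z) - 1)))"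
        by (simp add: exp_add[symmetric] algebra_simps)
      then show "exp z * (indicator {0..} (s / sqrt z) * G (s / sqrt z)) = F z s"
        using elim by (simp add: F_def G_def mult_ac indicator_def zero_le_divide_iff)
    qed
    finally show ?case by simp
  qed
  ultimately show ?thesis
    unfolding integral_half_line_exp_half_square by (rule Lim_transform_eventually)
qed

section \<open>Bessel's integral for I_n\<close>

lemma integral_cis:
  fixes m :: int
  shows "integral {-pi..pi} (\<lambda>t. cis (of_int m * t)) = (if m = 0 then of_real (2 * pi) else 0)"
proof (cases "m = 0")
  case True
  then show ?thesis by (simp add: scaleR_conv_of_real)
next
  case False
  have "((\<lambda>t. cis (of_int m * t)) has_integral
      cis (of_int m * pi) / (\<i> * of_int m) - cis (of_int m * - pi) / (\<i> * of_int m)) {-pi..pi}"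
  proof (rule fundamental_theorem_of_calculus)
    fix t :: real
    have "((\<lambda>z. exp (\<i> * of_int m * z) / (\<i> * of_int m)) has_field_derivative exp (\<i> * of_int m * of_real t))
        (at (of_real t))"
      using False by (auto intro!: derivative_eq_intros)
    then have "((\<lambda>t. exp (\<i> * of_int m * of_real t) / (\<i> * of_int m)) has_vector_derivative
        exp (\<i> * of_int m * of_real t)) (at t within {-pi..pi})"
      by (rule has_vector_derivative_real_field)
    then show "((\<lambda>t. cis (of_int m * t) / (\<i> * of_int m)) has_vector_derivative cis (of_int m * t))
        (at t within {-pi..pi})"
      by (simp add: cis_conv_exp mult_ac)
  qed auto
  moreover have "cis (of_int m * pi) = cis (of_int m * - pi)"
  proof -
    have "cis (of_int m * pi) = cis (of_int m * - pi) * cis (2 * pi * of_int m)"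
      unfolding cis_mult by (simp add: algebra_simps)
    then show ?thesis by (simp add: cis_multiple_2pi)
  qed
  ultimately show ?thesis using False by (simp add: integral_unique)
qed

lemma integral_mult_exp_series:
  fixes g w :: "real \<Rightarrow> complex"
  assumes g: "continuous_on {a..b} g" and w: "continuous_on {a..b} w"
  shows "(\<lambda>l. integral {a..b} (\<lambda>t. g t * w t ^ l) / fact l) sums integral {a..b} (\<lambda>t. g t * exp (w t))"
proof -
  have "bounded (g ` {a..b})" "bounded (w ` {a..b})"
    by (intro compact_imp_bounded compact_continuous_image g w compact_Icc)+
  then obtain B C where B: "\<And>t. t \<in> {a..b} \<Longrightarrow> norm (g t) \<le> B" and C: "\<And>t. t \<in> {a..b} \<Longrightarrow> norm (w t) \<le> C"
    unfolding bounded_iff by blast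
  have "uniform_limit {a..b} (\<lambda>n t. \<Sum>l<n. g t * w t ^ l / fact l)
      (\<lambda>t. \<Sum>l. g t * w t ^ l / fact l) sequentially"
  proof (rule Weierstrass_m_test)
    show "norm (g t * w t ^ l / fact l) \<le> B * (C ^ l / fact l)" if "t \<in> {a..b}" for l t
    proof -
      have "norm (g t) * norm (w t) ^ l \<le> B * C ^ l"
        using B[OF that] C[OF that] by (intro mult_mono power_mono) (auto intro: order_trans[OF norm_ge_zero])
      then show ?thesis by (simp add: norm_mult norm_divide norm_power divide_right_mono)
    qed
    show "summable (\<lambda>l. B * (C ^ l / fact l))"
      using summable_exp[of C] by (intro summable_mult) (simp add: field_simps)
  qed
  moreover have "(\<Sum>l. g t * w t ^ l / fact l) = g t * exp (w t)" for t
    using sums_mult[OF exp_converges[of "w t"], of "g t"] by (simp add: sums_iff scaleR_conv_of_real field_simps)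
  ultimately have ul: "uniform_limit {a..b} (\<lambda>n t. \<Sum>l<n. g t * w t ^ l / fact l) (\<lambda>t. g t * exp (w t)) sequentially"
    by simp
  have int: "(\<lambda>t. g t * w t ^ l / fact l) integrable_on {a..b}" for l
    by (intro integrable_continuous_interval continuous_intros g w) auto
  obtain I J where I: "\<And>n. ((\<lambda>t. \<Sum>l<n. g t * w t ^ l / fact l) has_integral I n) {a..b}"
    and J: "((\<lambda>t. g t * exp (w t)) has_integral J) {a..b}" and lim: "I \<longlonglongrightarrow> J"
  proof (rule uniform_limit_integral[OF ul])
    show "continuous_on {a..b} (\<lambda>t. \<Sum>l<n. g t * w t ^ l / fact l)" for n
      by (intro continuous_intros g w) auto
  qed (auto intro: that)
  have "I n = (\<Sum>l<n. integral {a..b} (\<lambda>t. g t * w t ^ l) / fact l)" for n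
  proof -
    have "I n = integral {a..b} (\<lambda>t. \<Sum>l<n. g t * w t ^ l / fact l)" using integral_unique[OF I[of n]] by simp
    also have "\<dots> = (\<Sum>l<n. integral {a..b} (\<lambda>t. g t * w t ^ l / fact l))"
      by (rule integral_sum) (use int in blast)+
    finally show ?thesis by simp
  qed
  then have "I = (\<lambda>n. \<Sum>l<n. integral {a..b} (\<lambda>t. g t * w t ^ l) / fact l)" by (rule ext)
  then show ?thesis using lim unfolding sums_def integral_unique[OF J] by (simp only:)
qed

definition bessel_I_real :: "nat \<Rightarrow> real \<Rightarrow> real" where
  "bessel_I_real n z = integral {-pi..pi} (\<lambda>t. exp (z * cos t) * cos (real n * t)) / (2 * pi)"

text \<open>Expand \<open>e\<^sup>z \<^sup>c\<^sup>o\<^sup>s \<^sup>t\<close> as a product of two exponential series in \<open>e\<^sup>i\<^sup>t\<close> and \<open>e\<^sup>-\<^sup>i\<^sup>t\<close>.\<close>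

lemma bessel_I_eq_integral: "bessel_I n (complex_of_real z) = complex_of_real (bessel_I_real n z)"
proof -
  define a :: complex where "a = of_real (z / 2)"
  \<comment> \<open>Integrating against cis (-k t) extracts from the first exponential series the
    coefficient of cis (k t).\<close>
  have J: "integral {-pi..pi} (\<lambda>t. cis (- (real k * t)) * exp (a * cis t)) = of_real (2 * pi) * a ^ k / fact k" for k
  proof -
    have "integral {-pi..pi} (\<lambda>t. cis (- (real k * t)) * (a * cis t) ^ j) / fact j
        = (if j = k then of_real (2 * pi) * a ^ k / fact k else 0)" for j
    proof -
      have "cis (- (real k * t)) * (a * cis t) ^ j = a ^ j * cis (of_int (int j - int k) * t)" for t
        by (simp add: power_mult_distrib Complex.DeMoivre cis_mult mult.left_commute[of _ "a ^ j"] algebra_simps)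
      then have "integral {-pi..pi} (\<lambda>t. cis (- (real k * t)) * (a * cis t) ^ j)
          = a ^ j * integral {-pi..pi} (\<lambda>t. cis (of_int (int j - int k) * t))"
        by (simp only: integral_mult_right)
      then show ?thesis by (simp add: integral_cis del: of_int_diff)
    qed
    moreover have "(\<lambda>j. integral {-pi..pi} (\<lambda>t. cis (- (real k * t)) * (a * cis t) ^ j) / fact j) sums
        integral {-pi..pi} (\<lambda>t. cis (- (real k * t)) * exp (a * cis t))"
      by (intro integral_mult_exp_series continuous_intros)
    ultimately have "(\<lambda>j. if j = k then of_real (2 * pi) * a ^ k / fact k else 0) sums
        integral {-pi..pi} (\<lambda>t. cis (- (real k * t)) * exp (a * cis t))" by simp
    then show ?thesis
      using sums_unique2 sums_single[of k "\<lambda>_. of_real (2 * pi) * a ^ k / fact k"] by blast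
  qed
  \<comment> \<open>This is exp (z cos t) times cis (-n t). Expanding the second exponential moves
    the frequency in its l-th term to n + l, where J applies with k = n + l.\<close>
  define f where "f t = cis (- (real n * t)) * exp (a * cis t) * exp (a * cis (- t))" for t
  have "(\<lambda>l. integral {-pi..pi} (\<lambda>t. (cis (- (real n * t)) * exp (a * cis t)) * (a * cis (- t)) ^ l) / fact l) sums
      integral {-pi..pi} f"
    unfolding f_def by (intro integral_mult_exp_series continuous_intros)
  moreover have "integral {-pi..pi} (\<lambda>t. (cis (- (real n * t)) * exp (a * cis t)) * (a * cis (- t)) ^ l) / fact l
      = of_real (2 * pi) * (a ^ n * ((a\<^sup>2) ^ l / (fact l * fact (n + l))))" for l
  proof -
    have "(cis (- (real n * t)) * exp (a * cis t)) * (a * cis (- t)) ^ l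
        = a ^ l * (cis (- (real (n + l) * t)) * exp (a * cis t))" for t
    proof -
      have "cis (- (real n * t)) * cis (- t) ^ l = cis (- (real (n + l) * t))"
        by (simp add: Complex.DeMoivre cis_mult algebra_simps)
      then show ?thesis by (simp add: power_mult_distrib mult_ac)
    qed
    then have "integral {-pi..pi} (\<lambda>t. (cis (- (real n * t)) * exp (a * cis t)) * (a * cis (- t)) ^ l)
       = a ^ l * (of_real (2 * pi) * a ^ (n + l) / fact (n + l))"
      using J[of "n + l"] by (simp only: integral_mult_right)
    then have "integral {-pi..pi} (\<lambda>t. (cis (- (real n * t)) * exp (a * cis t)) * (a * cis (- t)) ^ l) / fact l
      = of_real (2 * pi) * ((a ^ l * a ^ (n + l)) / (fact l * fact (n + l)))"
      by (simp add: mult_ac)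
    moreover have "a ^ l * a ^ (n + l) = a ^ n * (a\<^sup>2) ^ l"
      by (simp add: power_add power2_eq_square power_mult_distrib)
    ultimately show ?thesis by simp
  qed
  ultimately have S: "(\<lambda>l. of_real (2 * pi) * (a ^ n * ((a\<^sup>2) ^ l / (fact l * fact (n + l))))) sums integral {-pi..pi} f"
    by simp
  have I: "bessel_I n (complex_of_real z) = a ^ n * (\<Sum>l. (a\<^sup>2) ^ l / (fact l * fact (n + l)))"
  proof -
    have "Gamma (of_nat n + of_nat l + 1 :: complex) = fact (n + l)" for l
      using Gamma_fact[of "n + l"] by (simp add: add_ac)
    moreover have "- ((\<i> * complex_of_real z)\<^sup>2) / 4 = a\<^sup>2" by (simp add: a_def power_mult_distrib power_divide)
    moreover have "\<i> powi (- int n) * (\<i> * complex_of_real z / 2) ^ n = a ^ n"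
    proof -
      have "(\<i> * complex_of_real z / 2) ^ n = \<i> ^ n * a ^ n"
        by (simp add: a_def power_mult_distrib[symmetric])
      then show ?thesis by (simp add: power_int_minus)
    qed
    ultimately show ?thesis unfolding bessel_I_def bessel_J_def by (simp add: mult.assoc[symmetric])
  qed
  have fa: "f t = complex_of_real (exp (z * cos t)) * cis (- (real n * t))" for t
  proof -
    have "a * cis t + a * cis (- t) = complex_of_real (z * cos t)"
      by (simp add: a_def complex_eq_iff)
    then have "exp (a * cis t) * exp (a * cis (- t)) = complex_of_real (exp (z * cos t))"
      by (simp add: exp_add[symmetric] exp_of_real[symmetric])
    then show ?thesis by (simp add: f_def mult_ac)
  qed
  have fc: "continuous_on {-pi..pi} f" unfolding f_def by (intro continuous_intros)
  have "((\<lambda>t. Re (f t)) has_integral Re (integral {-pi..pi} f)) {-pi..pi}"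
    by (intro has_integral_Re integrable_integral integrable_continuous_interval fc)
  then have Re: "Re (integral {-pi..pi} f) = 2 * pi * bessel_I_real n z"
    by (simp add: fa bessel_I_real_def integral_unique)
  have summ: "summable (\<lambda>l. (a\<^sup>2) ^ l / (fact l * fact (n + l)))"
  proof (rule summable_comparison_test'[where N = 0])
    show "summable (\<lambda>l. (norm (a\<^sup>2)) ^ l / fact l)"
      using summable_exp[of "norm (a\<^sup>2)"] by (simp add: field_simps)
    show "norm ((a\<^sup>2) ^ l / (fact l * fact (n + l))) \<le> (norm (a\<^sup>2)) ^ l / fact l" for l
      unfolding norm_divide norm_power norm_mult norm_fact
      using fact_ge_1[of "n + l", where 'a = real] by (intro divide_left_mono) auto
  qed
  then have "(\<lambda>l. of_real (2 * pi) * (a ^ n * ((a\<^sup>2) ^ l / (fact l * fact (n + l))))) sums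
      (of_real (2 * pi) * (a ^ n * (\<Sum>l. (a\<^sup>2) ^ l / (fact l * fact (n + l)))))"
    by (intro sums_mult summable_sums)
  then have val: "integral {-pi..pi} f = of_real (2 * pi) * bessel_I n (complex_of_real z)"
    using sums_unique2[OF S] I by simp
  \<comment> \<open>Only the real part of the integral has been identified with Bessel's integral.
    The power series has real terms, so I_n is real and the real part suffices.\<close>
  have "bessel_I n (complex_of_real z) \<in> \<real>"
  proof -
    have "(a\<^sup>2) ^ l / (fact l * fact (n + l)) = complex_of_real (((z/2)\<^sup>2) ^ l / (fact l * fact (n + l)))" for l
      by (simp add: a_def)
    then have "Im ((a\<^sup>2) ^ l / (fact l * fact (n + l))) = 0" for l by (simp only: Im_complex_of_real)
    then have "(\<lambda>l. 0) sums Im (\<Sum>l. (a\<^sup>2) ^ l / (fact l * fact (n + l)))"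
      using sums_Im[OF summable_sums[OF summ]] by presburger
    then have "(\<Sum>l. (a\<^sup>2) ^ l / (fact l * fact (n + l))) \<in> \<real>"
      using sums_unique2[OF _ sums_zero] by (auto simp: complex_is_Real_iff)
    then show ?thesis unfolding I by (intro Reals_mult Reals_power) (auto simp: a_def)
  qed
  then obtain x where x: "bessel_I n (complex_of_real z) = complex_of_real x" by (rule Reals_cases)
  have "2 * pi * x = 2 * pi * bessel_I_real n z" using Re by (simp add: val x)
  then show ?thesis by (simp add: x)
qed

lemma bessel_I_real_asymptotic:
  "((\<lambda>z. sqrt z * exp (- z) * bessel_I_real n z) \<longlongrightarrow> 1 / sqrt (2 * pi)) at_top"
proof -
  have "((\<lambda>z. sqrt z * exp (- z) * integral {-pi..pi} (\<lambda>t. exp (z * cos t) * cos (real n * t)))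
      \<longlongrightarrow> sqrt (2 * pi) * 1) at_top"
  proof (rule laplace_method_cos[where M = 1])
    show "filterlim (\<lambda>x::real. x) at_top at_top" by (rule filterlim_ident)
    fix s :: real
    have "((\<lambda>z. s / sqrt z) \<longlongrightarrow> 0) at_top" by real_asymp
    then have "((\<lambda>z. cos (real n * (s / sqrt z))) \<longlongrightarrow> cos (real n * 0)) at_top"
      by (intro tendsto_cos tendsto_mult tendsto_const)
    then show "((\<lambda>z. cos (real n * (s / sqrt z))) \<longlongrightarrow> 1) at_top" by simp
  qed (auto intro!: continuous_intros)
  then have "((\<lambda>z. sqrt z * exp (- z) * integral {-pi..pi} (\<lambda>t. exp (z * cos t) * cos (real n * t)) / (2 * pi))
      \<longlongrightarrow> sqrt (2 * pi) * 1 / (2 * pi)) at_top"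
    by (intro tendsto_divide tendsto_const) auto
  moreover have "sqrt (2 * pi) * 1 / (2 * pi) = 1 / sqrt (2 * pi)"
    using real_sqrt_mult_self[of "2 * pi"] by (simp add: field_simps)
  ultimately show ?thesis by (simp add: bessel_I_real_def)
qed

section \<open>The kernels in elliptic coordinates\<close>

text \<open>For z > 0 this is the p-th derivative of K_0 at z up to the sign (-1)^p.\<close>

definition cosh_moment :: "nat \<Rightarrow> real \<Rightarrow> real" where
  "cosh_moment p z = integral {0..} (\<lambda>t. exp (- z * cosh t) * cosh t ^ p)"

lemma bessel_K_0_eq: "bessel_K 0 = cosh_moment 0"
  by (simp add: bessel_K_def cosh_moment_def fun_eq_iff)

lemma set_integrable_cosh_moment:
  fixes z :: real
  assumes "z > 0"
  shows "set_integrable lborel {0..} (\<lambda>t::real. exp (- z * cosh t) * cosh t ^ p)"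
proof (rule set_integrable_exp_cosh[OF assms, where N = "real p"])
  show "continuous_on UNIV (\<lambda>t::real. cosh t ^ p)" by (intro continuous_intros)
  fix t :: real assume "t \<ge> 0"
  then have "\<bar>cosh t\<bar> ^ p \<le> exp t ^ p" by (intro power_mono) (auto simp: cosh_field_def)
  then show "\<bar>cosh t ^ p\<bar> \<le> exp (real p * t)" by (simp add: exp_of_nat_mult)
qed

lemma cosh_moment_eq_lebesgue:
  assumes "z > 0"
  shows "cosh_moment p z = (\<integral>t. indicator {0..} t *\<^sub>R (exp (- z * cosh t) * cosh t ^ p) \<partial>lborel)"
  using set_borel_integral_eq_integral(2)[OF set_integrable_cosh_moment[OF assms]]
  by (simp add: cosh_moment_def set_lebesgue_integral_def)

text \<open>A mean value estimate, uniform for exponents beyond m; it supplies the majorant for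
  differentiating under the integral.\<close>

lemma exp_diff_le:
  fixes c m x y :: real
  assumes "c \<ge> 0" "m \<le> x" "m \<le> y"
  shows "\<bar>exp (- x * c) - exp (- y * c)\<bar> \<le> c * exp (- m * c) * \<bar>x - y\<bar>"
proof -
  have main: "\<bar>exp (- x * c) - exp (- y * c)\<bar> \<le> c * exp (- m * c) * \<bar>x - y\<bar>" if "m \<le> x" "x \<le> y" for x y
  proof -
    have "exp (- x * c) - exp (- y * c) = exp (- x * c) * (1 - exp (- ((y - x) * c)))"
      by (simp add: right_diff_distrib exp_add[symmetric] algebra_simps)
    also have "\<dots> \<le> exp (- m * c) * ((y - x) * c)"
    proof (rule mult_mono)
      show "1 - exp (- ((y - x) * c)) \<le> (y - x) * c"
        using exp_ge_add_one_self[of "- ((y - x) * c)"] by linarith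
      show "exp (- x * c) \<le> exp (- m * c)" using that assms(1) by (simp add: mult_right_mono)
      show "0 \<le> 1 - exp (- ((y - x) * c))" using that assms(1) by simp
    qed auto
    finally have "exp (- x * c) - exp (- y * c) \<le> exp (- m * c) * ((y - x) * c)" .
    moreover have "exp (- y * c) \<le> exp (- x * c)" using that assms(1) by (simp add: mult_right_mono)
    ultimately show ?thesis using that by (simp add: mult_ac)
  qed
  show ?thesis using main[of x y] main[of y x] assms by (cases "x \<le> y") (auto simp: abs_minus_commute)
qed

lemma has_real_derivative_cosh_moment:
  assumes z: "z > 0"
  shows "(cosh_moment p has_real_derivative - cosh_moment (Suc p) z) (at z)"
proof -
  have [measurable]: "(cosh :: real \<Rightarrow> real) \<in> borel_measurable borel"
    by (intro borel_measurable_continuous_onI continuous_intros)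
  \<comment> \<open>Restricting to exponents above z / 2 keeps them away from 0, so that the
    difference quotients share the integrable majorant with m in place of z.\<close>
  define m where "m = z / 2"
  define S where "S = {m<..}"
  have zS: "z \<in> S" and m: "m > 0" using z by (auto simp: S_def m_def)
  define f where "f w t = indicator {0..} t *\<^sub>R (exp (- w * cosh t) * cosh t ^ p)" for w t :: real
  have fi: "integrable lborel (f w)" if "w > 0" for w
    using set_integrable_cosh_moment[OF that, of p] by (simp add: set_integrable_def f_def[abs_def])
  have M: "cosh_moment p w = (\<integral>t. f w t \<partial>lborel)" if "w > 0" for w
    unfolding f_def by (rule cosh_moment_eq_lebesgue[OF that])
  have "((\<lambda>w. (cosh_moment p w - cosh_moment p z) / (w - z)) \<longlongrightarrow> - cosh_moment (Suc p) z) (at z within S)"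
    unfolding tendsto_at_iff_sequentially
  proof (intro allI impI)
    fix X assume X: "\<forall>i. X i \<in> S - {z}" "X \<longlonglongrightarrow> z"
    define g where "g i t = (f (X i) t - f z t) / (X i - z)" for i t
    have "(\<lambda>i. \<integral>t. g i t \<partial>lborel) \<longlonglongrightarrow>
        (\<integral>t. - (indicator {0..} t *\<^sub>R (exp (- z * cosh t) * cosh t ^ Suc p)) \<partial>lborel)"
    proof (rule integral_dominated_convergence[where w = "\<lambda>t. indicator {0..} t *\<^sub>R (exp (- m * cosh t) * cosh t ^ Suc p)"])
      show "(\<lambda>t. - (indicator {0..} t *\<^sub>R (exp (- z * cosh t) * cosh t ^ Suc p))) \<in> borel_measurable lborel"
        by measurable
      show "g i \<in> borel_measurable lborel" for i unfolding g_def f_def by measurable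
      show "integrable lborel (\<lambda>t. indicator {0..} t *\<^sub>R (exp (- m * cosh t) * cosh t ^ Suc p))"
        using set_integrable_cosh_moment[OF m, of "Suc p"] by (simp only: set_integrable_def)
      show "AE t in lborel. (\<lambda>i. g i t) \<longlonglongrightarrow> - (indicator {0..} t *\<^sub>R (exp (- z * cosh t) * cosh t ^ Suc p))"
      proof (rule AE_I2)
        fix t :: real
        have "((\<lambda>w. f w t) has_real_derivative - (indicator {0..} t *\<^sub>R (exp (- z * cosh t) * cosh t ^ Suc p))) (at z within S)"
          unfolding f_def by (auto intro!: derivative_eq_intros)
        then have "((\<lambda>w. (f w t - f z t) / (w - z)) \<longlongrightarrow> - (indicator {0..} t *\<^sub>R (exp (- z * cosh t) * cosh t ^ Suc p))) (at z within S)"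
          by (simp add: has_field_derivative_iff)
        then show "(\<lambda>i. g i t) \<longlonglongrightarrow> - (indicator {0..} t *\<^sub>R (exp (- z * cosh t) * cosh t ^ Suc p))"
          using X unfolding tendsto_at_iff_sequentially g_def comp_def by blast
      qed
      show "AE t in lborel. norm (g i t) \<le> indicator {0..} t *\<^sub>R (exp (- m * cosh t) * cosh t ^ Suc p)" for i
      proof (rule AE_I2)
        fix t :: real
        have Xi: "X i \<noteq> z" "m \<le> X i" using X(1) by (auto simp: S_def less_imp_le)
        have "\<bar>exp (- X i * cosh t) - exp (- z * cosh t)\<bar> \<le> cosh t * exp (- m * cosh t) * \<bar>X i - z\<bar>"
          using Xi m by (intro exp_diff_le) (auto simp: m_def)
        then have "\<bar>exp (- X i * cosh t) - exp (- z * cosh t)\<bar> * cosh t ^ p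
            \<le> (cosh t * exp (- m * cosh t) * \<bar>X i - z\<bar>) * cosh t ^ p"
          by (intro mult_right_mono) auto
        moreover have "\<bar>f (X i) t - f z t\<bar>
            = indicator {0..} t * (\<bar>exp (- X i * cosh t) - exp (- z * cosh t)\<bar> * cosh t ^ p)"
        proof -
          have "f (X i) t - f z t = indicator {0..} t * ((exp (- X i * cosh t) - exp (- z * cosh t)) * cosh t ^ p)"
            by (simp add: f_def algebra_simps)
          then show ?thesis by (simp add: abs_mult)
        qed
        ultimately have "\<bar>f (X i) t - f z t\<bar>
            \<le> indicator {0..} t * ((cosh t * exp (- m * cosh t) * \<bar>X i - z\<bar>) * cosh t ^ p)"
          by (simp add: mult_left_mono)
        then show "norm (g i t) \<le> indicator {0..} t *\<^sub>R (exp (- m * cosh t) * cosh t ^ Suc p)"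
          using Xi(1) by (simp add: g_def abs_divide divide_le_eq mult_ac)
      qed
    qed
    moreover have "(\<integral>t. g i t \<partial>lborel) = (cosh_moment p (X i) - cosh_moment p z) / (X i - z)" for i
    proof -
      have "X i > 0" using X(1) m by (auto simp: S_def intro: less_trans)
      then show ?thesis unfolding g_def by (simp add: M z fi)
    qed
    moreover have "(\<integral>t. - (indicator {0..} t *\<^sub>R (exp (- z * cosh t) * cosh t ^ Suc p)) \<partial>lborel)
        = - cosh_moment (Suc p) z"
      by (simp only: cosh_moment_eq_lebesgue[OF z] Bochner_Integration.integral_minus)
    ultimately show "((\<lambda>w. (cosh_moment p w - cosh_moment p z) / (w - z)) \<circ> X) \<longlonglongrightarrow> - cosh_moment (Suc p) z"
      unfolding comp_def by (simp only:)
  qed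
  then have "(cosh_moment p has_real_derivative - cosh_moment (Suc p) z) (at z within S)"
    unfolding has_field_derivative_iff .
  moreover have "at z within S = at z" using zS unfolding S_def by (intro at_within_open) auto
  ultimately show ?thesis by simp
qed

text \<open>Integrating the derivative of \<open>sinh t e\<^sup>-\<^sup>z \<^sup>c\<^sup>o\<^sup>s\<^sup>h \<^sup>t\<close> gives Bessel's equation for \<open>K\<^sub>0\<close>.\<close>

lemma cosh_moment_recurrence:
  assumes z: "z > 0"
  shows "z * (cosh_moment 2 z - cosh_moment 0 z) = cosh_moment 1 z"
proof -
  define E where "E t = exp (- z * cosh t)" for t
  define g where "g t = E t * cosh t ^ 1 - z * (E t * cosh t ^ 2 - E t * cosh t ^ 0)" for t
  have i: "set_integrable lborel {0..} (\<lambda>t. E t * cosh t ^ p)" for p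
    unfolding E_def by (rule set_integrable_cosh_moment[OF z])
  have gi: "set_integrable lborel {0..} g"
    unfolding g_def by (intro set_integral_diff set_integrable_mult_right i)
  have "set_lebesgue_integral lborel {0..b} g = sinh b * E b" if "b \<ge> 0" for b
  proof -
    have "((\<lambda>t. sinh t * E t) has_real_derivative g t) (at t)" for t
      unfolding E_def g_def using cosh_square_eq[of t]
      by (auto intro!: derivative_eq_intros simp: power2_eq_square algebra_simps)
    then have "(g has_integral (sinh b * E b - sinh 0 * E 0)) {0..b}"
      using that by (intro fundamental_theorem_of_calculus)
       (auto intro: has_vector_derivative_at_within simp: has_real_derivative_iff_has_vector_derivative)
    moreover have "set_integrable lborel {0..b} g"
      by (rule set_integrable_subset[OF gi]) auto
    ultimately show ?thesis
      using set_borel_integral_eq_integral(2)[of "{0..b}" g] by (simp add: integral_unique)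
  qed
  then have "\<forall>\<^sub>F b in at_top. sinh b * E b = set_lebesgue_integral lborel {0..b} g"
    by (intro eventually_mono[OF eventually_ge_at_top[of 0]]) simp
  moreover have "((\<lambda>b. sinh b * E b) \<longlongrightarrow> 0) at_top" using z unfolding E_def by real_asymp
  ultimately have "((\<lambda>b. set_lebesgue_integral lborel {0..b} g) \<longlongrightarrow> 0) at_top"
    by (rule Lim_transform_eventually[rotated])
  moreover have "((\<lambda>b. set_lebesgue_integral lborel {0..b} g) \<longlongrightarrow> set_lebesgue_integral lborel {0..} g) at_top"
    by (rule tendsto_set_lebesgue_integral_at_top[OF _ gi]) auto
  ultimately have "set_lebesgue_integral lborel {0..} g = 0"
    using tendsto_unique[OF trivial_limit_at_top_linorder] by blast
  moreover have "set_lebesgue_integral lborel {0..} g = cosh_moment 1 z - z * (cosh_moment 2 z - cosh_moment 0 z)"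
  proof -
    let ?I = "set_lebesgue_integral lborel {0..}"
    have J: "?I (\<lambda>t. E t * cosh t ^ p) = cosh_moment p z" for p
      using set_borel_integral_eq_integral(2)[OF i[of p]] by (simp add: cosh_moment_def E_def)
    have "?I g = ?I (\<lambda>t. E t * cosh t ^ 1) - ?I (\<lambda>t. z * (E t * cosh t ^ 2 - E t * cosh t ^ 0))"
      unfolding g_def by (intro set_integral_diff(2) i set_integrable_mult_right set_integral_diff(1))
    also have "?I (\<lambda>t. z * (E t * cosh t ^ 2 - E t * cosh t ^ 0)) = z * ?I (\<lambda>t. E t * cosh t ^ 2 - E t * cosh t ^ 0)"
      by (rule set_integral_mult_right)
    also have "?I (\<lambda>t. E t * cosh t ^ 2 - E t * cosh t ^ 0) = ?I (\<lambda>t. E t * cosh t ^ 2) - ?I (\<lambda>t. E t * cosh t ^ 0)"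
      by (rule set_integral_diff(2)[OF i i])
    finally show ?thesis by (simp only: J)
  qed
  ultimately show ?thesis by simp
qed

text \<open>K_0 as a function of the squared distance s for c = 1, where k r = 2 h sqrt s. The
  squared distance is a polynomial in hyperbolic and trigonometric functions, so the root is
  differentiated only here.\<close>

definition radial :: "real \<Rightarrow> real \<Rightarrow> real" where
  "radial h s = bessel_K 0 (2 * h * sqrt s)"

definition radial1 :: "real \<Rightarrow> real \<Rightarrow> real" where
  "radial1 h s = - h * cosh_moment 1 (2 * h * sqrt s) / sqrt s"

text \<open>The second derivative as prescribed by Bessel's equation in the variable s; that it is
  the derivative of \<open>radial1\<close> is where the recurrence of the moments enters.\<close>

definition radial2 :: "real \<Rightarrow> real \<Rightarrow> real" where
  "radial2 h s = (h\<^sup>2 * radial h s - radial1 h s) / s"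

lemma has_real_derivative_radial:
  assumes h: "h > 0" and s: "s > 0"
  shows "(radial h has_real_derivative radial1 h s) (at s)"
    "(radial1 h has_real_derivative radial2 h s) (at s)"
proof -
  define z where "z = 2 * h * sqrt s"
  have z: "z > 0" using h s by (simp add: z_def)
  have dz: "((\<lambda>s. 2 * h * sqrt s) has_real_derivative h / sqrt s) (at s)"
    using s by (auto intro!: derivative_eq_intros simp: field_simps)
  have dM: "((\<lambda>s. cosh_moment p (2 * h * sqrt s)) has_real_derivative - cosh_moment (Suc p) z * (h / sqrt s)) (at s)" for p
    using DERIV_chain2[OF _ dz, of "cosh_moment p" "- cosh_moment (Suc p) z"]
      has_real_derivative_cosh_moment[OF z] by (simp add: z_def)
  show "(radial h has_real_derivative radial1 h s) (at s)"
    using dM[of 0] by (simp add: radial_def[abs_def] radial1_def bessel_K_0_eq z_def mult_ac)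
  have sq: "sqrt s * sqrt s = s" using s by simp
  have "((\<lambda>s. - h * cosh_moment 1 (2 * h * sqrt s) / sqrt s) has_real_derivative
      (- h * (- cosh_moment 2 z * (h / sqrt s)) * sqrt s - - h * cosh_moment 1 z * (inverse (sqrt s) / 2)) / (sqrt s * sqrt s)) (at s)"
  proof -
    have "((\<lambda>s. cosh_moment 1 (2 * h * sqrt s)) has_real_derivative - cosh_moment 2 z * (h / sqrt s)) (at s)"
      using dM[of 1] by (simp add: numeral_2_eq_2)
    from DERIV_divide[OF DERIV_cmult[OF this, of "- h"] DERIV_real_sqrt[OF s]] s show ?thesis
      by (simp add: z_def)
  qed
  also have "(- h * (- cosh_moment 2 z * (h / sqrt s)) * sqrt s - - h * cosh_moment 1 z * (inverse (sqrt s) / 2)) / (sqrt s * sqrt s)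
     = (h\<^sup>2 * cosh_moment 2 z + h * cosh_moment 1 z / (2 * sqrt s)) / s"
    using s unfolding sq by (simp add: power2_eq_square field_simps)
  also have "\<dots> = radial2 h s"
  proof -
    have "cosh_moment 2 z = cosh_moment 0 z + cosh_moment 1 z / z"
      using cosh_moment_recurrence[OF z] z by (simp add: field_simps)
    then have "h\<^sup>2 * cosh_moment 2 z = h\<^sup>2 * cosh_moment 0 z + h * cosh_moment 1 z / (2 * sqrt s)"
      using h by (simp add: z_def power2_eq_square distrib_left)
    then show ?thesis
      by (simp add: radial2_def radial_def radial1_def bessel_K_0_eq z_def[symmetric])
  qed
  finally show "(radial1 h has_real_derivative radial2 h s) (at s)" by (simp add: radial1_def[abs_def])
qed

lemma continuous_on_radial:
  assumes "h > 0"
  shows "continuous_on {0<..} (radial h)" "continuous_on {0<..} (radial1 h)" "continuous_on {0<..} (radial2 h)"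
proof -
  show 1: "continuous_on {0<..} (radial h)" "continuous_on {0<..} (radial1 h)"
    using has_real_derivative_radial[OF assms]
    by (auto intro!: continuous_at_imp_continuous_on DERIV_isCont)
  show "continuous_on {0<..} (radial2 h)"
    unfolding radial2_def by (intro continuous_intros 1) auto
qed

lemma radial_ode: "s > 0 \<Longrightarrow> s * radial2 h s + radial1 h s = h\<^sup>2 * radial h s"
  by (simp add: radial2_def)

section \<open>Separation of variables under the integral sign\<close>

definition separated_potential :: "real \<Rightarrow> real \<Rightarrow> real \<Rightarrow> real" where
  "separated_potential h lam x = lam + 2 * h\<^sup>2 * cosh (2 * x)"

lemma continuous_on_separated_potential: "continuous_on S (separated_potential h lam)"
  unfolding separated_potential_def by (intro continuous_intros)

text \<open>Two integrations by parts in \<open>e\<close> move the operator from \<open>k\<close> to \<open>u\<close>.\<close>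

lemma integral_kernel_modified_mathieu:
  fixes k kx kxx ke kee :: "real \<Rightarrow> real \<Rightarrow> real"
  assumes U: "open U" "convex U"
    and u: "hill_solution_on UNIV (\<lambda>e. - (lam + 2 * h\<^sup>2 * cos (2 * e))) u u'"
    and per: "u pi = u (- pi)" "u' pi = u' (- pi)"
    and k: "\<And>x e. x \<in> U \<Longrightarrow> ((\<lambda>x. k x e) has_real_derivative kx x e) (at x)"
      "\<And>x e. x \<in> U \<Longrightarrow> ((\<lambda>x. kx x e) has_real_derivative kxx x e) (at x)"
      "\<And>x e. x \<in> U \<Longrightarrow> ((\<lambda>e. k x e) has_real_derivative ke x e) (at e)"
      "\<And>x e. x \<in> U \<Longrightarrow> ((\<lambda>e. ke x e) has_real_derivative kee x e) (at e)"
    and c: "continuous_on (U \<times> UNIV) (\<lambda>(x, e). kx x e)" "continuous_on (U \<times> UNIV) (\<lambda>(x, e). kxx x e)"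
    and kper: "\<And>x. x \<in> U \<Longrightarrow> k x pi = k x (- pi)" "\<And>x. x \<in> U \<Longrightarrow> ke x pi = ke x (- pi)"
    and pde: "\<And>x e. x \<in> U \<Longrightarrow> kxx x e + kee x e = 2 * h\<^sup>2 * (cosh (2 * x) - cos (2 * e)) * k x e"
  shows "hill_solution_on U (separated_potential h lam)
      (\<lambda>x. integral {-pi..pi} (\<lambda>e. k x e * u e)) (\<lambda>x. integral {-pi..pi} (\<lambda>e. kx x e * u e))"
proof -
  note d = hill_solution_onD[OF u UNIV_I]
  have uc: "continuous_on A u" for A using d by (auto intro!: continuous_at_imp_continuous_on DERIV_isCont)
  have kc: "continuous_on {-pi..pi} (k x)" if "x \<in> U" for x
    using k(3)[OF that] by (auto intro!: continuous_at_imp_continuous_on DERIV_isCont)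
  have slice: "continuous_on {-pi..pi} (kk x)" if "continuous_on (U \<times> UNIV) (\<lambda>(x, e). kk x e)" "x \<in> U" for kk x
  proof -
    have "continuous_on {-pi..pi} (\<lambda>e. (x, e))" by (intro continuous_intros)
    from continuous_on_compose2[OF that(1) this] that(2) show ?thesis by auto
  qed
  have cu: "continuous_on (U \<times> cbox (-pi) pi) (\<lambda>(x, e). kk x e * u e)"
    if "continuous_on (U \<times> UNIV) (\<lambda>(x, e). kk x e)" for kk
  proof -
    have 1: "continuous_on (U \<times> cbox (-pi) pi) (\<lambda>p. kk (fst p) (snd p))"
      by (rule continuous_on_subset[OF that[unfolded case_prod_beta]]) auto
    have 2: "continuous_on (U \<times> cbox (-pi) pi) (\<lambda>p. u (snd p))"
      by (rule continuous_on_compose2[OF uc[of UNIV] continuous_on_snd[OF continuous_on_id]]) auto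
    show ?thesis unfolding case_prod_beta by (rule continuous_on_mult[OF 1 2])
  qed
  have step: "((\<lambda>x. integral {-pi..pi} (\<lambda>e. f x e * u e)) has_real_derivative
      integral {-pi..pi} (\<lambda>e. fx x e * u e)) (at x)"
    if x: "x \<in> U" and df: "\<And>x e. x \<in> U \<Longrightarrow> ((\<lambda>x. f x e) has_real_derivative fx x e) (at x)"
      and fi: "\<And>x. x \<in> U \<Longrightarrow> continuous_on {-pi..pi} (f x)"
      and fx: "continuous_on (U \<times> UNIV) (\<lambda>(x, e). fx x e)" for f fx x
  proof -
    have "((\<lambda>x. integral (cbox (-pi) pi) (\<lambda>e. f x e * u e)) has_real_derivative
      integral (cbox (-pi) pi) (\<lambda>e. fx x e * u e)) (at x within U)"
    proof (rule leibniz_rule_field_derivative[OF _ _ cu[OF fx] x U(2)])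
      show "((\<lambda>x. f x t * u t) has_real_derivative fx x t * u t) (at x within U)" if "x \<in> U" for x t
        by (rule has_field_derivative_at_within[OF DERIV_cmult_right[OF df[OF that]]])
      show "(\<lambda>e. f x e * u e) integrable_on cbox (-pi) pi" if "x \<in> U" for x
        using fi[OF that] uc by (auto intro!: integrable_continuous_interval continuous_intros)
    qed
    then show ?thesis using at_within_open[OF x U(1)] by simp
  qed
  show ?thesis
    unfolding hill_solution_on_def
  proof (intro ballI conjI)
    fix x assume x: "x \<in> U"
    show "((\<lambda>x. integral {-pi..pi} (\<lambda>e. k x e * u e)) has_real_derivative
        integral {-pi..pi} (\<lambda>e. kx x e * u e)) (at x)"
      by (rule step[OF x k(1) kc c(1)])
    have "((\<lambda>x. integral {-pi..pi} (\<lambda>e. kx x e * u e)) has_real_derivative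
        integral {-pi..pi} (\<lambda>e. kxx x e * u e)) (at x)"
      by (rule step[OF x k(2) slice[OF c(1)] c(2)])
    moreover have "integral {-pi..pi} (\<lambda>e. kxx x e * u e)
        = separated_potential h lam x * integral {-pi..pi} (\<lambda>e. k x e * u e)"
    proof -
      \<comment> \<open>The boundary form of Green's identity in e. It is periodic along with k and
        u, so its derivative b' integrates to 0 over the period.\<close>
      define b where "b e = ke x e * u e - k x e * u' e" for e
      define b' where "b' e = kee x e * u e + k x e * ((lam + 2 * h\<^sup>2 * cos (2 * e)) * u e)" for e
      have "(b has_real_derivative b' e) (at e)" for e
      proof -
        have "(b has_real_derivative (kee x e * u e + u' e * ke x e) -
            (ke x e * u' e + (- (lam + 2 * h\<^sup>2 * cos (2 * e)) * u e) * k x e)) (at e)"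
          unfolding b_def by (intro DERIV_diff DERIV_mult k x d)
        then show ?thesis by (simp add: b'_def algebra_simps)
      qed
      then have "(b' has_integral b pi - b (- pi)) {-pi..pi}"
        by (intro fundamental_theorem_of_calculus)
         (auto intro: has_vector_derivative_at_within simp: has_real_derivative_iff_has_vector_derivative)
      then have b0: "(b' has_integral 0) {-pi..pi}" by (simp add: b_def per kper x)
      have "kxx x e * u e = separated_potential h lam x * (k x e * u e) - b' e" for e
      proof -
        have "kxx x e * u e = (2 * h\<^sup>2 * (cosh (2 * x) - cos (2 * e)) * k x e - kee x e) * u e"
          using pde[OF x, of e] by (simp add: eq_diff_eq)
        then show ?thesis by (simp add: b'_def separated_potential_def algebra_simps)
      qed
      moreover have "((\<lambda>e. separated_potential h lam x * (k x e * u e) - b' e) has_integral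
          separated_potential h lam x * integral {-pi..pi} (\<lambda>e. k x e * u e) - 0) {-pi..pi}"
        using kc[OF x] uc
        by (intro has_integral_diff has_integral_mult_right integrable_integral b0
            integrable_continuous_interval continuous_intros)
      ultimately show ?thesis by (simp add: integral_unique)
    qed
    ultimately show "((\<lambda>x. integral {-pi..pi} (\<lambda>e. kx x e * u e)) has_real_derivative
        separated_potential h lam x * integral {-pi..pi} (\<lambda>e. k x e * u e)) (at x)" by simp
  qed
qed

text \<open>The squared distance of two points with elliptic coordinates \<open>(x, e)\<close>, \<open>(y, f)\<close>, for \<open>c = 1\<close>.\<close>

definition sqdist :: "real \<Rightarrow> real \<Rightarrow> real \<Rightarrow> real \<Rightarrow> real" where
  "sqdist y f x e = (cosh (x + y) - cos (e + f)) * (cosh (x - y) - cos (e - f))"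

lemma sqdist_expand:
  "sqdist y f x e = (cosh x)\<^sup>2 + (cosh y)\<^sup>2 + (cos e)\<^sup>2 + (cos f)\<^sup>2 - 2
     - 2 * (cosh x * cosh y * cos e * cos f) - 2 * (sinh x * sinh y * sin e * sin f)"
  unfolding sqdist_def cosh_add cosh_diff cos_add cos_diff
  using cosh_square_eq[of x] cosh_square_eq[of y] sin_cos_squared_add[of e] sin_cos_squared_add[of f]
  by algebra

text \<open>The product form is |cosh Z - cosh W|^2 with Z = x + i e and W = y + i f: cosh Z - cosh
  W is twice sinh ((Z + W) / 2) times sinh ((Z - W) / 2), and 2 |sinh (a + i b)|^2 = cosh (2 a) -
  cos (2 b). It is symmetric in x and y alone, so it also equals the squared distance of (y, e) and
  (x, f), the form stated here.\<close>

lemma sqdist_eq: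
  "sqdist y f x e = (cosh y * cos e - cosh x * cos f)\<^sup>2 + (sinh y * sin e - sinh x * sin f)\<^sup>2"
  unfolding sqdist_expand
  using cosh_square_eq[of x] cosh_square_eq[of y] sin_cos_squared_add[of e] sin_cos_squared_add[of f]
  by algebra

lemma sqdist_pos:
  assumes "\<bar>y\<bar> < x"
  shows "sqdist y f x e > 0"
proof -
  have "cosh t > 1" if "t > 0" for t :: real
    using cosh_ge_quadratic[of t] zero_less_power[OF that, of 2] by linarith
  then have "cosh (x + y) > 1" "cosh (x - y) > 1" using assms by auto
  then show ?thesis
    unfolding sqdist_def using cos_le_one[of "e + f"] cos_le_one[of "e - f"]
    by (intro mult_pos_pos) linarith+
qed

definition sqdist_x where
  "sqdist_x y f x e = sinh (x + y) * (cosh (x - y) - cos (e - f)) + (cosh (x + y) - cos (e + f)) * sinh (x - y)"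
  for x y e f :: real

definition sqdist_xx where
  "sqdist_xx y f x e = cosh (x + y) * (cosh (x - y) - cos (e - f)) + 2 * (sinh (x + y) * sinh (x - y))
     + (cosh (x + y) - cos (e + f)) * cosh (x - y)" for x y e f :: real

definition sqdist_e where
  "sqdist_e y f x e = sin (e + f) * (cosh (x - y) - cos (e - f)) + (cosh (x + y) - cos (e + f)) * sin (e - f)"
  for x y e f :: real

definition sqdist_ee where
  "sqdist_ee y f x e = cos (e + f) * (cosh (x - y) - cos (e - f)) + 2 * (sin (e + f) * sin (e - f))
     + (cosh (x + y) - cos (e + f)) * cos (e - f)" for x y e f :: real

lemma has_real_derivative_sqdist:
  "((\<lambda>x. sqdist y f x e) has_real_derivative sqdist_x y f x e) (at x)"
  "((\<lambda>x. sqdist_x y f x e) has_real_derivative sqdist_xx y f x e) (at x)"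
  "((\<lambda>e. sqdist y f x e) has_real_derivative sqdist_e y f x e) (at e)"
  "((\<lambda>e. sqdist_e y f x e) has_real_derivative sqdist_ee y f x e) (at e)"
  unfolding sqdist_def sqdist_x_def sqdist_xx_def sqdist_e_def sqdist_ee_def
  by (auto intro!: derivative_eq_intros simp: algebra_simps)

text \<open>In Cartesian coordinates a squared distance S has squared gradient 4 S and Laplacian 4.
  Elliptic coordinates are conformal, so both get multiplied by the factor (cosh (2 x) - cos (2 e))
  / 2; the next lemma is the Laplacian.\<close>

lemma sqdist_gradient:
  "(sqdist_x y f x e)\<^sup>2 + (sqdist_e y f x e)\<^sup>2 = 2 * (cosh (2 * x) - cos (2 * e)) * sqdist y f x e"
proof -
  have 1: "cosh (2 * x) = cosh (x + y) * cosh (x - y) + sinh (x + y) * sinh (x - y)"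
    using cosh_add[of "x + y" "x - y"] by simp
  have 2: "cos (2 * e) = cos (e + f) * cos (e - f) - sin (e + f) * sin (e - f)"
    using cos_add[of "e + f" "e - f"] by simp
  show ?thesis
    unfolding 1 2 sqdist_x_def sqdist_e_def sqdist_def
    using cosh_square_eq[of "x + y"] cosh_square_eq[of "x - y"]
      sin_cos_squared_add[of "e + f"] sin_cos_squared_add[of "e - f"]
    by algebra
qed

lemma sqdist_laplacian:
  "sqdist_xx y f x e + sqdist_ee y f x e = 2 * (cosh (2 * x) - cos (2 * e))"
proof -
  have 1: "cosh (2 * x) = cosh (x + y) * cosh (x - y) + sinh (x + y) * sinh (x - y)"
    using cosh_add[of "x + y" "x - y"] by simp
  have 2: "cos (2 * e) = cos (e + f) * cos (e - f) - sin (e + f) * sin (e - f)"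
    using cos_add[of "e + f" "e - f"] by simp
  show ?thesis unfolding 1 2 sqdist_xx_def sqdist_ee_def by algebra
qed

text \<open>y and f are parameters, x and e the variables of the differential equation. In the
  theorem y = \<xi>, f = \<open>\<eta>\<^sub>0\<close>, x = \<open>\<xi>\<^sub>0\<close> and e =
  \<eta>, so each pair mixes the two points.\<close>

definition kernel_K :: "real \<Rightarrow> real \<Rightarrow> real \<Rightarrow> real \<Rightarrow> real \<Rightarrow> real" where
  "kernel_K h y f x e = radial h (sqdist y f x e)"

definition kernel_K_e :: "real \<Rightarrow> real \<Rightarrow> real \<Rightarrow> real \<Rightarrow> real \<Rightarrow> real" where
  "kernel_K_e h y f x e = radial1 h (sqdist y f x e) * sqdist_e y f x e"

definition kernel_K_ee :: "real \<Rightarrow> real \<Rightarrow> real \<Rightarrow> real \<Rightarrow> real \<Rightarrow> real" where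
  "kernel_K_ee h y f x e = radial2 h (sqdist y f x e) * (sqdist_e y f x e)\<^sup>2
     + radial1 h (sqdist y f x e) * sqdist_ee y f x e"

lemma has_real_derivative_kernel_K_e:
  assumes h: "h > 0" and x: "\<bar>y\<bar> < x"
  shows "((\<lambda>e. kernel_K h y f x e) has_real_derivative kernel_K_e h y f x e) (at e)"
    "((\<lambda>e. kernel_K_e h y f x e) has_real_derivative kernel_K_ee h y f x e) (at e)"
proof -
  note r = has_real_derivative_radial[OF h sqdist_pos[OF x, of f e]]
  note D = has_real_derivative_sqdist(3)[of y f x e] has_real_derivative_sqdist(4)[of y f x e]
  show "((\<lambda>e. kernel_K h y f x e) has_real_derivative kernel_K_e h y f x e) (at e)"
    unfolding kernel_K_def kernel_K_e_def by (rule DERIV_chain2[OF r(1) D(1)])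
  show "((\<lambda>e. kernel_K_e h y f x e) has_real_derivative kernel_K_ee h y f x e) (at e)"
    using DERIV_mult[OF DERIV_chain2[OF r(2) D(1)] D(2)]
    unfolding kernel_K_e_def kernel_K_ee_def by (simp add: power2_eq_square mult_ac)
qed

lemma continuous_on_kernel_K_ee:
  assumes h: "h > 0" and x: "\<bar>y\<bar> < x"
  shows "continuous_on S (\<lambda>e. kernel_K_ee h y f x e)"
proof -
  have "continuous_on S (\<lambda>e. radial1 h (sqdist y f x e))" "continuous_on S (\<lambda>e. radial2 h (sqdist y f x e))"
  proof -
    have Sc: "continuous_on S (\<lambda>e. sqdist y f x e)"
      unfolding sqdist_def by (intro continuous_intros)
    show "continuous_on S (\<lambda>e. radial1 h (sqdist y f x e))" "continuous_on S (\<lambda>e. radial2 h (sqdist y f x e))"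
      by (rule continuous_on_compose2[OF continuous_on_radial(2)[OF h] Sc]
          continuous_on_compose2[OF continuous_on_radial(3)[OF h] Sc]; use sqdist_pos[OF x] in auto)+
  qed
  then show ?thesis
    unfolding kernel_K_ee_def sqdist_e_def sqdist_ee_def by (intro continuous_intros)
qed

lemma kernel_K_periodic:
  "kernel_K h y f x (e + 2 * pi) = kernel_K h y f x e"
  "kernel_K_e h y f x (e + 2 * pi) = kernel_K_e h y f x e"
proof -
  have 1: "cos (e + 2 * pi + f) = cos (e + f)" "cos (e + 2 * pi - f) = cos (e - f)"
    "sin (e + 2 * pi + f) = sin (e + f)" "sin (e + 2 * pi - f) = sin (e - f)"
    using cos_periodic[of "e + f"] cos_periodic[of "e - f"] sin_periodic[of "e + f"] sin_periodic[of "e - f"]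
    by (simp_all add: algebra_simps)
  show "kernel_K h y f x (e + 2 * pi) = kernel_K h y f x e"
    "kernel_K_e h y f x (e + 2 * pi) = kernel_K_e h y f x e"
    by (simp_all add: kernel_K_def kernel_K_e_def sqdist_def sqdist_e_def 1)
qed

lemma integral_kernel_K:
  assumes h: "h > 0"
    and u: "hill_solution_on UNIV (\<lambda>e. - (lam + 2 * h\<^sup>2 * cos (2 * e))) u u'"
    and per: "u pi = u (- pi)" "u' pi = u' (- pi)"
  shows "\<exists>W'. hill_solution_on {\<bar>y\<bar><..} (separated_potential h lam)
      (\<lambda>x. integral {-pi..pi} (\<lambda>e. kernel_K h y f x e * u e)) W'"
proof -
  define U where "U = {\<bar>y\<bar><..}"
  have pos: "sqdist y f x e > 0" if "x \<in> U" for x e using that by (intro sqdist_pos) (simp add: U_def)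
  note r = has_real_derivative_radial[OF h pos]
  define kx where "kx x e = radial1 h (sqdist y f x e) * sqdist_x y f x e" for x e
  define kxx where "kxx x e = radial2 h (sqdist y f x e) * (sqdist_x y f x e)\<^sup>2
     + radial1 h (sqdist y f x e) * sqdist_xx y f x e" for x e
  have Sc: "continuous_on A (\<lambda>p. sqdist y f (fst p) (snd p))" "continuous_on A (\<lambda>p. sqdist_x y f (fst p) (snd p))"
    "continuous_on A (\<lambda>p. sqdist_xx y f (fst p) (snd p))" for A
    unfolding sqdist_def sqdist_x_def sqdist_xx_def by (intro continuous_intros)+
  have Rc: "continuous_on (U \<times> UNIV) (\<lambda>p. radial1 h (sqdist y f (fst p) (snd p)))"
    "continuous_on (U \<times> UNIV) (\<lambda>p. radial2 h (sqdist y f (fst p) (snd p)))"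
    by (rule continuous_on_compose2[OF continuous_on_radial(2)[OF h] Sc(1)]
        continuous_on_compose2[OF continuous_on_radial(3)[OF h] Sc(1)]; use pos in auto)+
  have "hill_solution_on U (separated_potential h lam)
      (\<lambda>x. integral {-pi..pi} (\<lambda>e. kernel_K h y f x e * u e)) (\<lambda>x. integral {-pi..pi} (\<lambda>e. kx x e * u e))"
  proof (rule integral_kernel_modified_mathieu[OF _ _ u per])
    show "open U" "convex U" by (auto simp: U_def)
    fix x assume x: "x \<in> U"
    then have xy: "\<bar>y\<bar> < x" by (simp add: U_def)
    show "((\<lambda>x. kernel_K h y f x e) has_real_derivative kx x e) (at x)" for e
      unfolding kernel_K_def kx_def by (rule DERIV_chain2[OF r(1)[OF x] has_real_derivative_sqdist(1)])
    show "((\<lambda>x. kx x e) has_real_derivative kxx x e) (at x)" for e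
      using DERIV_mult[OF DERIV_chain2[OF r(2)[OF x] has_real_derivative_sqdist(1)] has_real_derivative_sqdist(2)]
      unfolding kx_def kxx_def by (simp add: power2_eq_square mult_ac)
    show "((\<lambda>e. kernel_K h y f x e) has_real_derivative kernel_K_e h y f x e) (at e)"
      "((\<lambda>e. kernel_K_e h y f x e) has_real_derivative kernel_K_ee h y f x e) (at e)" for e
      by (rule has_real_derivative_kernel_K_e[OF h xy])+
    show "kernel_K h y f x pi = kernel_K h y f x (- pi)" "kernel_K_e h y f x pi = kernel_K_e h y f x (- pi)"
      using kernel_K_periodic[of h y f x "- pi"] by simp_all
    show "kxx x e + kernel_K_ee h y f x e = 2 * h\<^sup>2 * (cosh (2 * x) - cos (2 * e)) * kernel_K h y f x e" for e
    proof -
      \<comment> \<open>The chain rule and the two conformal identities extract the common factor D;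
        what is left is Bessel's equation in s.\<close>
      define s D where "s = sqdist y f x e" and "D = 2 * (cosh (2 * x) - cos (2 * e))"
      have "kxx x e + kernel_K_ee h y f x e
          = radial2 h s * ((sqdist_x y f x e)\<^sup>2 + (sqdist_e y f x e)\<^sup>2)
            + radial1 h s * (sqdist_xx y f x e + sqdist_ee y f x e)"
        by (simp add: kxx_def kernel_K_ee_def s_def algebra_simps)
      also have "\<dots> = radial2 h s * (D * s) + radial1 h s * D"
        unfolding sqdist_gradient sqdist_laplacian s_def D_def ..
      also have "\<dots> = D * (s * radial2 h s + radial1 h s)" by (simp add: algebra_simps)
      also have "\<dots> = D * (h\<^sup>2 * radial h s)" using radial_ode[OF pos[OF x, of e]] by (simp add: s_def)
      finally show ?thesis by (simp add: kernel_K_def s_def D_def)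
    qed
  next
    show "continuous_on (U \<times> UNIV) (\<lambda>(x, e). kx x e)" "continuous_on (U \<times> UNIV) (\<lambda>(x, e). kxx x e)"
      unfolding kx_def kxx_def case_prod_beta by (intro continuous_intros Rc Sc)+
  qed
  then show ?thesis unfolding U_def by blast
qed

text \<open>The plane wave exp (k p \<bullet> n) for c = 1, where k = 2 h, p is the point with
  elliptic coordinates (x, e), and n = (cos f, sin f) is the direction.\<close>

definition kernel_I :: "real \<Rightarrow> real \<Rightarrow> real \<Rightarrow> real \<Rightarrow> real" where
  "kernel_I h f x e = exp (2 * h * (cosh x * cos e * cos f + sinh x * sin e * sin f))"

text \<open>The exponent P is linear in Cartesian coordinates, hence harmonic: its second
  derivatives are P in x and -P in e and cancel. Its squared gradient is 4 h^2 times the conformal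
  factor sinh^2 x + sin^2 e, which gives the equation for exp P.\<close>

lemma integral_kernel_I:
  assumes u: "hill_solution_on UNIV (\<lambda>e. - (lam + 2 * h\<^sup>2 * cos (2 * e))) u u'"
    and per: "u pi = u (- pi)" "u' pi = u' (- pi)"
  shows "\<exists>W'. hill_solution_on UNIV (separated_potential h lam)
      (\<lambda>x. integral {-pi..pi} (\<lambda>e. kernel_I h f x e * u e)) W'"
proof -
  define P where "P x e = 2 * h * (cosh x * cos e * cos f + sinh x * sin e * sin f)" for x e
  define Px where "Px x e = 2 * h * (sinh x * cos e * cos f + cosh x * sin e * sin f)" for x e
  define Pe where "Pe x e = 2 * h * (- (cosh x * sin e * cos f) + sinh x * cos e * sin f)" for x e
  have dP: "((\<lambda>x. P x e) has_real_derivative Px x e) (at x)" "((\<lambda>x. Px x e) has_real_derivative P x e) (at x)"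
    "((\<lambda>e. P x e) has_real_derivative Pe x e) (at e)" "((\<lambda>e. Pe x e) has_real_derivative - P x e) (at e)" for x e
    unfolding P_def Px_def Pe_def by (auto intro!: derivative_eq_intros simp: algebra_simps)
  have kP: "kernel_I h f = (\<lambda>x e. exp (P x e))" by (simp add: kernel_I_def P_def fun_eq_iff)
  have "hill_solution_on UNIV (separated_potential h lam)
      (\<lambda>x. integral {-pi..pi} (\<lambda>e. kernel_I h f x e * u e)) (\<lambda>x. integral {-pi..pi} (\<lambda>e. exp (P x e) * Px x e * u e))"
    unfolding kP
  proof (rule integral_kernel_modified_mathieu[OF open_UNIV convex_UNIV u per,
      where kxx = "\<lambda>x e. exp (P x e) * (Px x e)\<^sup>2 + exp (P x e) * P x e"
        and ke = "\<lambda>x e. exp (P x e) * Pe x e" and kee = "\<lambda>x e. exp (P x e) * (Pe x e)\<^sup>2 - exp (P x e) * P x e"])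
    fix x e
    note dexp = DERIV_chain2[OF DERIV_exp dP(1)[of e x]] DERIV_chain2[OF DERIV_exp dP(3)[of x e]]
    show "((\<lambda>x. exp (P x e)) has_real_derivative exp (P x e) * Px x e) (at x)"
      "((\<lambda>e. exp (P x e)) has_real_derivative exp (P x e) * Pe x e) (at e)" using dexp by simp_all
    show "((\<lambda>x. exp (P x e) * Px x e) has_real_derivative exp (P x e) * (Px x e)\<^sup>2 + exp (P x e) * P x e) (at x)"
      using DERIV_mult[OF dexp(1) dP(2)[of e x]] by (simp add: power2_eq_square mult_ac)
    show "((\<lambda>e. exp (P x e) * Pe x e) has_real_derivative exp (P x e) * (Pe x e)\<^sup>2 - exp (P x e) * P x e) (at e)"
      using DERIV_mult[OF dexp(2) dP(4)[of x e]] by (simp add: power2_eq_square mult_ac)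
    show "exp (P x e) * (Px x e)\<^sup>2 + exp (P x e) * P x e + (exp (P x e) * (Pe x e)\<^sup>2 - exp (P x e) * P x e)
        = 2 * h\<^sup>2 * (cosh (2 * x) - cos (2 * e)) * exp (P x e)"
    proof -
      have "(Px x e)\<^sup>2 + (Pe x e)\<^sup>2 = 2 * h\<^sup>2 * (cosh (2 * x) - cos (2 * e))"
      proof -
        have rot: "(2 * h * (A * p + B * q))\<^sup>2 + (2 * h * (- (B * p) + A * q))\<^sup>2
            = 4 * h\<^sup>2 * (A\<^sup>2 + B\<^sup>2) * (q\<^sup>2 + p\<^sup>2)" for A B p q :: real
          by (simp add: power2_eq_square algebra_simps)
        have "(Px x e)\<^sup>2 + (Pe x e)\<^sup>2
            = 4 * h\<^sup>2 * ((sinh x)\<^sup>2 * (cos e)\<^sup>2 + (cosh x)\<^sup>2 * (sin e)\<^sup>2)"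
          unfolding Px_def Pe_def using rot[of "sinh x * cos e" "cos f" "cosh x * sin e" "sin f"]
          by (simp add: power_mult_distrib)
        also have "\<dots> = 4 * h\<^sup>2 * ((sinh x)\<^sup>2 + (sin e)\<^sup>2)"
          by (simp add: cosh_square_eq cos_squared_eq algebra_simps)
        also have "\<dots> = 2 * h\<^sup>2 * (cosh (2 * x) - cos (2 * e))"
          unfolding cosh_double cos_double by (simp add: cosh_square_eq cos_squared_eq algebra_simps)
        finally show ?thesis .
      qed
      moreover have "exp (P x e) * (Px x e)\<^sup>2 + exp (P x e) * P x e + (exp (P x e) * (Pe x e)\<^sup>2 - exp (P x e) * P x e)
        = ((Px x e)\<^sup>2 + (Pe x e)\<^sup>2) * exp (P x e)"
        by (simp add: algebra_simps)
      ultimately show ?thesis by (simp only:)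
    qed
  qed (auto simp: P_def Px_def Pe_def case_prod_beta intro!: continuous_intros)
  then show ?thesis by blast
qed

lemma dominated_convergence_Icc:
  fixes f :: "real \<Rightarrow> real \<Rightarrow> real"
  assumes f: "\<And>x. continuous_on {a..b} (f x)" and g: "continuous_on {a..b} g"
    and B: "\<forall>\<^sub>F x in at_top. \<forall>t\<in>{a..b}. \<bar>f x t\<bar> \<le> B"
    and lim: "\<And>t. t \<in> {a..b} \<Longrightarrow> ((\<lambda>x. f x t) \<longlongrightarrow> g t) at_top"
  shows "((\<lambda>x. integral {a..b} (f x)) \<longlongrightarrow> integral {a..b} g) at_top"
proof -
  have eq: "integral {a..b} F = (\<integral>t. indicator {a..b} t *\<^sub>R F t \<partial>lborel)" if "continuous_on {a..b} F" for F :: "real \<Rightarrow> real"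
    using set_borel_integral_eq_integral(2)[OF borel_integrable_atLeastAtMost'[OF that]]
    by (simp add: set_lebesgue_integral_def)
  have meas: "(\<lambda>t. indicator {a..b} t *\<^sub>R F t) \<in> borel_measurable lborel"
    if "continuous_on {a..b} F" for F :: "real \<Rightarrow> real"
    using borel_integrable_atLeastAtMost'[OF that] unfolding set_integrable_def by (rule borel_measurable_integrable)
  have "((\<lambda>x. \<integral>t. indicator {a..b} t *\<^sub>R f x t \<partial>lborel) \<longlongrightarrow> (\<integral>t. indicator {a..b} t *\<^sub>R g t \<partial>lborel)) at_top"
  proof (rule integral_dominated_convergence_at_top[where w = "\<lambda>t. indicator {a..b} t *\<^sub>R B"])
    show "(\<lambda>t. indicator {a..b} t *\<^sub>R g t) \<in> borel_measurable lborel"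
      "(\<lambda>t. indicator {a..b} t *\<^sub>R f x t) \<in> borel_measurable lborel" for x by (intro meas f g)+
    show "integrable lborel (\<lambda>t. indicator {a..b} t *\<^sub>R B)"
      using borel_integrable_atLeastAtMost'[of a b "\<lambda>_. B"] by (simp add: set_integrable_def)
    show "AE t in lborel. ((\<lambda>x. indicator {a..b} t *\<^sub>R f x t) \<longlongrightarrow> indicator {a..b} t *\<^sub>R g t) at_top"
    proof (rule AE_I2)
      fix t
      show "((\<lambda>x. indicator {a..b} t *\<^sub>R f x t) \<longlongrightarrow> indicator {a..b} t *\<^sub>R g t) at_top"
        using lim[of t] by (cases "t \<in> {a..b}") auto
    qed
    show "\<forall>\<^sub>F x in at_top. AE t in lborel. norm (indicator {a..b} t *\<^sub>R f x t) \<le> indicator {a..b} t *\<^sub>R B"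
      using B by eventually_elim (auto intro!: AE_I2 simp: indicator_def)
  qed
  then show ?thesis by (simp only: eq[OF f] eq[OF g])
qed

section \<open>Radial functions and the expansion\<close>

lemma integral_eq_primitive:
  fixes G :: "real \<Rightarrow> real"
  assumes G: "continuous_on UNIV G" and ab: "a \<le> b"
  shows "integral {a..b} G = primitive G b - primitive G a"
proof -
  have "(G has_integral primitive G b - primitive G a) {a..b}"
    using ab has_real_derivative_primitive[OF G]
    by (intro fundamental_theorem_of_calculus)
     (auto intro: has_vector_derivative_at_within simp: has_real_derivative_iff_has_vector_derivative)
  then show ?thesis by (rule integral_unique)
qed

lemma integral_periodic_shift:
  fixes G :: "real \<Rightarrow> real"
  assumes G: "continuous_on UNIV G" and per: "\<And>e. G (e + 2 * pi) = G e"
  shows "integral {a..a + 2 * pi} G = integral {-pi..pi} G"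
proof -
  define I where "I a = primitive G (a + 2 * pi) - primitive G a" for a
  have "(I has_real_derivative 0) (at a)" for a
  proof -
    have "((\<lambda>a. primitive G (a + 2 * pi)) has_real_derivative G (a + 2 * pi)) (at a)"
      using has_real_derivative_primitive[OF G, of "a + 2 * pi"] by (simp add: DERIV_shift)
    from DERIV_diff[OF this has_real_derivative_primitive[OF G]]
    show ?thesis by (simp add: I_def[abs_def] per)
  qed
  then have "I a = I (- pi)" using DERIV_isconst_all by blast
  moreover have "integral {b..b + 2 * pi} G = I b" for b
    unfolding I_def by (rule integral_eq_primitive[OF G]) simp
  ultimately have "integral {a..a + 2 * pi} G = integral {-pi..- pi + 2 * pi} G" by (simp only:)
  moreover have "- pi + 2 * pi = pi" by simp
  ultimately show ?thesis by (simp only:)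
qed

lemma integral_translate:
  fixes G :: "real \<Rightarrow> real"
  assumes G: "continuous_on UNIV G" and ab: "a \<le> b"
  shows "integral {a..b} (\<lambda>t. G (t + c)) = integral {a + c..b + c} G"
proof -
  have "((\<lambda>t. primitive G (t + c)) has_real_derivative G (t + c)) (at t)" for t
    using has_real_derivative_primitive[OF G, of "t + c"] by (simp add: DERIV_shift)
  then have "((\<lambda>t. G (t + c)) has_integral primitive G (b + c) - primitive G (a + c)) {a..b}"
    using ab by (intro fundamental_theorem_of_calculus)
     (auto intro: has_vector_derivative_at_within simp: has_real_derivative_iff_has_vector_derivative)
  then show ?thesis using integral_eq_primitive[OF G, of "a + c" "b + c"] ab by (simp add: integral_unique)
qed

lemma integral_symmetric_interval:
  fixes G :: "real \<Rightarrow> real"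
  assumes G: "continuous_on UNIV G"
  shows "integral {-pi..pi} G = integral {0..pi} (\<lambda>e. G e + G (- e))"
proof -
  have int: "F integrable_on {a..b}" if "continuous_on UNIV F" for F :: "real \<Rightarrow> real" and a b
    using continuous_on_subset[OF that] by (intro integrable_continuous_interval) auto
  have Gm: "continuous_on UNIV (\<lambda>e. G (- e))"
    by (rule continuous_on_compose2[OF G continuous_on_minus[OF continuous_on_id]]) auto
  have "integral {-pi..pi} G = integral {-pi..0} G + integral {0..pi} G"
    by (rule Henstock_Kurzweil_Integration.integral_combine[symmetric]) (auto intro: int G)
  also have "integral {-pi..0} G = integral {0..pi} (\<lambda>e. G (- e))"
    using Henstock_Kurzweil_Integration.integral_reflect_real[of pi 0 "\<lambda>e. G (- e)"] by simp
  finally show ?thesis using integral_add[OF int[OF G] int[OF Gm], of 0 pi] by simp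
qed

section \<open>Leading behaviour of the integrals of both kernels\<close>

lemma filterlim_cosh_at_top: "c > 0 \<Longrightarrow> filterlim (\<lambda>x::real. c * cosh x) at_top at_top"
  by real_asymp

text \<open>With e = t + f the exponent becomes Z cos t - 2 h exp (-x) sin (t + f) sin f, since cosh
  x - sinh x = exp (-x). The peak is then at t = 0, and the correction, which vanishes as x grows,
  is put into the factor g.\<close>

lemma kernel_I_asymptotic:
  assumes h: "h > 0" and u: "continuous_on UNIV u" "\<And>e. u (e + 2 * pi) = u e" "\<And>e. \<bar>u e\<bar> \<le> B"
  shows "((\<lambda>x. sqrt (2 * h * cosh x) * exp (- (2 * h * cosh x)) *
     integral {-pi..pi} (\<lambda>e. kernel_I h f x e * u e)) \<longlongrightarrow> sqrt (2 * pi) * u f) at_top"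
proof -
  define Z where "Z x = 2 * h * cosh x" for x
  define g where "g x t = exp (- (2 * h * (exp (- x) * sin (t + f) * sin f))) * u (t + f)" for x t
  have Z: "filterlim Z at_top at_top" unfolding Z_def using h by (intro filterlim_cosh_at_top) simp
  have uf: "continuous_on A (\<lambda>t. u (t + f))" for A
    by (rule continuous_on_compose2[OF u(1)]) (auto intro!: continuous_intros)
  have "((\<lambda>x. sqrt (Z x) * exp (- Z x) * integral {-pi..pi} (\<lambda>t. exp (Z x * cos t) * g x t))
    \<longlongrightarrow> sqrt (2 * pi) * u f) at_top"
  proof (rule laplace_method_cos[OF Z, where M = "exp (2 * h) * B"])
    show "continuous_on UNIV (g x)" for x unfolding g_def by (intro continuous_intros uf)
    show "\<forall>\<^sub>F x in at_top. \<forall>t. \<bar>g x t\<bar> \<le> exp (2 * h) * B"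
      using eventually_ge_at_top[of 0]
    proof eventually_elim
      case (elim x)
      show ?case
      proof
        fix t
        have "\<bar>exp (- x) * sin (t + f) * sin f\<bar> \<le> 1 * 1 * 1"
          unfolding abs_mult using elim by (intro mult_mono) auto
        then have "- (exp (- x) * sin (t + f) * sin f) \<le> 1" by linarith
        then have "2 * h * - (exp (- x) * sin (t + f) * sin f) \<le> 2 * h * 1" using h by (intro mult_left_mono) auto
        then have "exp (- (2 * h * (exp (- x) * sin (t + f) * sin f))) \<le> exp (2 * h)" by simp
        then show "\<bar>g x t\<bar> \<le> exp (2 * h) * B" unfolding g_def abs_mult using u(3)
          by (intro mult_mono) auto
      qed
    qed
    fix s
    have lim0: "((\<lambda>x. s / sqrt (Z x)) \<longlongrightarrow> 0) at_top"
    proof -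
      have "((\<lambda>z. s / sqrt z) \<longlongrightarrow> 0) at_top" by real_asymp
      then show ?thesis using Z by (rule filterlim_compose)
    qed
    have "((\<lambda>x. u (s / sqrt (Z x) + f)) \<longlongrightarrow> u (0 + f)) at_top"
    proof (rule isCont_tendsto_compose[of "0 + f" u])
      show "isCont u (0 + f)" using u(1) by (simp add: continuous_on_eq_continuous_at)
    qed (intro tendsto_intros lim0)
    moreover have "((\<lambda>x. exp (- (2 * h * (exp (- x) * sin (s / sqrt (Z x) + f) * sin f))))
       \<longlongrightarrow> exp (- (2 * h * (0 * sin (0 + f) * sin f)))) at_top"
    proof -
      have e0: "((\<lambda>x::real. exp (- x)) \<longlongrightarrow> 0) at_top" by real_asymp
      show ?thesis
        by (intro tendsto_exp tendsto_minus tendsto_mult tendsto_const tendsto_sin tendsto_add lim0 e0)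
    qed
    ultimately have "((\<lambda>x. g x (s / sqrt (Z x)))
      \<longlongrightarrow> exp (- (2 * h * (0 * sin (0 + f) * sin f))) * u (0 + f)) at_top"
      unfolding g_def by (rule tendsto_mult[rotated])
    then show "((\<lambda>x. g x (s / sqrt (Z x))) \<longlongrightarrow> u f) at_top" by simp
  qed
  moreover have "integral {-pi..pi} (\<lambda>t. exp (Z x * cos t) * g x t)
      = integral {-pi..pi} (\<lambda>e. kernel_I h f x e * u e)" for x
  proof -
    define G where "G e = kernel_I h f x e * u e" for e
    have Gc: "continuous_on UNIV G" unfolding G_def kernel_I_def by (intro continuous_intros u)
    have "exp (Z x * cos t) * g x t = G (t + f)" for t
    proof -
      have "Z x * cos t - 2 * h * (exp (- x) * sin (t + f) * sin f)
          = 2 * h * (cosh x * cos (t + f) * cos f + sinh x * sin (t + f) * sin f)"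
      proof -
        have ct: "cos t = cos (t + f) * cos f + sin (t + f) * sin f" using cos_diff[of "t + f" f] by simp
        have ex: "exp (- x) = cosh x - sinh x" by (simp add: cosh_minus_sinh)
        show ?thesis unfolding ct ex Z_def by (simp add: algebra_simps)
      qed
      then show ?thesis
        by (simp add: g_def G_def kernel_I_def mult.assoc[symmetric] exp_add[symmetric])
    qed
    then have "integral {-pi..pi} (\<lambda>t. exp (Z x * cos t) * g x t) = integral {-pi + f..pi + f} G"
      using integral_translate[OF Gc, of "-pi" pi f] by simp
    also have "\<dots> = integral {-pi + f..(-pi + f) + 2 * pi} G" by (simp add: algebra_simps)
    also have "\<dots> = integral {-pi..pi} G"
      by (rule integral_periodic_shift[OF Gc]) (simp add: G_def kernel_I_def u(2))
    finally show ?thesis by (simp add: G_def[abs_def])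
  qed
  ultimately show ?thesis by (simp add: Z_def)
qed

text \<open>The constant m involves y only, so the bound is uniform in both angles and can dominate
  exp (Z - R) below. The summand 1 in m produces the term -2 cosh x, which absorbs m^2 and the
  constant -2 as soon as cosh x \<ge> m^2 + 1.\<close>

lemma sqrt_sqdist_ge:
  fixes y f x e :: real
  defines "m \<equiv> cosh y + \<bar>sinh y\<bar> + 1"
  assumes x: "x \<ge> 0" "cosh x \<ge> m\<^sup>2 + 1" "cosh x \<ge> m"
  shows "sqrt (sqdist y f x e) \<ge> cosh x - m"
proof -
  have b1: "cosh x * cosh y * cos e * cos f \<le> cosh x * cosh y"
  proof -
    have "cos e * cos f \<le> 1" using abs_cos_le_one[of e] abs_cos_le_one[of f]
      by (metis abs_le_D1 abs_mult mult_le_one abs_ge_zero)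
    then have "cosh x * cosh y * (cos e * cos f) \<le> cosh x * cosh y * 1" by (intro mult_left_mono) auto
    then show ?thesis by (simp add: mult.assoc)
  qed
  have b2: "sinh x * sinh y * sin e * sin f \<le> cosh x * \<bar>sinh y\<bar>"
  proof -
    have "sinh x * sinh y * sin e * sin f \<le> \<bar>sinh x\<bar> * \<bar>sinh y\<bar> * (\<bar>sin e\<bar> * \<bar>sin f\<bar>)"
      using abs_ge_self[of "sinh x * sinh y * sin e * sin f"] by (simp add: abs_mult mult.assoc)
    also have "\<dots> \<le> cosh x * \<bar>sinh y\<bar> * (1 * 1)"
      using x sinh_le_cosh_real[of x] by (intro mult_mono) auto
    finally show ?thesis by simp
  qed
  have "(cosh x - m)\<^sup>2 = (cosh x)\<^sup>2 - 2 * (cosh x * cosh y) - 2 * (cosh x * \<bar>sinh y\<bar>) - 2 * cosh x + m\<^sup>2"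
    by (simp add: m_def power2_eq_square algebra_simps)
  also have "\<dots> \<le> (cosh x)\<^sup>2 + (cosh y)\<^sup>2 + (cos e)\<^sup>2 + (cos f)\<^sup>2 - 2
     - 2 * (cosh x * cosh y * cos e * cos f) - 2 * (sinh x * sinh y * sin e * sin f)"
    using b1 b2 x(2) cosh_real_ge_1[of x] zero_le_power2[of "cosh y"] zero_le_power2[of "cos e"] zero_le_power2[of "cos f"]
    by linarith
  also have "\<dots> = sqdist y f x e" by (simp add: sqdist_expand)
  finally show ?thesis using x(3) by (simp add: real_le_rsqrt)
qed

text \<open>As a function of x the squared distance has the form under the root. Since sinh x and
  cosh x agree to leading order, the root is cosh x + (b + g) / 2 up to o(1); -(b + g) / 2 turns
  into the exponent of the plane wave.\<close>

lemma sqrt_cosh_asymptotic: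
  fixes a b g :: real
  shows "((\<lambda>x. cosh x - sqrt ((cosh x)\<^sup>2 + b * cosh x + g * sinh x + a)) \<longlongrightarrow> - (b + g) / 2) at_top"
    "((\<lambda>x. cosh x / sqrt ((cosh x)\<^sup>2 + b * cosh x + g * sinh x + a)) \<longlongrightarrow> 1) at_top"
proof -
  have "((\<lambda>x. cosh x - sqrt ((cosh x)\<^sup>2 + b * cosh x + g * sinh x + a))
      \<longlongrightarrow> - (inverse ((1 / 2)\<^sup>2) * (b / 2 + g / 2) / 4)) at_top" by real_asymp
  moreover have "- (inverse ((1 / 2)\<^sup>2) * (b / 2 + g / 2) / 4) = - (b + g) / 2"
    by (simp add: power2_eq_square field_simps)
  ultimately show "((\<lambda>x. cosh x - sqrt ((cosh x)\<^sup>2 + b * cosh x + g * sinh x + a)) \<longlongrightarrow> - (b + g) / 2) at_top"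
    by (simp only:)
  show "((\<lambda>x. cosh x / sqrt ((cosh x)\<^sup>2 + b * cosh x + g * sinh x + a)) \<longlongrightarrow> 1) at_top"
    by real_asymp
qed

text \<open>With R = 2 h sqrt S, where S is the squared distance, the scaled kernel is H(R) sqrt (Z
  / R) exp (Z - R), where H(z) = sqrt z exp z K_0(z) tends to sqrt (pi / 2), Z / R tends to 1, and Z
  - R tends to the exponent of the plane wave at (y, e).\<close>

lemma kernel_K_asymptotic:
  assumes h: "h > 0" and u: "continuous_on UNIV u" "\<And>e. \<bar>u e\<bar> \<le> B"
  shows "((\<lambda>x. sqrt (2 * h * cosh x) * exp (2 * h * cosh x) *
     integral {-pi..pi} (\<lambda>e. kernel_K h y f x e * u e))
     \<longlongrightarrow> sqrt (pi / 2) * integral {-pi..pi} (\<lambda>e. kernel_I h f y e * u e)) at_top"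
proof -
  define Z where "Z x = 2 * h * cosh x" for x
  define R where "R x e = 2 * h * sqrt (sqdist y f x e)" for x e
  define m where "m = cosh y + \<bar>sinh y\<bar> + 1"
  define H where "H z = sqrt z * exp z * bessel_K 0 z" for z
  have m1: "m \<ge> 1" unfolding m_def by simp
  have Zlim: "filterlim Z at_top at_top" unfolding Z_def using h by (intro filterlim_cosh_at_top) simp
  have Zpos: "Z x > 0" for x using h by (simp add: Z_def)
  have Hlim: "(H \<longlongrightarrow> sqrt (pi / 2)) at_top" unfolding H_def by (rule bessel_K_asymptotic)
  have "sqrt (pi / 2) < 2" using pi_less_4 by (intro real_less_lsqrt) auto
  then have "\<forall>\<^sub>F z in at_top. \<bar>H z\<bar> < 2"
    using order_tendstoD(2)[OF tendsto_rabs[OF Hlim]] by simp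
  then obtain z0 where z0: "\<And>z. z \<ge> z0 \<Longrightarrow> \<bar>H z\<bar> < 2" by (auto simp: eventually_at_top_linorder)
  have split: "sqrt (Z x) * exp (Z x) * kernel_K h y f x e = H (R x e) * sqrt (Z x / R x e) * exp (Z x - R x e)"
    if "R x e > 0" for x e
    using that Zpos[of x] by (simp add: H_def kernel_K_def radial_def R_def[symmetric] real_sqrt_divide exp_diff)
  \<comment> \<open>Replacing x by max x (|y| + 1) makes the integrand continuous in e for every x,
    as \<open>dominated_convergence_Icc\<close> asks; for large x nothing changes.\<close>
  define F where "F x e = sqrt (Z (max x (\<bar>y\<bar> + 1))) * exp (Z (max x (\<bar>y\<bar> + 1))) *
    (kernel_K h y f (max x (\<bar>y\<bar> + 1)) e * u e)" for x e
  \<comment> \<open>cosh x \<ge> 2 m makes R at least Z / 2, so Z / R \<le> 2; Z \<ge> 2 |z0| then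
    places R where |H| < 2.\<close>
  have ev_big: "\<forall>\<^sub>F x in at_top. x \<ge> 0 \<and> x \<ge> \<bar>y\<bar> + 1 \<and> cosh x \<ge> m\<^sup>2 + 1 \<and> cosh x \<ge> 2 * m \<and> Z x \<ge> 2 * \<bar>z0\<bar>"
  proof -
    have cl: "filterlim (\<lambda>x::real. cosh x) at_top at_top" using filterlim_cosh_at_top[of 1] by simp
    show ?thesis
      using filterlim_at_top[THEN iffD1, rule_format, OF cl] filterlim_at_top[THEN iffD1, rule_format, OF Zlim]
      by (intro eventually_conj eventually_ge_at_top) auto
  qed
  have "((\<lambda>x. integral {-pi..pi} (F x)) \<longlongrightarrow> integral {-pi..pi} (\<lambda>e. sqrt (pi / 2) * (kernel_I h f y e * u e))) at_top"
  proof (rule dominated_convergence_Icc[where B = "2 * sqrt 2 * exp (2 * h * m) * B"])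
    show "continuous_on {-pi..pi} (F x)" for x
    proof -
      have "continuous_on {-pi..pi} (\<lambda>e. kernel_K h y f (max x (\<bar>y\<bar> + 1)) e)"
      proof -
        have "\<bar>y\<bar> < max x (\<bar>y\<bar> + 1)" by simp
        from has_real_derivative_kernel_K_e(1)[OF h this] show ?thesis
          by (intro continuous_at_imp_continuous_on ballI DERIV_isCont)
      qed
      then show ?thesis unfolding F_def by (intro continuous_intros continuous_on_subset[OF u(1)]) auto
    qed
    show "continuous_on {-pi..pi} (\<lambda>e. sqrt (pi / 2) * (kernel_I h f y e * u e))"
      unfolding kernel_I_def by (intro continuous_intros continuous_on_subset[OF u(1)]) auto
    show "\<forall>\<^sub>F x in at_top. \<forall>e\<in>{-pi..pi}. \<bar>F x e\<bar> \<le> 2 * sqrt 2 * exp (2 * h * m) * B"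
      using ev_big
    proof (rule eventually_mono, intro ballI)
      fix x e
      assume x: "x \<ge> 0 \<and> x \<ge> \<bar>y\<bar> + 1 \<and> cosh x \<ge> m\<^sup>2 + 1 \<and> cosh x \<ge> 2 * m \<and> Z x \<ge> 2 * \<bar>z0\<bar>"
      have "cosh x \<ge> m" using x m1 by linarith
      then have "cosh x - m \<le> sqrt (sqdist y f x e)"
        using x unfolding m_def by (intro sqrt_sqdist_ge) simp_all
      then have "2 * h * (cosh x - m) \<le> R x e" unfolding R_def using h by (intro mult_left_mono) auto
      then have R1: "Z x - R x e \<le> 2 * h * m" by (simp add: Z_def algebra_simps)
      have "2 * h * (2 * m) \<le> 2 * h * cosh x" using x h by (intro mult_left_mono) auto
      then have R2: "R x e \<ge> Z x / 2" using R1 by (simp add: Z_def)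
      have Rpos: "R x e > 0" using R2 Zpos[of x] by linarith
      have 1: "\<bar>H (R x e)\<bar> \<le> 2" using z0[of "R x e"] R2 x by linarith
      have "Z x / R x e \<le> 2" using R2 Rpos by (simp add: divide_le_eq)
      then have 2: "sqrt (Z x / R x e) \<le> sqrt 2" by simp
      have 3: "exp (Z x - R x e) \<le> exp (2 * h * m)" using R1 by simp
      have "\<bar>H (R x e)\<bar> * sqrt (Z x / R x e) * exp (Z x - R x e) * \<bar>u e\<bar> \<le> 2 * sqrt 2 * exp (2 * h * m) * B"
        using 1 2 3 u(2)[of e] Rpos Zpos[of x] by (intro mult_mono) auto
      moreover have "F x e = H (R x e) * sqrt (Z x / R x e) * exp (Z x - R x e) * u e"
        using split[OF Rpos] max_absorb1[of "\<bar>y\<bar> + 1" x] x by (simp add: F_def mult.assoc)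
      ultimately show "\<bar>F x e\<bar> \<le> 2 * sqrt 2 * exp (2 * h * m) * B"
        using Rpos Zpos[of x] by (simp add: abs_mult)
    qed
    fix e
    define b g a where "b = - 2 * (cosh y * cos e * cos f)" and "g = - 2 * (sinh y * sin e * sin f)"
      and "a = (cosh y)\<^sup>2 + (cos e)\<^sup>2 + (cos f)\<^sup>2 - 2"
    have R_eq: "R x e = 2 * h * sqrt ((cosh x)\<^sup>2 + b * cosh x + g * sinh x + a)" for x
      by (simp add: R_def sqdist_expand b_def g_def a_def algebra_simps)
    from tendsto_mult[OF tendsto_const[of "2 * h"] sqrt_cosh_asymptotic(1)[of b g a]]
    have ZR: "((\<lambda>x. Z x - R x e) \<longlongrightarrow> 2 * h * (- (b + g) / 2)) at_top"
      by (simp add: Z_def R_eq right_diff_distrib)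
    have ZdR: "((\<lambda>x. Z x / R x e) \<longlongrightarrow> 1) at_top"
      using h sqrt_cosh_asymptotic(2)[of b g a] by (simp add: Z_def R_eq)
    have Rlim: "filterlim (\<lambda>x. R x e) at_top at_top"
    proof -
      have "filterlim (\<lambda>x. - (Z x - R x e) + Z x) at_top at_top"
        by (rule filterlim_tendsto_add_at_top[OF tendsto_minus[OF ZR] Zlim])
      then show ?thesis by simp
    qed
    have "((\<lambda>x. H (R x e) * sqrt (Z x / R x e) * exp (Z x - R x e) * u e)
        \<longlongrightarrow> sqrt (pi / 2) * sqrt 1 * exp (2 * h * (- (b + g) / 2)) * u e) at_top"
      by (intro tendsto_mult tendsto_const tendsto_exp tendsto_real_sqrt ZR ZdR filterlim_compose[OF Hlim Rlim])
    also have "sqrt (pi / 2) * sqrt 1 * exp (2 * h * (- (b + g) / 2)) * u e = sqrt (pi / 2) * (kernel_I h f y e * u e)"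
      by (simp add: kernel_I_def b_def g_def algebra_simps)
    finally have "((\<lambda>x. H (R x e) * sqrt (Z x / R x e) * exp (Z x - R x e) * u e)
        \<longlongrightarrow> sqrt (pi / 2) * (kernel_I h f y e * u e)) at_top" .
    moreover have "\<forall>\<^sub>F x in at_top. H (R x e) * sqrt (Z x / R x e) * exp (Z x - R x e) * u e = F x e"
      using filterlim_at_top_dense[THEN iffD1, rule_format, OF Rlim, of 0] eventually_ge_at_top[of "\<bar>y\<bar> + 1"]
    proof eventually_elim
      case (elim x)
      then show ?case
        using split[of x e] max_absorb1[of "\<bar>y\<bar> + 1" x] by (simp add: F_def mult.assoc)
    qed
    ultimately show "((\<lambda>x. F x e) \<longlongrightarrow> sqrt (pi / 2) * (kernel_I h f y e * u e)) at_top"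
      by (rule Lim_transform_eventually)
  qed
  moreover have "\<forall>\<^sub>F x in at_top. integral {-pi..pi} (F x)
      = sqrt (Z x) * exp (Z x) * integral {-pi..pi} (\<lambda>e. kernel_K h y f x e * u e)"
  proof (rule eventually_mono[OF eventually_ge_at_top[of "\<bar>y\<bar> + 1"]])
    fix x assume "\<bar>y\<bar> + 1 \<le> x"
    then have "max x (\<bar>y\<bar> + 1) = x" by (rule max_absorb1)
    then have "F x = (\<lambda>e. sqrt (Z x) * exp (Z x) * (kernel_K h y f x e * u e))"
      unfolding F_def by (simp only:)
    then show "integral {-pi..pi} (F x)
      = sqrt (Z x) * exp (Z x) * integral {-pi..pi} (\<lambda>e. kernel_K h y f x e * u e)"
      by (simp only: integral_mult_right)
  qed
  ultimately have "((\<lambda>x. sqrt (Z x) * exp (Z x) * integral {-pi..pi} (\<lambda>e. kernel_K h y f x e * u e))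
      \<longlongrightarrow> integral {-pi..pi} (\<lambda>e. sqrt (pi / 2) * (kernel_I h f y e * u e))) at_top"
    by (rule Lim_transform_eventually)
  then show ?thesis by (simp add: Z_def)
qed

section \<open>Uniqueness of dominant and recessive solutions\<close>

lemma hill_wronskian_constant:
  assumes u: "hill_solution_on S Q u u'" and v: "hill_solution_on S Q v v'" and S: "is_interval S" "open S"
    and xy: "x \<in> S" "y \<in> S"
  shows "u x * v' x - u' x * v x = u y * v' y - u' y * v y"
proof -
  have "((\<lambda>x. u x * v' x - u' x * v x) has_real_derivative 0) (at x within S)" if "x \<in> S" for x
  proof -
    have "((\<lambda>x. u x * v' x - u' x * v x) has_real_derivative
        (u x * (Q x * v x) + u' x * v' x) - (u' x * v' x + Q x * u x * v x)) (at x)"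
      by (intro DERIV_diff DERIV_mult' hill_solution_onD[OF u that] hill_solution_onD[OF v that])
    then show ?thesis by (simp add: has_field_derivative_at_within)
  qed
  then have "\<exists>k. \<forall>x\<in>S. u x * v' x - u' x * v x = k"
    using S is_interval_convex by (intro has_field_derivative_zero_constant) auto
  then show ?thesis using xy by metis
qed

lemma hill_proportional:
  assumes u: "hill_solution_on S Q u u'" and v: "hill_solution_on S Q v v'"
    and S: "is_interval S" "open S" and Q: "continuous_on S Q"
    and X: "X \<in> S" "v X \<noteq> 0" and y: "y \<in> S" "u y * v' y - u' y * v y = 0" and x: "x \<in> S"
  shows "u x = u X / v X * v x"
proof -
  define a where "a = u X / v X"
  have W: "u X * v' X - u' X * v X = 0"
    using hill_wronskian_constant[OF u v S X(1) y(1)] y(2) by simp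
  have sol: "hill_solution_on S Q (\<lambda>x. a * v x + 0 * v x) (\<lambda>x. a * v' x + 0 * v' x)"
    by (rule hill_solution_on_lincomb[OF v v])
  have "u x = a * v x + 0 * v x"
    by (rule hill_solution_unique(1)[OF u sol S(1) Q X(1) _ _ x]) (use X W in \<open>auto simp: a_def field_simps\<close>)
  then show ?thesis by (simp add: a_def)
qed

lemma tendsto_eventually_nonzero:
  fixes \<phi> v :: "real \<Rightarrow> real"
  assumes "((\<lambda>x. \<phi> x * v x) \<longlongrightarrow> c) at_top" "c \<noteq> 0"
  shows "\<forall>\<^sub>F x in at_top. v x \<noteq> 0"
  using tendsto_imp_eventually_ne[OF assms] by eventually_elim auto

text \<open>Growth alone leaves a recessive summand undetermined. Parity removes it: at 0 both
  solutions vanish or both derivatives vanish, so the Wronskian is 0 and the solutions are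
  proportional; the limits fix the factor.\<close>

lemma hill_dominant_unique:
  assumes v: "hill_solution_on UNIV Q v v'" "\<And>x. v (- x) = s * v x"
    and d: "hill_solution_on UNIV Q d d'" "\<And>x. d (- x) = s * d x"
    and s: "s = 1 \<or> s = -1" and Q: "continuous_on UNIV Q"
    and lim: "((\<lambda>x. \<phi> x * v x) \<longlongrightarrow> c) at_top" "c \<noteq> 0" "((\<lambda>x. \<phi> x * d x) \<longlongrightarrow> c') at_top"
  shows "d x = c' / c * v x"
proof -
  obtain X where X: "v X \<noteq> 0"
    using eventually_happens[OF tendsto_eventually_nonzero[OF lim(1,2)]] by auto
  have "v' 0 = - s * v' 0" "d' 0 = - s * d' 0"
    using has_real_derivative_even_odd[of v v' 0 s 0] has_real_derivative_even_odd[of d d' 0 s 0]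
      hill_solution_onD(1)[OF v(1) UNIV_I] hill_solution_onD(1)[OF d(1) UNIV_I] v(2) d(2) by auto
  moreover have "v 0 = s * v 0" "d 0 = s * d 0" using v(2)[of 0] d(2)[of 0] by auto
  ultimately have "d 0 * v' 0 - d' 0 * v 0 = 0" using s by auto
  then have eq: "d x = d X / v X * v x" for x
    by (rule hill_proportional[OF d(1) v(1) is_interval_univ open_UNIV Q UNIV_I X UNIV_I _ UNIV_I])
  have "((\<lambda>x. d X / v X * (\<phi> x * v x)) \<longlongrightarrow> d X / v X * c) at_top"
    by (intro tendsto_mult tendsto_const lim)
  moreover have "(\<lambda>x. d X / v X * (\<phi> x * v x)) = (\<lambda>x. \<phi> x * d x)" by (subst eq) (simp add: mult_ac)
  ultimately have "d X / v X * c = c'"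
    using tendsto_unique[OF trivial_limit_at_top_linorder _ lim(3)] by simp
  then have "d X / v X = c' / c" using lim(2) by (simp add: field_simps)
  then show ?thesis using eq[of x] by simp
qed

text \<open>If \<open>d / v\<close> converges and \<open>v\<close> decays, then the Wronskian vanishes, since
  \<open>\<bar>(d / v)'\<bar> = \<bar>W\<bar> / v\<^sup>2 \<ge> \<bar>W\<bar>\<close> eventually.\<close>

lemma hill_recessive_unique:
  assumes v: "hill_solution_on {R<..} Q v v'" and d: "hill_solution_on {R<..} Q d d'"
    and Q: "continuous_on {R<..} Q" and \<phi>: "filterlim \<phi> at_top at_top"
    and lim: "((\<lambda>x. \<phi> x * v x) \<longlongrightarrow> c) at_top" "c \<noteq> 0" "((\<lambda>x. \<phi> x * d x) \<longlongrightarrow> c') at_top"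
    and x: "x > R"
  shows "d x = c' / c * v x"
proof -
  have S: "is_interval {R<..}" "open {R<..}" by auto
  define W where "W = d (R + 1) * v' (R + 1) - d' (R + 1) * v (R + 1)"
  have Wx: "d t * v' t - d' t * v t = W" if "t > R" for t
    unfolding W_def by (rule hill_wronskian_constant[OF d v S]) (use that in auto)
  have v0: "(v \<longlongrightarrow> 0) at_top"
  proof -
    have "((\<lambda>x. inverse (\<phi> x) * (\<phi> x * v x)) \<longlongrightarrow> 0 * c) at_top"
      using filterlim_compose[OF tendsto_inverse_0_at_top[OF \<phi>] filterlim_ident] lim(1) by (intro tendsto_mult) auto
    moreover have "\<forall>\<^sub>F x in at_top. inverse (\<phi> x) * (\<phi> x * v x) = v x"
      using filterlim_at_top_dense[THEN iffD1, rule_format, OF \<phi>, of 0] by eventually_elim simp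
    ultimately have "(v \<longlongrightarrow> 0 * c) at_top" by (rule Lim_transform_eventually)
    then show ?thesis by simp
  qed
  have ratio: "((\<lambda>x. d x / v x) \<longlongrightarrow> c' / c) at_top"
  proof -
    have "((\<lambda>x. (\<phi> x * d x) / (\<phi> x * v x)) \<longlongrightarrow> c' / c) at_top" by (intro tendsto_divide lim)
    moreover have "\<forall>\<^sub>F x in at_top. (\<phi> x * d x) / (\<phi> x * v x) = d x / v x"
      using filterlim_at_top_dense[THEN iffD1, rule_format, OF \<phi>, of 0] by eventually_elim simp
    ultimately show ?thesis by (rule Lim_transform_eventually)
  qed
  have "\<forall>\<^sub>F x in at_top. \<bar>v x\<bar> < 1"
    using order_tendstoD(2)[OF tendsto_rabs[OF v0], of 1] by simp
  then have "\<forall>\<^sub>F x in at_top. \<bar>v x\<bar> < 1 \<and> v x \<noteq> 0 \<and> x > R"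
    by (intro eventually_conj tendsto_eventually_nonzero[OF lim(1,2)] eventually_gt_at_top)
  then obtain X where X: "\<And>x. x \<ge> X \<Longrightarrow> \<bar>v x\<bar> < 1 \<and> v x \<noteq> 0 \<and> x > R" by (auto simp: eventually_at_top_linorder)
  have inc: "\<bar>W\<bar> \<le> \<bar>d (t + 1) / v (t + 1) - d t / v t\<bar>" if t: "t \<ge> X" for t
  proof -
    have "((\<lambda>x. d x / v x) has_real_derivative - W / (v s)\<^sup>2) (at s)" if "s \<ge> t" for s
    proof -
      have s: "v s \<noteq> 0" "s > R" using X[of s] that t by auto
      have "((\<lambda>x. d x / v x) has_real_derivative (d' s * v s - d s * v' s) / (v s * v s)) (at s)"
        using s hill_solution_onD(1)[OF d, of s] hill_solution_onD(1)[OF v, of s] by (intro DERIV_divide) auto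
      moreover have "d' s * v s - d s * v' s = - W" using Wx[OF s(2)] by simp
      ultimately show ?thesis by (simp add: power2_eq_square)
    qed
    then obtain z where z: "t < z" "d (t + 1) / v (t + 1) - d t / v t = (t + 1 - t) * (- W / (v z)\<^sup>2)"
      using MVT2[of t "t + 1" "\<lambda>x. d x / v x" "\<lambda>s. - W / (v s)\<^sup>2"] by auto
    have "\<bar>v z\<bar> < 1" "v z \<noteq> 0" using X[of z] z t by auto
    then have "0 < (v z)\<^sup>2" "(v z)\<^sup>2 \<le> 1" by (auto simp: abs_square_le_1)
    then have "\<bar>W\<bar> \<le> \<bar>W\<bar> / (v z)\<^sup>2" by (simp add: le_divide_eq mult_left_le)
    then show ?thesis using z by (simp add: abs_divide)
  qed
  have W0: "W = 0"
  proof -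
    have "filterlim (\<lambda>t::real. t + 1) at_top at_top" by real_asymp
    then have "((\<lambda>t. \<bar>d (t + 1) / v (t + 1) - d t / v t\<bar>) \<longlongrightarrow> \<bar>c' / c - c' / c\<bar>) at_top"
      using filterlim_compose[OF ratio] by (intro tendsto_rabs tendsto_diff ratio) auto
    then have "\<bar>W\<bar> \<le> \<bar>c' / c - c' / c\<bar>"
      by (rule tendsto_lowerbound) (auto intro: eventually_mono[OF eventually_ge_at_top[of X]] inc)
    then show ?thesis by simp
  qed
  have XR: "X > R" "v X \<noteq> 0" using X[of X] by auto
  have eq: "d t = d X / v X * v t" if "t > R" for t
    by (rule hill_proportional[OF d v S Q _ XR(2), of X]) (use XR Wx W0 that in auto)
  have "\<forall>\<^sub>F t in at_top. d t / v t = d X / v X"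
    using eventually_ge_at_top[of X]
  proof eventually_elim
    case (elim t)
    then show ?case using eq[of t] X[of t] by auto
  qed
  then have "((\<lambda>t. d t / v t) \<longlongrightarrow> d X / v X) at_top" by (rule tendsto_eventually)
  then have "d X / v X = c' / c" using tendsto_unique[OF trivial_limit_at_top_linorder _ ratio] by blast
  then show ?thesis using eq[OF x] by simp
qed

section \<open>The defining conditions of the radial functions as limits\<close>

lemma modified_mathieu_solution_iff:
  "modified_mathieu_solution lam (- (h\<^sup>2)) u \<longleftrightarrow> (\<exists>u'. hill_solution_on UNIV (separated_potential h lam) u u')"
proof
  assume "modified_mathieu_solution lam (- (h\<^sup>2)) u"
  then obtain u' u'' where u: "\<And>x. (u has_real_derivative u' x) (at x)"
    "\<And>x. (u' has_real_derivative u'' x) (at x)"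
    "\<And>x. - u'' x + (lam - 2 * (- (h\<^sup>2)) * cosh (2 * x)) * u x = 0"
    unfolding modified_mathieu_solution_def by blast
  have "u'' x = separated_potential h lam x * u x" for x
    using u(3)[of x] by (simp add: separated_potential_def algebra_simps)
  then show "\<exists>u'. hill_solution_on UNIV (separated_potential h lam) u u'"
    using u(1,2) unfolding hill_solution_on_def by metis
next
  assume "\<exists>u'. hill_solution_on UNIV (separated_potential h lam) u u'"
  then obtain u' where u: "hill_solution_on UNIV (separated_potential h lam) u u'" by blast
  show "modified_mathieu_solution lam (- (h\<^sup>2)) u"
    unfolding modified_mathieu_solution_def
    by (intro exI[of _ u'] exI[of _ "\<lambda>x. separated_potential h lam x * u x"])
      (use hill_solution_onD[OF u UNIV_I] in \<open>auto simp: separated_potential_def algebra_simps\<close>)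
qed

text \<open>A factor \<phi> that normalizes the comparison function turns asymptotic equivalence
  into an ordinary limit. For the Bessel functions \<phi> and c are the same for all orders.\<close>

lemma asymp_equiv_iff_scaled_limit:
  fixes v A \<phi> :: "real \<Rightarrow> real"
  assumes A: "((\<lambda>x. \<phi> x * A x) \<longlongrightarrow> c) at_top" "c \<noteq> 0"
  shows "v \<sim>[at_top] A \<longleftrightarrow> ((\<lambda>x. \<phi> x * v x) \<longlongrightarrow> c) at_top"
proof -
  have A0: "\<forall>\<^sub>F x in at_top. \<phi> x * A x \<noteq> 0" by (rule tendsto_imp_eventually_ne[OF A])
  show ?thesis
  proof
    assume "v \<sim>[at_top] A"
    then have "((\<lambda>x. (if v x = 0 \<and> A x = 0 then 1 else v x / A x) * (\<phi> x * A x)) \<longlongrightarrow> 1 * c) at_top"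
      by (intro tendsto_mult A asymp_equivD)
    moreover have "\<forall>\<^sub>F x in at_top. (if v x = 0 \<and> A x = 0 then 1 else v x / A x) * (\<phi> x * A x) = \<phi> x * v x"
      using A0 by eventually_elim auto
    ultimately have "((\<lambda>x. \<phi> x * v x) \<longlongrightarrow> 1 * c) at_top" by (rule Lim_transform_eventually)
    then show "((\<lambda>x. \<phi> x * v x) \<longlongrightarrow> c) at_top" by simp
  next
    assume "((\<lambda>x. \<phi> x * v x) \<longlongrightarrow> c) at_top"
    then have "((\<lambda>x. (\<phi> x * v x) / (\<phi> x * A x)) \<longlongrightarrow> c / c) at_top" by (intro tendsto_divide A)
    moreover have "\<forall>\<^sub>F x in at_top. (\<phi> x * v x) / (\<phi> x * A x) = v x / A x"
      using A0 by eventually_elim auto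
    ultimately have "((\<lambda>x. v x / A x) \<longlongrightarrow> c / c) at_top" by (rule Lim_transform_eventually)
    then show "v \<sim>[at_top] A" using A(2) by (intro asymp_equivI') simp
  qed
qed

lemma asymp_equiv_complex_of_real_iff:
  "(\<lambda>x. complex_of_real (v x)) \<sim>[F] (\<lambda>x. complex_of_real (A x)) \<longleftrightarrow> v \<sim>[F] A"
proof -
  have "(\<lambda>x. if complex_of_real (v x) = 0 \<and> complex_of_real (A x) = 0 then 1
      else complex_of_real (v x) / complex_of_real (A x))
    = (\<lambda>x. complex_of_real (if v x = 0 \<and> A x = 0 then 1 else v x / A x))" by auto
  then show ?thesis unfolding asymp_equiv_def using tendsto_of_real_iff[where 'a = complex and c = 1]
    by (simp only: of_real_1)
qed

lemma asymp_bessel_I_iff: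
  assumes h: "h > 0"
  shows "(\<lambda>x. complex_of_real (v x)) \<sim>[at_top] (\<lambda>x. bessel_I n (complex_of_real (2 * h * cosh x))) \<longleftrightarrow>
    ((\<lambda>x. (sqrt (2 * h * cosh x) * exp (- (2 * h * cosh x))) * v x) \<longlongrightarrow> 1 / sqrt (2 * pi)) at_top"
proof -
  have "filterlim (\<lambda>x. 2 * h * cosh x) at_top at_top" using h by (intro filterlim_cosh_at_top) simp
  then have "((\<lambda>x. (sqrt (2 * h * cosh x) * exp (- (2 * h * cosh x))) * bessel_I_real n (2 * h * cosh x))
      \<longlongrightarrow> 1 / sqrt (2 * pi)) at_top"
    by (rule filterlim_compose[OF bessel_I_real_asymptotic])
  from asymp_equiv_iff_scaled_limit[OF this, of v] show ?thesis
    unfolding bessel_I_eq_integral asymp_equiv_complex_of_real_iff by simp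
qed

lemma asymp_bessel_K_iff:
  assumes h: "h > 0"
  shows "v \<sim>[at_top] (\<lambda>x. bessel_K n (2 * h * cosh x)) \<longleftrightarrow>
    ((\<lambda>x. (sqrt (2 * h * cosh x) * exp (2 * h * cosh x)) * v x) \<longlongrightarrow> sqrt (pi / 2)) at_top"
proof -
  have "filterlim (\<lambda>x. 2 * h * cosh x) at_top at_top" using h by (intro filterlim_cosh_at_top) simp
  then have "((\<lambda>x. (sqrt (2 * h * cosh x) * exp (2 * h * cosh x)) * bessel_K n (2 * h * cosh x))
      \<longlongrightarrow> sqrt (pi / 2)) at_top"
    by (rule filterlim_compose[OF bessel_K_asymptotic])
  from asymp_equiv_iff_scaled_limit[OF this, of v] show ?thesis by simp
qed

lemma periodic_continuous_bounded:
  fixes u :: "real \<Rightarrow> real"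
  assumes u: "continuous_on UNIV u" and per: "periodic_fun_simple u (2 * pi)"
  obtains B where "\<And>e. \<bar>u e\<bar> \<le> B"
proof -
  interpret P: periodic_fun_simple u "2 * pi" by fact
  have "bounded (u ` {0..2 * pi})"
    by (intro compact_imp_bounded compact_continuous_image continuous_on_subset[OF u]) auto
  then obtain B where B: "\<And>e. e \<in> {0..2 * pi} \<Longrightarrow> \<bar>u e\<bar> \<le> B" unfolding bounded_iff real_norm_def by blast
  have "\<bar>u e\<bar> \<le> B" for e
  proof -
    define m where "m = \<lfloor>e / (2 * pi)\<rfloor>"
    have "of_int m \<le> e / (2 * pi)" "e / (2 * pi) < of_int m + 1" unfolding m_def by linarith+
    then have "of_int m * (2 * pi) \<le> e" "e < (of_int m + 1) * (2 * pi)" by (simp_all add: field_simps)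
    then have "\<bar>u (e - of_int m * (2 * pi))\<bar> \<le> B" by (intro B) (auto simp: algebra_simps)
    then show ?thesis by (simp add: P.minus_of_int)
  qed
  then show ?thesis using that by blast
qed

definition dominant_modified :: "real \<Rightarrow> real \<Rightarrow> real \<Rightarrow> (real \<Rightarrow> real) \<Rightarrow> bool" where
  "dominant_modified h lam s v \<longleftrightarrow> modified_mathieu_solution lam (- (h\<^sup>2)) v \<and> (\<forall>x. v (- x) = s * v x) \<and>
    ((\<lambda>x. (sqrt (2 * h * cosh x) * exp (- (2 * h * cosh x))) * v x) \<longlongrightarrow> 1 / sqrt (2 * pi)) at_top"

definition recessive_modified :: "real \<Rightarrow> real \<Rightarrow> (real \<Rightarrow> real) \<Rightarrow> bool" where
  "recessive_modified h lam v \<longleftrightarrow> modified_mathieu_solution lam (- (h\<^sup>2)) v \<and>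
    ((\<lambda>x. (sqrt (2 * h * cosh x) * exp (2 * h * cosh x)) * v x) \<longlongrightarrow> sqrt (pi / 2)) at_top"

section \<open>The product formula for a single angular function\<close>

locale angular_function =
  fixes h lam s :: real and u :: "real \<Rightarrow> real"
  assumes h: "h > 0" and s: "s = 1 \<or> s = -1"
    and sol: "mathieu_solution lam (- (h\<^sup>2)) u" and parity: "\<And>x. u (- x) = s * u x"
    and per: "periodic_fun_simple u (2 * pi)" and nz: "\<exists>x. u x \<noteq> 0"
begin

sublocale P: periodic_fun_simple u "2 * pi" by (rule per)

lemma hill_angular:
  obtains u' where "hill_solution_on UNIV (\<lambda>e. - (lam + 2 * h\<^sup>2 * cos (2 * e))) u u'" "u' pi = u' (- pi)"
proof -
  obtain u' u'' where u: "\<And>x. (u has_real_derivative u' x) (at x)"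
    "\<And>x. (u' has_real_derivative u'' x) (at x)"
    "\<And>x. u'' x + (lam - 2 * (- (h\<^sup>2)) * cos (2 * x)) * u x = 0"
    using sol unfolding mathieu_solution_def by blast
  have "u'' x = - (lam + 2 * h\<^sup>2 * cos (2 * x)) * u x" for x
    using u(3)[of x] by (simp add: algebra_simps)
  then have 1: "hill_solution_on UNIV (\<lambda>e. - (lam + 2 * h\<^sup>2 * cos (2 * e))) u u'"
    using u(1,2) unfolding hill_solution_on_def by metis
  have "((\<lambda>x. u (x + 2 * pi)) has_real_derivative u' (- pi + 2 * pi)) (at (- pi))"
    using u(1)[of "- pi + 2 * pi"] by (subst DERIV_shift[symmetric])
  then have "(u has_real_derivative u' pi) (at (- pi))" by (simp add: P.plus_1)
  then have "u' pi = u' (- pi)" using DERIV_unique u(1) by blast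
  then show ?thesis using that 1 by blast
qed

lemma u_cont: "continuous_on A u"
proof -
  obtain u' where "hill_solution_on UNIV (\<lambda>e. - (lam + 2 * h\<^sup>2 * cos (2 * e))) u u'" by (rule hill_angular)
  then show ?thesis using hill_solution_on_continuous(1) continuous_on_subset by blast
qed

lemma u_pi: "u pi = u (- pi)"
  using P.plus_1[of "- pi"] by simp

definition int_I where "int_I f x = integral {-pi..pi} (\<lambda>e. kernel_I h f x e * u e)" for f x :: real

definition int_K where "int_K y f x = integral {-pi..pi} (\<lambda>e. kernel_K h y f x e * u e)" for y f x :: real

lemma int_I_hill: "\<exists>w'. hill_solution_on UNIV (separated_potential h lam) (int_I f) w'"
proof -
  obtain u' where "hill_solution_on UNIV (\<lambda>e. - (lam + 2 * h\<^sup>2 * cos (2 * e))) u u'" "u' pi = u' (- pi)"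
    by (rule hill_angular)
  from integral_kernel_I[OF this(1) u_pi this(2)] show ?thesis by (simp add: int_I_def[abs_def])
qed

lemma int_K_hill: "\<exists>w'. hill_solution_on {\<bar>y\<bar><..} (separated_potential h lam) (int_K y f) w'"
proof -
  obtain u' where "hill_solution_on UNIV (\<lambda>e. - (lam + 2 * h\<^sup>2 * cos (2 * e))) u u'" "u' pi = u' (- pi)"
    by (rule hill_angular)
  from integral_kernel_K[OF h this(1) u_pi this(2)] show ?thesis by (simp add: int_K_def[abs_def])
qed

lemma int_I_parity: "int_I f (- x) = s * int_I f x"
proof -
  have "int_I f (- x) = integral {-pi..pi} (\<lambda>e. kernel_I h f (- x) (- e) * u (- e))"
    unfolding int_I_def using Henstock_Kurzweil_Integration.integral_reflect_real[of pi "- pi" "\<lambda>e. kernel_I h f (- x) e * u e"] by simp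
  also have "\<dots> = integral {-pi..pi} (\<lambda>e. s * (kernel_I h f x e * u e))"
    by (simp add: kernel_I_def parity mult_ac)
  finally show ?thesis by (simp add: int_I_def)
qed

lemma int_I_limit:
  "((\<lambda>x. (sqrt (2 * h * cosh x) * exp (- (2 * h * cosh x))) * int_I f x) \<longlongrightarrow> sqrt (2 * pi) * u f) at_top"
proof -
  obtain B where "\<And>e. \<bar>u e\<bar> \<le> B" using periodic_continuous_bounded[OF u_cont per] by blast
  from kernel_I_asymptotic[OF h u_cont P.plus_1 this] show ?thesis by (simp add: int_I_def)
qed

lemma int_K_limit:
  "((\<lambda>x. (sqrt (2 * h * cosh x) * exp (2 * h * cosh x)) * int_K y f x) \<longlongrightarrow> sqrt (pi / 2) * int_I f y) at_top"
proof -
  obtain B where "\<And>e. \<bar>u e\<bar> \<le> B" using periodic_continuous_bounded[OF u_cont per] by blast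
  from kernel_K_asymptotic[OF h u_cont this] show ?thesis by (simp add: int_K_def int_I_def)
qed

abbreviation is_I :: "(real \<Rightarrow> real) \<Rightarrow> bool" where "is_I \<equiv> dominant_modified h lam s"

abbreviation is_K :: "(real \<Rightarrow> real) \<Rightarrow> bool" where "is_K \<equiv> recessive_modified h lam"

lemma is_I_unique:
  assumes "is_I v" "is_I w" shows "v = w"
proof
  fix x
  obtain v' w' where *: "hill_solution_on UNIV (separated_potential h lam) v v'"
    "hill_solution_on UNIV (separated_potential h lam) w w'"
    using assms unfolding dominant_modified_def modified_mathieu_solution_iff by blast
  have "v x = (1 / sqrt (2 * pi)) / (1 / sqrt (2 * pi)) * w x"
    by (rule hill_dominant_unique[OF *(2) _ *(1) _ s continuous_on_separated_potential,
          where \<phi> = "\<lambda>x. sqrt (2 * h * cosh x) * exp (- (2 * h * cosh x))"])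
      (use assms in \<open>auto simp: dominant_modified_def\<close>)
  then show "v x = w x" by simp
qed

lemma filterlim_recessive_factor: "filterlim (\<lambda>x. sqrt (2 * h * cosh x) * exp (2 * h * cosh x)) at_top at_top"
  using h by real_asymp

lemma is_K_unique:
  assumes "is_K v" "is_K w" shows "v = w"
proof
  fix x
  obtain v' w' where *: "hill_solution_on UNIV (separated_potential h lam) v v'"
    "hill_solution_on UNIV (separated_potential h lam) w w'"
    using assms unfolding recessive_modified_def modified_mathieu_solution_iff by blast
  have "v x = sqrt (pi / 2) / sqrt (pi / 2) * w x"
    by (rule hill_recessive_unique[where R = "x - 1", OF hill_solution_on_subset[OF *(2)] hill_solution_on_subset[OF *(1)]
        continuous_on_separated_potential filterlim_recessive_factor])
      (use assms in \<open>auto simp: recessive_modified_def\<close>)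
  then show "v x = w x" by simp
qed

text \<open>An angle f0 with u f0 nonzero allows normalizing the plane wave integral, which yields
  the dominant solution v. For any other f the integral is a solution of the same parity with
  leading coefficient sqrt (2 pi) u f against 1 / sqrt (2 pi) for v; the quotient is 2 pi u
  f.\<close>

lemma int_I_eq:
  obtains v where "is_I v" "\<And>f x. int_I f x = 2 * pi * v x * u f"
proof -
  obtain f0 where f0: "u f0 \<noteq> 0" using nz by blast
  define v where "v x = 1 / (2 * pi * u f0) * int_I f0 x" for x
  obtain w' where w': "hill_solution_on UNIV (separated_potential h lam) (int_I f0) w'" using int_I_hill by blast
  have vh: "hill_solution_on UNIV (separated_potential h lam) v (\<lambda>x. 1 / (2 * pi * u f0) * w' x)"
    using hill_solution_on_lincomb[OF w' w', of "1 / (2 * pi * u f0)" 0] by (simp add: v_def[abs_def])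
  have vp: "v (- x) = s * v x" for x by (simp add: v_def int_I_parity)
  have sq: "sqrt (2 * pi) / (2 * pi) = 1 / sqrt (2 * pi)"
    using real_sqrt_mult_self[of "2 * pi"] by (simp add: field_simps)
  have "((\<lambda>x. 1 / (2 * pi * u f0) * ((sqrt (2 * h * cosh x) * exp (- (2 * h * cosh x))) * int_I f0 x))
      \<longlongrightarrow> 1 / (2 * pi * u f0) * (sqrt (2 * pi) * u f0)) at_top"
    by (intro tendsto_mult tendsto_const int_I_limit)
  moreover have "1 / (2 * pi * u f0) * (sqrt (2 * pi) * u f0) = 1 / sqrt (2 * pi)"
    using f0 sq by simp
  ultimately have vl: "((\<lambda>x. (sqrt (2 * h * cosh x) * exp (- (2 * h * cosh x))) * v x) \<longlongrightarrow> 1 / sqrt (2 * pi)) at_top"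
    by (simp add: v_def mult_ac)
  have "int_I f x = 2 * pi * v x * u f" for f x
  proof -
    obtain d' where d': "hill_solution_on UNIV (separated_potential h lam) (int_I f) d'" using int_I_hill by blast
    have "int_I f x = (sqrt (2 * pi) * u f) / (1 / sqrt (2 * pi)) * v x"
      by (rule hill_dominant_unique[OF vh vp d' int_I_parity s continuous_on_separated_potential vl _ int_I_limit]) simp
    also have "(sqrt (2 * pi) * u f) / (1 / sqrt (2 * pi)) = 2 * pi * u f"
      using real_sqrt_mult_self[of "2 * pi"] by (simp add: mult_ac)
    finally show ?thesis by (simp add: mult_ac)
  qed
  moreover have "is_I v" unfolding dominant_modified_def modified_mathieu_solution_iff using vh vp vl by blast
  ultimately show ?thesis using that by blast
qed

text \<open>For fixed y0, f0 the integral is a solution for x > |y0| only; w continues its multiple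
  to the whole line from the data at |y0| + 1. For other y, f uniqueness of recessive solutions
  compares leading coefficients, and that of \<open>int_K y f\<close> is sqrt (pi / 2) times
  \<open>int_I f y\<close>, already known to be a product.\<close>

lemma int_K_eq:
  assumes v: "is_I v" "\<And>f x. int_I f x = 2 * pi * v x * u f"
  obtains w where "is_K w" "\<And>y f x. \<bar>y\<bar> < x \<Longrightarrow> int_K y f x = 2 * pi * v y * u f * w x"
proof -
  obtain f0 where f0: "u f0 \<noteq> 0" using nz by blast
  obtain y0 where y0: "v y0 \<noteq> 0"
  proof -
    have "\<forall>\<^sub>F x in at_top. v x \<noteq> 0"
      by (rule tendsto_eventually_nonzero[where c = "1 / sqrt (2 * pi)"]) (use v in \<open>auto simp: dominant_modified_def\<close>)
    then show ?thesis using that eventually_happens[of _ "at_top :: real filter"] by auto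
  qed
  define k where "k = 2 * pi * v y0 * u f0"
  have k: "k \<noteq> 0" using f0 y0 by (simp add: k_def)
  define G where "G x = 1 / k * int_K y0 f0 x" for x
  obtain g' where g': "hill_solution_on {\<bar>y0\<bar><..} (separated_potential h lam) (int_K y0 f0) g'" using int_K_hill by blast
  have Gh: "hill_solution_on {\<bar>y0\<bar><..} (separated_potential h lam) G (\<lambda>x. 1 / k * g' x)"
    using hill_solution_on_lincomb[OF g' g', of "1 / k" 0] by (simp add: G_def[abs_def])
  obtain w w' where w: "w (\<bar>y0\<bar> + 1) = G (\<bar>y0\<bar> + 1)" "w' (\<bar>y0\<bar> + 1) = 1 / k * g' (\<bar>y0\<bar> + 1)"
    "hill_solution_on UNIV (separated_potential h lam) w w'"
    using hill_initial_value[OF continuous_on_separated_potential] by blast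
  have wh: "hill_solution_on {\<bar>y0\<bar><..} (separated_potential h lam) w w'"
    by (rule hill_solution_on_subset[OF w(3)]) simp
  have wG: "w x = G x" if "x > \<bar>y0\<bar>" for x
    by (rule hill_solution_unique(1)[OF wh Gh _ continuous_on_separated_potential _ w(1,2)]) (use that in auto)
  have "((\<lambda>x. 1 / k * ((sqrt (2 * h * cosh x) * exp (2 * h * cosh x)) * int_K y0 f0 x))
      \<longlongrightarrow> 1 / k * (sqrt (pi / 2) * int_I f0 y0)) at_top"
    by (intro tendsto_mult tendsto_const int_K_limit)
  also have "1 / k * (sqrt (pi / 2) * int_I f0 y0) = sqrt (pi / 2)"
    using k v(2)[of f0 y0] by (simp add: k_def)
  finally have "((\<lambda>x. 1 / k * ((sqrt (2 * h * cosh x) * exp (2 * h * cosh x)) * int_K y0 f0 x))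
      \<longlongrightarrow> sqrt (pi / 2)) at_top" .
  moreover have "\<forall>\<^sub>F x in at_top. 1 / k * ((sqrt (2 * h * cosh x) * exp (2 * h * cosh x)) * int_K y0 f0 x)
      = (sqrt (2 * h * cosh x) * exp (2 * h * cosh x)) * w x"
    using eventually_gt_at_top[of "\<bar>y0\<bar>"] by eventually_elim (simp add: wG G_def)
  ultimately have wl: "((\<lambda>x. (sqrt (2 * h * cosh x) * exp (2 * h * cosh x)) * w x) \<longlongrightarrow> sqrt (pi / 2)) at_top"
    by (rule Lim_transform_eventually)
  have "int_K y f x = 2 * pi * v y * u f * w x" if x: "\<bar>y\<bar> < x" for y f x
  proof -
    obtain d' where d': "hill_solution_on {\<bar>y\<bar><..} (separated_potential h lam) (int_K y f) d'" using int_K_hill by blast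
    have "int_K y f x = (sqrt (pi / 2) * int_I f y) / sqrt (pi / 2) * w x"
      by (rule hill_recessive_unique[OF hill_solution_on_subset[OF w(3)] d' continuous_on_separated_potential
            filterlim_recessive_factor wl _ int_K_limit x]) auto
    then show ?thesis by (simp add: v(2))
  qed
  moreover have "is_K w" unfolding recessive_modified_def modified_mathieu_solution_iff using w(3) wl by blast
  ultimately show ?thesis using that by blast
qed

lemma int_K_The:
  assumes "\<bar>y\<bar> < x"
  shows "int_K y f x = 2 * pi * (THE v. is_I v) y * u f * (THE w. is_K w) x"
proof -
  obtain v where v: "is_I v" "\<And>f x. int_I f x = 2 * pi * v x * u f"
    using int_I_eq by blast
  obtain w where w: "is_K w" "\<And>y f x. \<bar>y\<bar> < x \<Longrightarrow> int_K y f x = 2 * pi * v y * u f * w x"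
    using int_K_eq[OF v] by blast
  have "(THE v. is_I v) = v" "(THE w. is_K w) = w"
    using v(1) w(1) is_I_unique is_K_unique by blast+
  then show ?thesis using w(2)[OF assms] by simp
qed

end

section \<open>Expansion of the kernel into angular functions\<close>

lemma reduce_angle:
  fixes e :: real
  obtains x t and m :: int where "x \<in> {0..pi}" "t = 1 \<or> t = -1" "e = t * x + of_int m * (2 * pi)"
proof -
  define m where "m = \<lfloor>(e + pi) / (2 * pi)\<rfloor>"
  define y where "y = e - of_int m * (2 * pi)"
  have "of_int m \<le> (e + pi) / (2 * pi)" "(e + pi) / (2 * pi) < of_int m + 1" unfolding m_def by linarith+
  then have "of_int m * (2 * pi) \<le> e + pi" "e + pi < (of_int m + 1) * (2 * pi)" by (simp_all add: field_simps)
  then have "-pi \<le> y" "y \<le> pi" by (auto simp: y_def algebra_simps)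
  then show ?thesis
    by (intro that[of "\<bar>y\<bar>" "if y \<ge> 0 then 1 else -1" m]) (auto simp: y_def)
qed

text \<open>G is twice the even or odd part of the kernel in the angle. Its product with e n over
  [0, pi] is the integral of the kernel against e n over the full period, that is, 2 pi times the
  product of the three other functions; the squared norm of e n on [0, pi] is pi / 2, and the
  quotient is the factor 4.\<close>

lemma angular_expansion:
  fixes e :: "nat \<Rightarrow> real \<Rightarrow> real" and neu :: bool
  defines "s \<equiv> if neu then 1 else - 1 :: real"
  assumes h: "h > 0"
    and e: "\<And>n. mathieu_sturm_liouville.eigenfunction h neu (lam n) (e n)"
    and N: "\<And>n. integral {0..2 * pi} (\<lambda>x. (e n x)\<^sup>2) = pi"
    and lam: "inj lam" "range lam = mathieu_sturm_liouville.eigenvalues h neu"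
    and yx: "\<bar>y\<bar> < x"
  shows "(\<lambda>n. 4 * ((THE v. dominant_modified h (lam n) s v) y * e n \<eta> *
      (THE w. recessive_modified h (lam n) w) x * e n f))
    sums (kernel_K h y f x \<eta> + s * kernel_K h y f x (- \<eta>))"
proof -
  interpret M: mathieu_sturm_liouville h neu .
  have af: "angular_function h (lam n) s (e n)" for n
    using e[of n] h unfolding M.eigenfunction_def
    by (intro angular_function.intro) (auto simp: s_def even_fun_def odd_fun_def split: if_splits)
  note par = angular_function.parity[OF af] and per = angular_function.per[OF af]
    and ec = angular_function.u_cont[OF af]
  define g where "g = kernel_K h y f x"
  define G where "G \<eta> = g \<eta> + s * g (- \<eta>)" for \<eta>
  have s1: "s = 1 \<or> s = -1" "s * s = 1" by (auto simp: s_def)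
  note dg = has_real_derivative_kernel_K_e[OF h yx, of f]
  have gc: "continuous_on A g" for A
    unfolding g_def using dg(1) by (auto intro!: continuous_at_imp_continuous_on DERIV_isCont)
  have pg: "periodic_fun_simple g (2 * pi)" "periodic_fun_simple G (2 * pi)"
  proof -
    show 1: "periodic_fun_simple g (2 * pi)" by unfold_locales (simp add: g_def kernel_K_periodic)
    interpret P: periodic_fun_simple g "2 * pi" by (rule 1)
    show "periodic_fun_simple G (2 * pi)"
      using P.minus_1 by unfold_locales (simp add: G_def P.plus_1)
  qed
  interpret PG: periodic_fun_simple G "2 * pi" by (rule pg(2))
  have Gpar: "G (- \<eta>) = s * G \<eta>" for \<eta> using s1 by (auto simp: G_def)
  define G' where "G' \<eta> = kernel_K_e h y f x \<eta> - s * kernel_K_e h y f x (- \<eta>)" for \<eta>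
  define G'' where "G'' \<eta> = kernel_K_ee h y f x \<eta> + s * kernel_K_ee h y f x (- \<eta>)" for \<eta>
  have refl: "((\<lambda>\<eta>. F (- \<eta>)) has_real_derivative - F' (- \<eta>)) (at \<eta>)"
    if "\<And>\<eta>. (F has_real_derivative F' \<eta>) (at \<eta>)" for F F' :: "real \<Rightarrow> real" and \<eta>
  proof -
    have "((\<lambda>x. - x) has_real_derivative -1) (at \<eta>)" by (auto intro!: derivative_eq_intros)
    from DERIV_chain2[where g = "\<lambda>x. - x", OF that this] show ?thesis by simp
  qed
  have dG: "(G has_real_derivative G' \<eta>) (at \<eta>)" for \<eta>
    using DERIV_add[OF dg(1) DERIV_cmult[OF refl[OF dg(1)], of s]]
    by (simp add: G_def[abs_def] G'_def g_def)
  have dG': "(G' has_real_derivative G'' \<eta>) (at \<eta>)" for \<eta>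
    using DERIV_diff[OF dg(2) DERIV_cmult[OF refl[OF dg(2)], of s]]
    by (simp add: G'_def[abs_def] G''_def)
  \<comment> \<open>The right side for which G solves the boundary value problem; its continuity
    rests on that of the second angular derivative of the kernel.\<close>
  define F where "F \<eta> = M.V \<eta> * G \<eta> - G'' \<eta>" for \<eta>
  have Gc: "continuous_on A G" for A
    using dG by (auto intro!: continuous_at_imp_continuous_on DERIV_isCont)
  have Fc: "M.cont F"
  proof -
    have "continuous_on {0..pi} (\<lambda>\<eta>. kernel_K_ee h y f x (- \<eta>))"
      by (rule continuous_on_compose2[OF continuous_on_kernel_K_ee[OF h yx, of UNIV]
            continuous_on_minus[OF continuous_on_id]]) auto
    then show ?thesis unfolding F_def G''_def
      by (intro continuous_intros Gc M.V_cont continuous_on_kernel_K_ee[OF h yx])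
  qed
  have "M.bc G G'"
    using kernel_K_periodic[of h y f x "- pi"]
    by (auto simp: M.bc_def G_def G'_def s_def g_def)
  then have sl: "M.sl G G' F" using dG dG' by (simp add: M.sl_def F_def)
  have ip_e: "M.ip (e n) (e n) = pi / 2" for n
  proof -
    interpret P: periodic_fun_simple "e n" "2 * pi" by (rule per)
    have c: "continuous_on UNIV (\<lambda>x. (e n x)\<^sup>2)" by (intro continuous_intros ec)
    have "pi = integral {0..0 + 2 * pi} (\<lambda>x. (e n x)\<^sup>2)" using N[of n] by simp
    also have "\<dots> = integral {-pi..pi} (\<lambda>x. (e n x)\<^sup>2)"
      by (rule integral_periodic_shift[OF c]) (simp add: P.plus_1)
    also have "\<dots> = integral {0..pi} (\<lambda>x. 2 * (e n x * e n x))"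
      using s1 by (subst integral_symmetric_interval[OF c]) (auto simp: par power_mult_distrib power2_eq_square)
    finally show ?thesis by (simp add: M.ip_def)
  qed
  have ip_G: "M.ip G (e n) = angular_function.int_K h (e n) y f x" for n
  proof -
    interpret A: angular_function h "lam n" s "e n" by (rule af)
    have c: "continuous_on UNIV (\<lambda>\<eta>. g \<eta> * e n \<eta>)" by (intro continuous_intros gc ec)
    have "A.int_K y f x = integral {0..pi} (\<lambda>\<eta>. g \<eta> * e n \<eta> + g (- \<eta>) * e n (- \<eta>))"
      unfolding A.int_K_def using integral_symmetric_interval[OF c] by (simp add: g_def)
    then show ?thesis by (simp add: M.ip_def G_def par algebra_simps)
  qed
  have main: "(\<lambda>n. 4 * ((THE v. dominant_modified h (lam n) s v) y * e n z *
      (THE w. recessive_modified h (lam n) w) x * e n f)) sums G z" if z: "z \<in> {0..pi}" for z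
  proof -
    have "(\<lambda>n. M.ip G (e n) / (pi / 2) * e n z) sums G z"
      by (rule M.eigenfunction_expansion_C2[OF e ip_e lam sl Fc z])
    moreover have "M.ip G (e n) / (pi / 2) * e n z = 4 * ((THE v. dominant_modified h (lam n) s v) y * e n z *
      (THE w. recessive_modified h (lam n) w) x * e n f)" for n
      unfolding ip_G angular_function.int_K_The[OF af yx] by simp
    ultimately show ?thesis by simp
  qed
  \<comment> \<open>The series is known on [0, pi]. Parity and period extend it to all angles: e n
    and G acquire the same sign \<tau>.\<close>
  obtain z t and m :: int where z: "z \<in> {0..pi}" "t = 1 \<or> t = -1" "\<eta> = t * z + of_int m * (2 * pi)"
    by (rule reduce_angle)
  define \<tau> where "\<tau> = (if t = 1 then 1 else s)"
  have "e n \<eta> = \<tau> * e n z" for n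
  proof -
    interpret P: periodic_fun_simple "e n" "2 * pi" by (rule per)
    have "e n \<eta> = e n (t * z)" unfolding z(3) by (rule P.plus_of_int)
    then show ?thesis using z(2) par[of n z] by (auto simp: \<tau>_def)
  qed
  moreover have "G \<eta> = \<tau> * G z"
  proof -
    have "G \<eta> = G (t * z)" unfolding z(3) by (rule PG.plus_of_int)
    then show ?thesis using z(2) Gpar[of z] by (auto simp: \<tau>_def)
  qed
  ultimately have "(\<lambda>n. 4 * ((THE v. dominant_modified h (lam n) s v) y * e n \<eta> *
      (THE w. recessive_modified h (lam n) w) x * e n f)) sums G \<eta>"
    using sums_mult[OF main[OF z(1)], of \<tau>] by (simp add: mult_ac)
  then show ?thesis by (simp add: G_def g_def)
qed

theorem theorem5p2:
  fixes \<xi> \<eta> \<xi>\<^sub>0 \<eta>\<^sub>0 k c q h r :: real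
    and ce se :: "nat \<Rightarrow> real \<Rightarrow> real"
  assumes "\<bar>\<xi>\<bar> < \<xi>\<^sub>0"
    and "k > 0" and "c > 0"
    and "q = - (1 / 4 * c\<^sup>2 * k\<^sup>2)"
    and "h = 1 / 2 * c * k"
    and "\<And>n. is_mathieu_ce n q (ce n)"
    and "\<And>n. n \<ge> 1 \<Longrightarrow> is_mathieu_se n q (se n)"
    and "r > 0"
    and "r\<^sup>2 = c\<^sup>2 * ((cosh \<xi> * cos \<eta> - cosh \<xi>\<^sub>0 * cos \<eta>\<^sub>0)\<^sup>2
                  + (sinh \<xi> * sin \<eta> - sinh \<xi>\<^sub>0 * sin \<eta>\<^sub>0)\<^sup>2)"
  shows "summable (\<lambda>n. mathieu_Ie n h \<xi> * ce n \<eta> * mathieu_Ke n h \<xi>\<^sub>0 * ce n \<eta>\<^sub>0) \<and>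
    summable (\<lambda>n. mathieu_Io (Suc n) h \<xi> * se (Suc n) \<eta> * mathieu_Ko (Suc n) h \<xi>\<^sub>0 * se (Suc n) \<eta>\<^sub>0) \<and>
    bessel_K 0 (k * r) =
      2 * (\<Sum>n. mathieu_Ie n h \<xi> * ce n \<eta> * mathieu_Ke n h \<xi>\<^sub>0 * ce n \<eta>\<^sub>0) +
      2 * (\<Sum>n. mathieu_Io (Suc n) h \<xi> * se (Suc n) \<eta> * mathieu_Ko (Suc n) h \<xi>\<^sub>0 * se (Suc n) \<eta>\<^sub>0)"
proof -
  have h: "h > 0" using assms(2,3) unfolding assms(5) by simp
  have q: "q = - (h\<^sup>2)" unfolding assms(4,5) by (simp add: power2_eq_square)
  define g where "g = kernel_K h \<xi> \<eta>\<^sub>0 \<xi>\<^sub>0"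
  interpret E: mathieu_sturm_liouville h True .
  interpret O: mathieu_sturm_liouville h False .
  have Ev: "E.eigenvalues = even_eigenvalues q"
    by (auto simp: E.eigenvalues_def E.eigenfunction_def even_eigenvalues_def q)
  have Ov: "O.eigenvalues = odd_eigenvalues q"
    by (auto simp: O.eigenvalues_def O.eigenfunction_def odd_eigenvalues_def q)
  define a where "a n = mathieu_a n q" for n
  \<comment> \<open>The odd eigenvalues are numbered from 1, so \<open>Suc n\<close> addresses entry
    n of the increasing enumeration.\<close>
  define b where "b n = mathieu_b (Suc n) q" for n
  have a_eq: "a = increasing_enum E.eigenvalues" by (simp add: a_def[abs_def] mathieu_a_def Ev)
  have b_eq: "b = increasing_enum O.eigenvalues" by (simp add: b_def[abs_def] mathieu_b_def Ov)
  have a: "inj a" "range a = E.eigenvalues"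
    unfolding a_eq using increasing_enum_props[OF E.infinite_eigenvalues E.finite_eigenvalues_below]
    by (auto simp: strict_mono_imp_inj_on)
  have b: "inj b" "range b = O.eigenvalues"
    unfolding b_eq using increasing_enum_props[OF O.infinite_eigenvalues O.finite_eigenvalues_below]
    by (auto simp: strict_mono_imp_inj_on)
  have nz: "\<exists>x. u x \<noteq> 0" if "integral {0..2 * pi} (\<lambda>x. (u x)\<^sup>2) = pi" for u :: "real \<Rightarrow> real"
  proof (rule ccontr)
    assume "\<not> (\<exists>x. u x \<noteq> 0)"
    then have "integral {0..2 * pi} (\<lambda>x. (u x)\<^sup>2) = 0" by simp
    then show False using that by simp
  qed
  have ce: "E.eigenfunction (a n) (ce n)" "integral {0..2 * pi} (\<lambda>x. (ce n x)\<^sup>2) = pi" for n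
    using assms(6)[of n] nz unfolding is_mathieu_ce_def E.eigenfunction_def a_def q by auto
  have se: "O.eigenfunction (b n) (se (Suc n))" "integral {0..2 * pi} (\<lambda>x. (se (Suc n) x)\<^sup>2) = pi" for n
    using assms(7)[of "Suc n"] nz unfolding is_mathieu_se_def O.eigenfunction_def b_def q by auto
  have Ie: "mathieu_Ie n h = (THE v. dominant_modified h (a n) 1 v)" for n
    unfolding mathieu_Ie_def asymp_bessel_I_iff[OF h]
    by (intro arg_cong[where f = The] ext) (simp add: dominant_modified_def even_fun_def a_def q)
  have Ke: "mathieu_Ke n h = (THE v. recessive_modified h (a n) v)" for n
    unfolding mathieu_Ke_def asymp_bessel_K_iff[OF h]
    by (intro arg_cong[where f = The] ext) (simp add: recessive_modified_def a_def q)
  have Io: "mathieu_Io (Suc n) h = (THE v. dominant_modified h (b n) (-1) v)" for n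
    unfolding mathieu_Io_def asymp_bessel_I_iff[OF h]
    by (intro arg_cong[where f = The] ext) (simp add: dominant_modified_def odd_fun_def b_def q)
  have Ko: "mathieu_Ko (Suc n) h = (THE v. recessive_modified h (b n) v)" for n
    unfolding mathieu_Ko_def asymp_bessel_K_iff[OF h]
    by (intro arg_cong[where f = The] ext) (simp add: recessive_modified_def b_def q)
  have even: "(\<lambda>n. 4 * (mathieu_Ie n h \<xi> * ce n \<eta> * mathieu_Ke n h \<xi>\<^sub>0 * ce n \<eta>\<^sub>0)) sums (g \<eta> + g (- \<eta>))"
    using angular_expansion[where neu = True, OF h ce a assms(1), of \<eta> \<eta>\<^sub>0] by (simp add: Ie Ke g_def)
  have odd: "(\<lambda>n. 4 * (mathieu_Io (Suc n) h \<xi> * se (Suc n) \<eta> * mathieu_Ko (Suc n) h \<xi>\<^sub>0 * se (Suc n) \<eta>\<^sub>0))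
      sums (g \<eta> - g (- \<eta>))"
    using angular_expansion[where neu = False and e = "\<lambda>n. se (Suc n)", OF h se b assms(1), of \<eta> \<eta>\<^sub>0]
    by (simp add: Io Ko g_def)
  have "bessel_K 0 (k * r) = g \<eta>"
  proof -
    have "r = sqrt (c\<^sup>2 * sqdist \<xi> \<eta>\<^sub>0 \<xi>\<^sub>0 \<eta>)"
      using assms(8,9) unfolding sqdist_eq by (metis real_sqrt_unique less_imp_le)
    then have "k * r = 2 * h * sqrt (sqdist \<xi> \<eta>\<^sub>0 \<xi>\<^sub>0 \<eta>)"
    proof -
      have "k * c = 2 * h" unfolding assms(5) by simp
      moreover have "k * r = k * c * sqrt (sqdist \<xi> \<eta>\<^sub>0 \<xi>\<^sub>0 \<eta>)"
        using \<open>r = _\<close> assms(3) by (simp add: real_sqrt_mult)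
      ultimately show ?thesis by (simp only:)
    qed
    then show ?thesis by (simp add: g_def kernel_K_def radial_def)
  qed
  \<comment> \<open>The two sums are a quarter of g(\<eta>) + g(-\<eta>) and of g(\<eta>) -
    g(-\<eta>); doubled and added they give g(\<eta>).\<close>
  moreover have "(\<lambda>n. mathieu_Ie n h \<xi> * ce n \<eta> * mathieu_Ke n h \<xi>\<^sub>0 * ce n \<eta>\<^sub>0) sums ((g \<eta> + g (- \<eta>)) / 4)"
    using sums_divide[OF even, of 4] by simp
  moreover have "(\<lambda>n. mathieu_Io (Suc n) h \<xi> * se (Suc n) \<eta> * mathieu_Ko (Suc n) h \<xi>\<^sub>0 * se (Suc n) \<eta>\<^sub>0)
      sums ((g \<eta> - g (- \<eta>)) / 4)"
    using sums_divide[OF odd, of 4] by simp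
  ultimately show ?thesis by (simp add: sums_iff)
qed

end
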